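(* Let $W^1(t),\dots,W^d(t)$ be independent standard Brownian motions, and let $T>0$. Then with probability 1, for all $f=(f^i_j)\in C^2$ (and all $y_0\in\mathbb{R}^n$) the equation $$dy^i=\sum_{j=1}^d f^i_j(y)\,dW^j,\qquad y^i(0)=y^i_0,\quad i=1,\dots,n,$$ has a unique solution in the pathwise sense defined in the context; that is, there are $0<\tau\le T$ and a solution $y$ for $0\le t<\tau$ such that if $\tau<T$ then $|y(t)|\to\infty$ as $t\to\tau$, and if $t<\tau$ and $\tilde y$ is any solution on $[0,t]$ with the same initial value, then $\tilde y=y$ on $[0,t]$.
   Context: $n,d$ are positive integers. $C^2$ here means: the set of $f=(f^i_j)_{1\le i\le n,\,1\le j\le d}$, $f^i_j:\mathbb{R}^n\to\mathbb{R}$, whose first derivatives exist and are locally Lipschitz (continuous second derivatives are not required). $A^{rj}(s,t)$ denotes either the Itô iterated integral $\int_s^t(W^r(u)-W^r(s))\,dW^j(u)$ (for all $r,j$) or the Stratonovich one (which equals the Itô one for $r\neq j$ and equals $\frac12(W^j(t)-W^j(s))^2$ for $r=j$), taken in a version for which, with probability 1, for all $s\le t\le u$, $A^{rj}(s,u)=A^{rj}(s,t)+A^{rj}(t,u)+(W^r(t)-W^r(s))(W^j(u)-W^j(t))$, and for every $p>2$ and every bounded interval there is a constant $c$ with $|W(t)-W(s)|\le c(t-s)^{1/p}$ and $|A^{rj}(s,t)|\le c(t-s)^{2/p}$ on that interval. Solution (for a fixed path): $y:[0,t_1]\to\mathbb{R}^n$ is a solution on $[0,t_1]$ if $y(0)=y_0$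 and there exist a continuous increasing function $\tilde\omega$ on $[0,t_1]$ and a non-negative function $\theta$ on $[0,\infty)$ with $\theta(\delta)=o(\delta)$ as $\delta\to0$ such that for all $i$ and all $0\le s<t\le t_1$ $$\Big|y^i(t)-y^i(s)-\sum_j f^i_j(y(s))(W^j(t)-W^j(s))-\sum_{h,r,j}f^h_r(y(s))\,\partial_hf^i_j(y(s))\,A^{rj}(s,t)\Big|\le\theta(\tilde\omega(t)-\tilde\omega(s)),$$ where $h$ runs over $1,\dots,n$ and $r,j$ over $1,\dots,d$. A solution for $0\le t<\tau$ is a function on $[0,\tau)$ whose restriction to $[0,t_1]$ is a solution on $[0,t_1]$ for every $t_1<\tau$. *)

theory Defs
  imports "HOL-Probability.Probability" "HOL-Library.Landau_Symbols"
begin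

section \<open>Brownian motion\<close>

definition standard_brownian_motion :: "'a measure \<Rightarrow> (real \<Rightarrow> 'a \<Rightarrow> real) \<Rightarrow> bool" where
  "standard_brownian_motion M B \<longleftrightarrow>
     prob_space M \<and>
     (\<forall>t\<ge>0. B t \<in> borel_measurable M) \<and>
     (AE \<omega> in M. B 0 \<omega> = 0) \<and>
     (\<forall>s t. 0 \<le> s \<and> s < t \<longrightarrow>
        distributed M lborel (\<lambda>\<omega>. B t \<omega> - B s \<omega>) (normal_density 0 (sqrt (t - s)))) \<and>
     (\<forall>N (p :: nat \<Rightarrow> real). 0 \<le> p 0 \<and> mono_on {..N} p \<longrightarrow>
        prob_space.indep_vars M (\<lambda>_. borel) (\<lambda>k \<omega>. B (p (Suc k)) \<omega> - B (p k) \<omega>) {..<N}) \<and>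
     (AE \<omega> in M. continuous_on {0..} (\<lambda>t. B t \<omega>))"

text \<open>Independence is that of the whole processes, seen as random elements of the product
  space of real functions on the half-line.\<close>

definition independent_brownian_motions ::
    "'a measure \<Rightarrow> ('d \<Rightarrow> real \<Rightarrow> 'a \<Rightarrow> real) \<Rightarrow> bool" where
  "independent_brownian_motions M W \<longleftrightarrow>
     (\<forall>j. standard_brownian_motion M (W j)) \<and>
     prob_space.indep_vars M (\<lambda>_. PiM {0..} (\<lambda>_. borel)) (\<lambda>j \<omega>. \<lambda>t\<in>{0..}. W j t \<omega>) UNIV"

definition natural_filtration ::
    "'a measure \<Rightarrow> ('d \<Rightarrow> real \<Rightarrow> 'a \<Rightarrow> real) \<Rightarrow> real \<Rightarrow> 'a measure" where
  "natural_filtration M W t =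
     sigma (space M) {W j s -` S \<inter> space M | j s S. 0 \<le> s \<and> s \<le> t \<and> S \<in> sets borel}"


section \<open>The Ito integral of square integrable integrands\<close>

definition simple_integrand ::
    "'a measure \<Rightarrow> (real \<Rightarrow> 'a measure) \<Rightarrow> real \<Rightarrow> real \<Rightarrow>
     nat \<Rightarrow> (nat \<Rightarrow> real) \<Rightarrow> (nat \<Rightarrow> 'a \<Rightarrow> real) \<Rightarrow> bool" where
  "simple_integrand M F s t N p e \<longleftrightarrow>
     p 0 = s \<and> p N = t \<and> mono_on {..N} p \<and>
     (\<forall>k<N. e k \<in> borel_measurable (F (p k)) \<and> integrable M (\<lambda>\<omega>. (e k \<omega>)\<^sup>2))"

definition simple_process ::
    "nat \<Rightarrow> (nat \<Rightarrow> real) \<Rightarrow> (nat \<Rightarrow> 'a \<Rightarrow> real) \<Rightarrow> real \<Rightarrow> 'a \<Rightarrow> real" where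
  "simple_process N p e u \<omega> = (\<Sum>k<N. e k \<omega> * indicator {p k..<p (Suc k)} u)"

definition simple_integral ::
    "nat \<Rightarrow> (nat \<Rightarrow> real) \<Rightarrow> (nat \<Rightarrow> 'a \<Rightarrow> real) \<Rightarrow> (real \<Rightarrow> 'a \<Rightarrow> real) \<Rightarrow> 'a \<Rightarrow> real" where
  "simple_integral N p e B \<omega> = (\<Sum>k<N. e k \<omega> * (B (p (Suc k)) \<omega> - B (p k) \<omega>))"

text \<open>\<open>has_ito_integral M F B s t X I\<close>: the random variable \<open>I\<close> is (a version of) the integral
  of \<open>X\<close> against the Brownian motion \<open>B\<close> over \<open>[s, t]\<close>, i.e. the mean square limit of the
  integrals of simple adapted processes that converge to \<open>X\<close> in mean square on
  \<open>[s, t] \<times> space M\<close>. The time integral is outermost so that no joint measurability is needed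
  when paths are continuous only almost surely.\<close>

definition has_ito_integral ::
    "'a measure \<Rightarrow> (real \<Rightarrow> 'a measure) \<Rightarrow> (real \<Rightarrow> 'a \<Rightarrow> real) \<Rightarrow> real \<Rightarrow> real \<Rightarrow>
     (real \<Rightarrow> 'a \<Rightarrow> real) \<Rightarrow> ('a \<Rightarrow> real) \<Rightarrow> bool" where
  "has_ito_integral M F B s t X I \<longleftrightarrow>
     I \<in> borel_measurable M \<and>
     (\<exists>N p e.
        (\<forall>m. simple_integrand M F s t (N m) (p m) (e m)) \<and>
        (\<lambda>m. \<integral>\<^sup>+u\<in>{s..t}. (\<integral>\<^sup>+\<omega>. ennreal ((simple_process (N m) (p m) (e m) u \<omega> - X u \<omega>)\<^sup>2) \<partial>M)
              \<partial>lborel) \<longlonglongrightarrow> 0 \<and>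
        (\<lambda>m. \<integral>\<^sup>+\<omega>. ennreal ((simple_integral (N m) (p m) (e m) B \<omega> - I \<omega>)\<^sup>2) \<partial>M) \<longlonglongrightarrow> 0)"

definition is_iterated_integral ::
    "'a measure \<Rightarrow> ('d \<Rightarrow> real \<Rightarrow> 'a \<Rightarrow> real) \<Rightarrow> 'd \<Rightarrow> 'd \<Rightarrow> real \<Rightarrow> real \<Rightarrow> ('a \<Rightarrow> real) \<Rightarrow> bool" where
  "is_iterated_integral M W r j s t I \<longleftrightarrow>
     has_ito_integral M (natural_filtration M W) (W j) s t (\<lambda>u \<omega>. W r u \<omega> - W r s \<omega>) I"

definition ito_iterated ::
    "'a measure \<Rightarrow> ('d \<Rightarrow> real \<Rightarrow> 'a \<Rightarrow> real) \<Rightarrow>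
     ('d \<Rightarrow> 'd \<Rightarrow> real \<Rightarrow> real \<Rightarrow> 'a \<Rightarrow> real) \<Rightarrow> bool" where
  "ito_iterated M W A \<longleftrightarrow>
     (\<forall>r j s t. 0 \<le> s \<and> s \<le> t \<longrightarrow> is_iterated_integral M W r j s t (A r j s t))"

definition stratonovich_iterated ::
    "'a measure \<Rightarrow> ('d \<Rightarrow> real \<Rightarrow> 'a \<Rightarrow> real) \<Rightarrow>
     ('d \<Rightarrow> 'd \<Rightarrow> real \<Rightarrow> real \<Rightarrow> 'a \<Rightarrow> real) \<Rightarrow> bool" where
  "stratonovich_iterated M W A \<longleftrightarrow>
     (\<forall>r j s t. 0 \<le> s \<and> s \<le> t \<longrightarrow>
        (if r = j then AE \<omega> in M. A j j s t \<omega> = (W j t \<omega> - W j s \<omega>)\<^sup>2 / 2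
         else is_iterated_integral M W r j s t (A r j s t)))"


section \<open>Pathwise conditions on the driving signal\<close>

definition chen_relation ::
    "('d \<Rightarrow> real \<Rightarrow> real) \<Rightarrow> ('d \<Rightarrow> 'd \<Rightarrow> real \<Rightarrow> real \<Rightarrow> real) \<Rightarrow> bool" where
  "chen_relation w a \<longleftrightarrow>
     (\<forall>r j s t u. 0 \<le> s \<and> s \<le> t \<and> t \<le> u \<longrightarrow>
        a r j s u = a r j s t + a r j t u + (w r t - w r s) * (w j u - w j t))"

definition rough_hoelder_bounds ::
    "('d::finite \<Rightarrow> real \<Rightarrow> real) \<Rightarrow> ('d \<Rightarrow> 'd \<Rightarrow> real \<Rightarrow> real \<Rightarrow> real) \<Rightarrow> bool" where
  "rough_hoelder_bounds w a \<longleftrightarrow>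
     (\<forall>p>2. \<forall>b. \<exists>c. \<forall>s t. 0 \<le> s \<and> s \<le> t \<and> t \<le> b \<longrightarrow>
        norm ((\<chi> j. w j t - w j s) :: real ^ 'd) \<le> c * (t - s) powr (1 / p) \<and>
        (\<forall>r j. \<bar>a r j s t\<bar> \<le> c * (t - s) powr (2 / p)))"


section \<open>Coefficients and solutions\<close>

definition partial_deriv :: "'n \<Rightarrow> (real ^ 'n \<Rightarrow> real) \<Rightarrow> real ^ 'n \<Rightarrow> real" where
  "partial_deriv h g x = deriv (\<lambda>t. g (x + t *\<^sub>R axis h 1)) 0"

text \<open>This is weaker than the usual \<open>C\<^sup>2\<close>: the first derivatives only have to be locally
  Lipschitz.\<close>

definition C2_coeff :: "('n::finite \<Rightarrow> 'd \<Rightarrow> real ^ 'n \<Rightarrow> real) \<Rightarrow> bool" where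
  "C2_coeff f \<longleftrightarrow>
     (\<forall>i j h. (\<forall>x. (\<lambda>t. f i j (x + t *\<^sub>R axis h 1)) field_differentiable at 0) \<and>
              (\<forall>x. \<exists>\<epsilon>>0. \<exists>L. L-lipschitz_on (ball x \<epsilon>) (partial_deriv h (f i j))))"

text \<open>The condition \<open>\<theta>(\<delta>) = o(\<delta>)\<close> is understood to include \<open>\<delta> = 0\<close>, i.e. \<open>\<theta>(0) = 0\<close>. Without
  this, a function \<open>\<Omega>\<close> that is constant on some interval would impose no condition there.\<close>

definition solution_on ::
    "('n::finite \<Rightarrow> 'd::finite \<Rightarrow> real ^ 'n \<Rightarrow> real) \<Rightarrow> ('d \<Rightarrow> real \<Rightarrow> real) \<Rightarrow>
     ('d \<Rightarrow> 'd \<Rightarrow> real \<Rightarrow> real \<Rightarrow> real) \<Rightarrow> real ^ 'n \<Rightarrow> real \<Rightarrow> (real \<Rightarrow> real ^ 'n) \<Rightarrow> bool" where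
  "solution_on f w a y0 t1 y \<longleftrightarrow>
     y 0 = y0 \<and>
     (\<exists>\<Omega> \<theta> :: real \<Rightarrow> real.
        continuous_on {0..t1} \<Omega> \<and> mono_on {0..t1} \<Omega> \<and>
        (\<forall>\<delta>\<ge>0. 0 \<le> \<theta> \<delta>) \<and> \<theta> 0 = 0 \<and> \<theta> \<in> o[at_right 0](\<lambda>\<delta>. \<delta>) \<and>
        (\<forall>i s t. 0 \<le> s \<and> s < t \<and> t \<le> t1 \<longrightarrow>
           \<bar>y t $ i - y s $ i
             - (\<Sum>j\<in>UNIV. f i j (y s) * (w j t - w j s))
             - (\<Sum>h\<in>UNIV. \<Sum>r\<in>UNIV. \<Sum>j\<in>UNIV.
                  f h r (y s) * partial_deriv h (f i j) (y s) * a r j s t)\<bar>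
           \<le> \<theta> (\<Omega> t - \<Omega> s)))"

definition solution_before ::
    "('n::finite \<Rightarrow> 'd::finite \<Rightarrow> real ^ 'n \<Rightarrow> real) \<Rightarrow> ('d \<Rightarrow> real \<Rightarrow> real) \<Rightarrow>
     ('d \<Rightarrow> 'd \<Rightarrow> real \<Rightarrow> real \<Rightarrow> real) \<Rightarrow> real ^ 'n \<Rightarrow> real \<Rightarrow> (real \<Rightarrow> real ^ 'n) \<Rightarrow> bool" where
  "solution_before f w a y0 \<tau> y \<longleftrightarrow>
     (\<forall>t1. 0 \<le> t1 \<and> t1 < \<tau> \<longrightarrow> solution_on f w a y0 t1 y)"

end

theory Submission
  imports Defs "HOL-Complex_Analysis.Great_Picard" "HOL-Real_Asymp.Real_Asymp"
begin

text \<open>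
  Write \<open>\<phi>\<^sub>s\<^sub>t(x) = x + f(x) W(s,t) + f'(x) f(x) A(s,t)\<close>. By the Chen relation the defect of the flow property
  of \<open>\<phi>\<close> on an interval of length \<open>h\<close> is \<open>O(h\<^sup>3\<^sup>\<alpha>)\<close> with \<open>3 \<alpha> > 1\<close>, so bisection shows that every solution,
  however weak its control \<open>\<theta>(\<Omega>(t) - \<Omega>(s))\<close>, has remainder \<open>y(t) - \<phi>\<^sub>s\<^sub>t(y(s)) = O(h\<^sup>3\<^sup>\<alpha>)\<close>; the same bound for the
  discrete Milstein scheme gives existence by compactness.

  Uniqueness is borderline: the difference of the defects at two points at distance \<open>z\<close> is only \<open>O(z v)\<close>,
  where \<open>v = |W|\<^sup>2 + |A|\<close> is not summable over the dyadic tree. Stopping the bisection at depth \<open>n\<close> leaves an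
  error \<open>exp(- (3 \<alpha> - 1) n ln 2)\<close>, which is amplified by \<open>exp(\<lambda> S\<^sub>n)\<close>, where \<open>S\<^sub>n\<close> is the sum of \<open>v\<close> over the first \<open>n\<close> levels.
  By the Ito isometry \<open>v\<close> has mean square norm \<open>O(h)\<close>, so \<open>S\<^sub>n / n\<close> has mean square norm \<open>O(h)\<close> on an interval of
  length \<open>h\<close>. Fatou's lemma and summation of the squares over all dyadic intervals show that almost surely
  \<open>liminf S\<^sub>n / n\<close> is uniformly small on short dyadic intervals; along a subsequence of depths the amplified error
  then tends to zero. As this null set does not involve \<open>f\<close>, the exceptional event is the same for all coefficients.
\<close>

section \<open>Coefficients\<close>

text \<open>The equation has to be localised before anything global can be said: the coefficients
  are truncated, every estimate is proved for bounded fields with one constant \<open>L\<close>, and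
  a solution is first shown to be bounded, so that some truncation covers it. The difference of
  defects stops at order \<open>z v\<close> because the first derivatives are only Lipschitz: a
  second difference of \<open>F\<close> costs the distance \<open>z\<close> times one full
  displacement, and with the outer increment of \<open>w\<close> this makes two increments and no
  third. Mean squares of \<open>v\<close> are used because means would not do: over the dyadic
  intervals of one level the means add up to order T at every level, whereas the mean squares are of
  order 4^-m on each of 2^m intervals and are summable over m. The amplification rate depends on the
  coefficients, which are chosen after the path; hence smallness is required below every \<eta>. The
  level from which it holds may depend on \<eta> but is common to all intervals, since uniqueness is
  carried across [0, T] from one interval to the next.\<close>

locale smooth_fields =
  fixes F :: "'d::finite \<Rightarrow> 'e::euclidean_space \<Rightarrow> 'e" and D :: "'d \<Rightarrow> 'e \<Rightarrow> 'e \<Rightarrow> 'e" and L :: real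
  assumes L_nonneg: "0 \<le> L"
    and F_deriv: "(F j has_derivative D j x) (at x)"
    and F_bound: "norm (F j x) \<le> L"
    and D_bound: "norm (D j x v) \<le> L * norm v"
    and D_lipschitz: "norm (D j x v - D j y v) \<le> L * norm (x - y) * norm v"
begin

lemma D_linear: "linear (D j x)"
  using F_deriv has_derivative_linear by blast

text \<open>The derivative of the j-th field along the r-th one, that is, the coefficient of
  \<open>a r j\<close> in the second order expansion.\<close>

definition G :: "'d \<Rightarrow> 'd \<Rightarrow> 'e \<Rightarrow> 'e" where "G r j x = D j x (F r x)"

lemma F_lipschitz: "norm (F j x - F j y) \<le> L * norm (x - y)"
  by (rule differentiable_bound[where S=UNIV and f'="D j"])
    (auto intro: F_deriv onorm_bound L_nonneg D_bound)

lemma G_bound: "norm (G r j x) \<le> L * L"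
  using D_bound[of j x "F r x"] mult_left_mono[OF F_bound L_nonneg] unfolding G_def
  by (meson order_trans)

lemma G_lipschitz: "norm (G r j x - G r j y) \<le> 2 * L * L * norm (x - y)"
proof -
  have "G r j x - G r j y = D j x (F r x - F r y) + (D j x (F r y) - D j y (F r y))"
    by (simp add: G_def linear_diff[OF D_linear])
  also have "norm \<dots> \<le> norm (D j x (F r x - F r y)) + norm (D j x (F r y) - D j y (F r y))"
    by (rule norm_triangle_ineq)
  also have "norm (D j x (F r x - F r y)) \<le> L * (L * norm (x - y))"
    using D_bound mult_left_mono[OF F_lipschitz L_nonneg] order_trans by blast
  also have "norm (D j x (F r y) - D j y (F r y)) \<le> L * norm (x - y) * L"
    using D_lipschitz mult_left_mono[OF F_bound] L_nonneg
    by (meson mult_nonneg_nonneg norm_ge_zero order_trans)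
  finally show ?thesis by (simp add: algebra_simps)
qed

lemma F_taylor: "norm (F j y - F j x - D j x (y - x)) \<le> L * (norm (y - x))\<^sup>2"
proof -
  have "norm (F j y - F j x - D j x (y - x)) \<le> norm (y - x) * (L * norm (y - x))"
  proof (rule differentiable_bound_linearization[where S="closed_segment x y" and f'="D j" and ?x0.0=x])
    fix z assume "z \<in> closed_segment x y"
    then have "norm (z - x) \<le> norm (y - x)"
      by (rule segment_bound1)
    then have "norm ((D j z - D j x) v) \<le> L * norm (y - x) * norm v" for v
      using order_trans[OF D_lipschitz] by (simp add: L_nonneg mult_left_mono mult_right_mono)
    then show "onorm (D j z - D j x) \<le> L * norm (y - x)"
      by (intro onorm_bound) (auto simp: L_nonneg)
  qed (auto intro: has_derivative_at_withinI[OF F_deriv]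
      simp: closed_segment_def algebra_simps intro!: exI[where x=t for t])
  then show ?thesis by (simp add: power2_eq_square algebra_simps)
qed

text \<open>Both segments are run through with the same parameter \<theta>. The derivative of the
  difference splits into \<open>D\<close> applied to the difference of the two displacements and a
  difference of \<open>D\<close> at two base points, applied to one displacement. Lipschitz
  continuity of \<open>D\<close> gives the second term and nothing of higher order.\<close>

lemma F_second_difference:
  "norm (F j y' - F j y - (F j x' - F j x)) \<le>
     L * norm ((y' - x') - (y - x)) + L * (norm (y - x) + norm (y' - x')) * norm (x' - x)"
proof -
  define p where "p \<theta> = y + \<theta> *\<^sub>R (y' - y)" for \<theta> :: real
  define q where "q \<theta> = x + \<theta> *\<^sub>R (x' - x)" for \<theta> :: real
  define B where "B = L * norm ((y' - x') - (y - x)) + L * (norm (y - x) + norm (y' - x')) * norm (x' - x)"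
  have B: "0 \<le> B" unfolding B_def using L_nonneg by simp
  let ?h = "\<lambda>\<theta>. F j (p \<theta>) - F j (q \<theta>)"
  have "norm (?h 1 - ?h 0) \<le> B * norm (1 - 0 :: real)"
  proof (rule differentiable_bound[where S="{0..1}"
        and f'="\<lambda>\<theta> h. D j (p \<theta>) (h *\<^sub>R (y' - y)) - D j (q \<theta>) (h *\<^sub>R (x' - x))"])
    fix \<theta> :: real assume \<theta>: "\<theta> \<in> {0..1}"
    show "(?h has_derivative (\<lambda>h. D j (p \<theta>) (h *\<^sub>R (y' - y)) - D j (q \<theta>) (h *\<^sub>R (x' - x)))) (at \<theta> within {0..1})"
      unfolding p_def q_def
      by (rule has_derivative_diff; rule has_derivative_compose[OF _ F_deriv])
        (auto intro!: derivative_eq_intros)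
    show "onorm (\<lambda>h. D j (p \<theta>) (h *\<^sub>R (y' - y)) - D j (q \<theta>) (h *\<^sub>R (x' - x))) \<le> B"
    proof (rule onorm_bound[OF B])
      fix h :: real
      have "D j (p \<theta>) (h *\<^sub>R (y' - y)) - D j (q \<theta>) (h *\<^sub>R (x' - x))
         = h *\<^sub>R (D j (p \<theta>) ((y' - x') - (y - x)) + (D j (p \<theta>) (x' - x) - D j (q \<theta>) (x' - x)))"
        by (simp add: linear_diff[OF D_linear] linear_add[OF D_linear] linear_scale[OF D_linear] algebra_simps)
      also have "norm \<dots> \<le> \<bar>h\<bar> * B"
      proof -
        have "p \<theta> - q \<theta> = (1 - \<theta>) *\<^sub>R (y - x) + \<theta> *\<^sub>R (y' - x')"
          by (simp add: p_def q_def algebra_simps)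
        then have "norm (p \<theta> - q \<theta>) \<le> \<bar>1 - \<theta>\<bar> * norm (y - x) + \<bar>\<theta>\<bar> * norm (y' - x')"
          by (metis norm_scaleR norm_triangle_ineq)
        also have "\<dots> \<le> norm (y - x) + norm (y' - x')"
          using \<theta> by (intro add_mono mult_left_le_one_le) auto
        finally have "norm (D j (p \<theta>) (x' - x) - D j (q \<theta>) (x' - x))
            \<le> L * (norm (y - x) + norm (y' - x')) * norm (x' - x)"
          by (intro order_trans[OF D_lipschitz] mult_right_mono mult_left_mono L_nonneg) auto
        then have "norm (D j (p \<theta>) ((y' - x') - (y - x)) + (D j (p \<theta>) (x' - x) - D j (q \<theta>) (x' - x))) \<le> B"
          unfolding B_def by (intro order_trans[OF norm_triangle_ineq] add_mono D_bound)
        then show ?thesis by (simp add: mult_left_mono)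
      qed
      finally show "norm (D j (p \<theta>) (h *\<^sub>R (y' - y)) - D j (q \<theta>) (h *\<^sub>R (x' - x))) \<le> B * norm h"
        by (simp add: mult.commute)
    qed
  qed auto
  then show ?thesis unfolding B_def p_def q_def by (simp add: algebra_simps)
qed

end

text \<open>Since \<open>2\<^sup>\<beta> > 2\<close> the error terms shrink under bisection, and the factors \<open>1 + C h\<^sup>\<alpha>\<close> are absorbed
  by the weight \<open>exp (a h\<^sup>\<alpha>)\<close>.\<close>

lemma sewing_bound:
  fixes J :: "real \<Rightarrow> real \<Rightarrow> real" and E :: "real \<Rightarrow> real"
  assumes \<delta>: "0 < \<delta>" and \<alpha>: "0 < \<alpha>" and \<beta>: "1 < \<beta>"
    and nonneg: "0 \<le> C" "0 \<le> C'" "0 \<le> B" "mono_on {lo..hi} E"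
    and a: "C + a * 2 powr - \<alpha> \<le> a" "0 \<le> a"
    and B: "B * 2 powr (1 - \<beta>) + C' \<le> B"
    and base: "\<And>s u. lo \<le> s \<Longrightarrow> u \<le> hi \<Longrightarrow> \<delta> / 2 < u - s \<Longrightarrow> u - s \<le> \<delta> \<Longrightarrow>
        J s u \<le> exp (a * (u - s) powr \<alpha>) * (B * (u - s) powr \<beta> + E u - E s)"
    and split: "\<And>s u. lo \<le> s \<Longrightarrow> u \<le> hi \<Longrightarrow> \<delta> < u - s \<Longrightarrow>
        J s u \<le> (1 + C * (u - s) powr \<alpha>) * (J s ((s + u) / 2) + J ((s + u) / 2) u) + C' * (u - s) powr \<beta>"
  shows "lo \<le> s \<Longrightarrow> u \<le> hi \<Longrightarrow> \<delta> / 2 < u - s \<Longrightarrow>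
     J s u \<le> exp (a * (u - s) powr \<alpha>) * (B * (u - s) powr \<beta> + E u - E s)"
proof -
  \<comment> \<open>Induction on the number of halvings. An interval longer than \<delta> has halves
    longer than \<delta> / 2, so the recursion always ends in the window of the base estimate and
    never falls below it.\<close>
  have "\<And>s u. lo \<le> s \<Longrightarrow> u \<le> hi \<Longrightarrow> \<delta> / 2 < u - s \<Longrightarrow> u - s \<le> \<delta> * 2 ^ n \<Longrightarrow>
     J s u \<le> exp (a * (u - s) powr \<alpha>) * (B * (u - s) powr \<beta> + E u - E s)" for n :: nat
  proof (induction n)
    case 0
    then show ?case using base by simp
  next
    case (Suc n)
    show ?case
    proof (cases "u - s \<le> \<delta>")
      case True
      then show ?thesis using base Suc.prems by simp
    next
      case False
      define h where "h = u - s"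
      define t where "t = (s + u) / 2"
      have h: "0 < h" "t - s = h / 2" "u - t = h / 2" "\<delta> < h" "s \<le> t" "t \<le> u" using False \<delta> by (auto simp: h_def t_def field_simps)
      have hp: "(h / 2) powr x = 2 powr - x * h powr x" for x
        using h by (simp add: powr_divide powr_minus field_simps)
      have IH1: "J s t \<le> exp (a * (h / 2) powr \<alpha>) * (B * (h / 2) powr \<beta> + E t - E s)"
        and IH2: "J t u \<le> exp (a * (h / 2) powr \<alpha>) * (B * (h / 2) powr \<beta> + E u - E t)"
        using Suc.IH[of s t] Suc.IH[of t u] Suc.prems h \<delta> unfolding h(2,3) by (auto simp: h_def)
      have E: "E s \<le> E u" using nonneg(4) Suc.prems \<delta> by (auto intro: mono_onD)
      let ?R = "2 * B * (h / 2) powr \<beta> + E u - E s"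
      have R: "0 \<le> ?R" using E mult_nonneg_nonneg[OF nonneg(3) powr_ge_zero, of "h / 2" \<beta>] by simp
      \<comment> \<open>The values \<open>E t\<close> cancel when the two halves are added, so the
        additive error does not grow under bisection.\<close>
      have "J s t + J t u \<le> exp (a * (h / 2) powr \<alpha>) * ?R"
        using IH1 IH2 by (simp add: algebra_simps)
      then have "(1 + C * h powr \<alpha>) * (J s t + J t u) \<le> (1 + C * h powr \<alpha>) * (exp (a * (h / 2) powr \<alpha>) * ?R)"
        using nonneg by (intro mult_left_mono) auto
      also have "\<dots> \<le> exp (C * h powr \<alpha>) * (exp (a * (h / 2) powr \<alpha>) * ?R)"
        using R exp_ge_add_one_self by (intro mult_right_mono mult_nonneg_nonneg) auto
      also have "\<dots> = exp (C * h powr \<alpha> + a * (h / 2) powr \<alpha>) * ?R"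
        by (simp add: exp_add)
      also have "\<dots> \<le> exp (a * h powr \<alpha>) * ?R"
      proof (intro mult_right_mono)
        have "(C + a * 2 powr - \<alpha>) * h powr \<alpha> \<le> a * h powr \<alpha>"
          using a by (intro mult_right_mono) auto
        then show "exp (C * h powr \<alpha> + a * (h / 2) powr \<alpha>) \<le> exp (a * h powr \<alpha>)"
          by (simp add: hp algebra_simps)
      qed (use R in auto)
      finally have 1: "(1 + C * h powr \<alpha>) * (J s t + J t u) \<le> exp (a * h powr \<alpha>) * ?R" .
      have 2: "C' * h powr \<beta> \<le> exp (a * h powr \<alpha>) * (C' * h powr \<beta>)"
        using a mult_nonneg_nonneg[OF nonneg(2) powr_ge_zero, of h \<beta>]
          mult_right_mono[of 1 "exp (a * h powr \<alpha>)" "C' * h powr \<beta>"] by simp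
      have "J s u \<le> exp (a * h powr \<alpha>) * (?R + C' * h powr \<beta>)"
        using split[of s u] Suc.prems False 1 2 by (simp add: h_def t_def algebra_simps)
      also have "\<dots> \<le> exp (a * h powr \<alpha>) * (B * h powr \<beta> + E u - E s)"
      proof (intro mult_left_mono)
        \<comment> \<open>Two halves, each with the factor 2^-\<beta>, give 2^(1-\<beta>); the
          condition on \<open>B\<close> leaves room for the new error \<open>C'\<close>.\<close>
        have "(B * 2 powr (1 - \<beta>) + C') * h powr \<beta> \<le> B * h powr \<beta>"
          using B by (intro mult_right_mono) auto
        moreover have "2 * B * (h / 2) powr \<beta> = B * 2 powr (1 - \<beta>) * h powr \<beta>"
          by (simp add: hp powr_diff powr_minus field_simps)
        ultimately show "?R + C' * h powr \<beta> \<le> B * h powr \<beta> + E u - E s"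
          by (simp only: distrib_right)
      qed auto
      finally show ?thesis by (simp add: h_def)
    qed
  qed note * = this
  assume "lo \<le> s" "u \<le> hi" "\<delta> / 2 < u - s"
  moreover obtain n :: nat where "(u - s) / \<delta> < 2 ^ n"
    using real_arch_pow[of 2 "(u - s) / \<delta>"] by auto
  ultimately show ?thesis using *[of s u n] \<delta> by (simp add: field_simps)
qed

section \<open>Total derivatives from Lipschitz partial derivatives\<close>

lemma taylor_of_partials:
  fixes g :: "real ^ 'n::finite \<Rightarrow> real" and p :: "'n \<Rightarrow> real ^ 'n \<Rightarrow> real"
  assumes partial: "\<And>h x. ((\<lambda>t. g (x + t *\<^sub>R axis h 1)) has_real_derivative p h x) (at 0)"
    and lip: "\<And>h x y. \<bar>p h x - p h y\<bar> \<le> L * norm (x - y)" and L: "0 \<le> L"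
  shows "\<bar>g y - g x - (\<Sum>h\<in>UNIV. p h x * (y - x) $ h)\<bar> \<le> real CARD('n) * L * (norm (y - x))\<^sup>2"
proof -
  \<comment> \<open>A mixed point with the coordinates in \<open>S\<close> taken from y and the
    others from x. Enlarging \<open>S\<close> by one index changes one coordinate, so only
    derivatives in one variable occur, and every coordinate stays between those of x and y.\<close>
  define m where "m S = (\<chi> h. if h \<in> S then y $ h else x $ h)" for S
  have "\<bar>g (m S) - g x - (\<Sum>h\<in>S. p h x * (y - x) $ h)\<bar> \<le> real (card S) * L * (norm (y - x))\<^sup>2" if "finite S" for S
    using that
  proof (induction S)
    case empty
    have "m {} = x" by (simp add: m_def vec_eq_iff)
    then show ?case by simp
  next
    case (insert h S)
    define d where "d = (y - x) $ h"
    have m: "m (insert h S) = m S + d *\<^sub>R axis h 1"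
      using insert.hyps by (auto simp: m_def vec_eq_iff axis_def d_def)
    \<comment> \<open>With the linear part at x removed, the derivative is a difference of values of
      \<open>p h\<close>, to which the Lipschitz bound applies.\<close>
    let ?\<phi> = "\<lambda>t. g (m S + t *\<^sub>R axis h 1) - p h x * t"
    have "norm (?\<phi> d - ?\<phi> 0) \<le> (L * norm (y - x)) * norm (d - 0)"
    proof (rule field_differentiable_bound[where S="closed_segment 0 d" and f'="\<lambda>t. p h (m S + t *\<^sub>R axis h 1) - p h x"])
      fix t assume t: "t \<in> closed_segment 0 d"
      have "((\<lambda>s. g ((m S + t *\<^sub>R axis h 1) + s *\<^sub>R axis h 1)) has_real_derivative p h (m S + t *\<^sub>R axis h 1)) (at 0)"
        by (rule partial)
      then have "((\<lambda>s. g (m S + (s + t) *\<^sub>R axis h 1)) has_real_derivative p h (m S + t *\<^sub>R axis h 1)) (at 0)"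
        by (simp add: algebra_simps)
      then have "((\<lambda>s. g (m S + s *\<^sub>R axis h 1)) has_real_derivative p h (m S + t *\<^sub>R axis h 1)) (at (0 + t))"
        by (simp only: DERIV_shift)
      then show "(?\<phi> has_real_derivative p h (m S + t *\<^sub>R axis h 1) - p h x) (at t within closed_segment 0 d)"
        by (auto intro!: derivative_eq_intros intro: has_field_derivative_at_within)
      have "norm (m S + t *\<^sub>R axis h 1 - x) \<le> norm (y - x)"
      proof (rule norm_le_componentwise_cart)
        fix i
        have "\<bar>t\<bar> \<le> \<bar>d\<bar>" using t by (auto simp: closed_segment_eq_real_ivl split: if_splits)
        then show "norm ((m S + t *\<^sub>R axis h 1 - x) $ i) \<le> norm ((y - x) $ i)"
          using insert.hyps by (auto simp: m_def axis_def d_def)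
      qed
      then show "norm (p h (m S + t *\<^sub>R axis h 1) - p h x) \<le> L * norm (y - x)"
        using lip[of h "m S + t *\<^sub>R axis h 1" x] L by (simp add: mult_left_mono order_trans)
    qed auto
    also have "\<dots> \<le> (L * norm (y - x)) * norm (y - x)"
      using L component_le_norm_cart[of "y - x" h] by (intro mult_left_mono) (auto simp: d_def)
    finally have "\<bar>g (m (insert h S)) - g (m S) - p h x * d\<bar> \<le> L * (norm (y - x))\<^sup>2"
      by (simp add: m power2_eq_square algebra_simps)
    moreover have "(\<Sum>i\<in>insert h S. p i x * (y - x) $ i) = p h x * d + (\<Sum>i\<in>S. p i x * (y - x) $ i)"
      using insert.hyps by (simp add: d_def)
    moreover have "real (card (insert h S)) * L * (norm (y - x))\<^sup>2 = L * (norm (y - x))\<^sup>2 + real (card S) * L * (norm (y - x))\<^sup>2"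
      using insert.hyps by (simp add: algebra_simps)
    ultimately show ?case using insert.IH by linarith
  qed
  from this[of UNIV] have "\<bar>g (m UNIV) - g x - (\<Sum>h\<in>UNIV. p h x * (y - x) $ h)\<bar> \<le> real CARD('n) * L * (norm (y - x))\<^sup>2" by simp
  moreover have "m UNIV = y" by (simp add: m_def vec_eq_iff)
  ultimately show ?thesis by simp
qed

lemma has_derivative_of_partials:
  fixes g :: "real ^ 'n::finite \<Rightarrow> real" and p :: "'n \<Rightarrow> real ^ 'n \<Rightarrow> real"
  assumes partial: "\<And>h x. ((\<lambda>t. g (x + t *\<^sub>R axis h 1)) has_real_derivative p h x) (at 0)"
    and lip: "\<And>h x y. \<bar>p h x - p h y\<bar> \<le> L * norm (x - y)" and L: "0 \<le> L"
  shows "(g has_derivative (\<lambda>v. \<Sum>h\<in>UNIV. p h x * v $ h)) (at x)"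
proof (rule has_derivativeI_sandwich[where e=1 and H="\<lambda>y. real CARD('n) * L * norm (y - x)"])
  show "bounded_linear (\<lambda>v. \<Sum>h\<in>UNIV. p h x * v $ h)"
    by (intro bounded_linear_sum bounded_linear_const_mult bounded_linear_vec_nth)
  show "((\<lambda>y. real CARD('n) * L * norm (y - x)) \<longlongrightarrow> 0) (at x)"
    by (rule tendsto_eq_intros refl)+ simp
  fix y assume "y \<noteq> x"
  then show "norm (g y - g x - (\<Sum>h\<in>UNIV. p h x * (y - x) $ h)) / norm (y - x) \<le> real CARD('n) * L * norm (y - x)"
    using taylor_of_partials[OF assms, of y x] by (simp add: divide_le_eq power2_eq_square mult.assoc)
qed simp

text \<open>Coefficients are truncated by composing them coordinatewise with a \<open>C\<^sup>1\<^sup>,\<^sup>1\<close> function that is the identity on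
  \<open>[-R, R]\<close>: the partial derivatives of the composite then need only the chain rule in one variable.\<close>

definition clip :: "real \<Rightarrow> real \<Rightarrow> real" where
  "clip R x = x - (max 0 (x - R))\<^sup>2 / 2 + (max 0 (x - R - 1))\<^sup>2 / 2
     + (max 0 (- x - R))\<^sup>2 / 2 - (max 0 (- x - R - 1))\<^sup>2 / 2"

definition clip_deriv :: "real \<Rightarrow> real \<Rightarrow> real" where
  "clip_deriv R x = 1 - max 0 (x - R) + max 0 (x - R - 1) - max 0 (- x - R) + max 0 (- x - R - 1)"

lemma DERIV_max_square: "((\<lambda>x::real. (max 0 x)\<^sup>2 / 2) has_real_derivative max 0 x) (at x)"
proof -
  consider "x < 0" | "x > 0" | "x = 0" by linarith
  then show ?thesis
  proof cases
    case 1
    have "((\<lambda>x::real. 0) has_real_derivative max 0 x) (at x)" using 1 by simp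
    then show ?thesis
      by (rule has_field_derivative_transform_within_open[where S="{..<0}"]) (use 1 in auto)
  next
    case 2
    have "((\<lambda>x::real. x\<^sup>2 / 2) has_real_derivative max 0 x) (at x)"
      using 2 by (auto intro!: derivative_eq_intros)
    then show ?thesis
      by (rule has_field_derivative_transform_within_open[where S="{0<..}"]) (use 2 in auto)
  next
    case 3
    have "((\<lambda>y::real. ((max 0 y)\<^sup>2 / 2 - (max 0 0)\<^sup>2 / 2) / (y - 0)) \<longlongrightarrow> 0) (at 0)"
    proof (rule Lim_null_comparison)
      show "eventually (\<lambda>y::real. norm (((max 0 y)\<^sup>2 / 2 - (max 0 0)\<^sup>2 / 2) / (y - 0)) \<le> \<bar>y\<bar>) (at 0)"
        by (intro always_eventually allI) (auto simp: max_def power2_eq_square)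
      show "((\<lambda>y::real. \<bar>y\<bar>) \<longlongrightarrow> 0) (at 0)" by (rule tendsto_eq_intros refl)+ simp
    qed
    then show ?thesis unfolding 3 by (simp add: has_field_derivative_iff)
  qed
qed

lemma DERIV_clip: "(clip R has_real_derivative clip_deriv R x) (at x)"
proof -
  have *: "((\<lambda>x. (max 0 (u x))\<^sup>2 / 2) has_real_derivative max 0 (u x) * u') (at x)"
    if "(u has_real_derivative u') (at x)" for u :: "real \<Rightarrow> real" and u'
    using DERIV_chain2[OF DERIV_max_square that] .
  have "((\<lambda>x. (max 0 (x - b))\<^sup>2 / 2) has_real_derivative max 0 (x - b)) (at x)"
    and "((\<lambda>x. (max 0 (- x - b))\<^sup>2 / 2) has_real_derivative - max 0 (- x - b)) (at x)" for b
  proof -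
    have "((\<lambda>x. x - b) has_real_derivative 1) (at x)" "((\<lambda>x. - x - b) has_real_derivative - 1) (at x)"
      by (auto intro!: derivative_eq_intros)
    from *[OF this(1)] *[OF this(2)]
    show "((\<lambda>x. (max 0 (x - b))\<^sup>2 / 2) has_real_derivative max 0 (x - b)) (at x)"
      "((\<lambda>x. (max 0 (- x - b))\<^sup>2 / 2) has_real_derivative - max 0 (- x - b)) (at x)" by auto
  qed
  \<comment> \<open>The terms with threshold R + 1 are the same two derivatives at b = R + 1,
    rewritten from x - (R + 1) to x - R - 1.\<close>
  note d = this this(1)[of "R + 1", unfolded diff_diff_add[symmetric]] this(2)[of "R + 1", unfolded diff_diff_add[symmetric]]
  show ?thesis unfolding clip_def[abs_def] clip_deriv_def
    by (rule DERIV_cong, (rule DERIV_add DERIV_diff DERIV_ident d)+) simp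
qed

lemma clip_deriv_bounds: "0 \<le> R \<Longrightarrow> \<bar>clip_deriv R x\<bar> \<le> 1"
  by (auto simp: clip_deriv_def max_def)

lemma clip_deriv_lipschitz: "\<bar>clip_deriv R x - clip_deriv R y\<bar> \<le> 4 * \<bar>x - y\<bar>"
proof -
  have "\<bar>max 0 u - max 0 v\<bar> \<le> \<bar>u - v\<bar>" for u v :: real by auto
  note * = this[of "x - R" "y - R"] this[of "x - R - 1" "y - R - 1"]
    this[of "- x - R" "- y - R"] this[of "- x - R - 1" "- y - R - 1"]
  have "\<bar>- x - R - (- y - R)\<bar> = \<bar>x - y\<bar>" "\<bar>- x - R - 1 - (- y - R - 1)\<bar> = \<bar>x - y\<bar>" by auto
  moreover have "\<bar>(1 - a1 + a2 - a3 + a4) - (1 - b1 + b2 - b3 + b4)\<bar> \<le> 4 * e"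
    if "\<bar>a1 - b1\<bar> \<le> e" "\<bar>a2 - b2\<bar> \<le> e" "\<bar>a3 - b3\<bar> \<le> e" "\<bar>a4 - b4\<bar> \<le> e"
    for a1 a2 a3 a4 b1 b2 b3 b4 e :: real
    using that by linarith
  ultimately show ?thesis unfolding clip_deriv_def using * by simp
qed

lemma clip_lipschitz: "0 \<le> R \<Longrightarrow> \<bar>clip R x - clip R y\<bar> \<le> \<bar>x - y\<bar>"
  using field_differentiable_bound[of UNIV "clip R" "clip_deriv R" 1 x y] DERIV_clip clip_deriv_bounds
  by auto

lemma clip_id: "\<bar>x\<bar> \<le> R \<Longrightarrow> clip R x = x" "\<bar>x\<bar> \<le> R \<Longrightarrow> clip_deriv R x = 1"
  by (auto simp: clip_def clip_deriv_def max_def)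

text \<open>The slope falls linearly from 1 at R to 0 at R + 1, so the function levels off at R +
  1/2; this is rounded up so that all values lie in \<open>cube (R + 1)\<close>.\<close>

lemma clip_bound: "0 \<le> R \<Longrightarrow> \<bar>clip R x\<bar> \<le> R + 1"
proof -
  assume R: "0 \<le> R"
  consider "\<bar>x\<bar> \<le> R" | "R < x" "x \<le> R + 1" | "R + 1 < x" | "x < - R" "- R - 1 \<le> x" | "x < - R - 1" by linarith
  then show ?thesis
  proof cases
    case 2
    then have "clip R x = x - (x - R)\<^sup>2 / 2" using R by (simp add: clip_def max_def)
    moreover have "(x - R)\<^sup>2 \<le> 1" using 2 by (simp add: power_le_one)
    ultimately show ?thesis using 2 R zero_le_power2[of "x - R"] by (simp only: abs_le_iff) linarith
  next
    case 4
    then have "clip R x = x + (- x - R)\<^sup>2 / 2" using R by (simp add: clip_def max_def)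
    moreover have "(- x - R)\<^sup>2 \<le> 1" using 4 by (simp add: power_le_one)
    ultimately show ?thesis using 4 R zero_le_power2[of "- x - R"] by (simp only: abs_le_iff) linarith
  next
    case 3
    then have "clip R x = R + 1 / 2" using R by (simp add: clip_def max_def power2_eq_square field_simps)
    then show ?thesis using R by simp
  next
    case 5
    then have "clip R x = - R - 1 / 2" using R by (simp add: clip_def max_def power2_eq_square field_simps)
    then show ?thesis using R by simp
  qed (use R in \<open>simp add: clip_id\<close>)
qed

definition clip_vec :: "real \<Rightarrow> real ^ 'n::finite \<Rightarrow> real ^ 'n" where
  "clip_vec R x = (\<chi> h. clip R (x $ h))"

lemma clip_vec_lipschitz: "0 \<le> R \<Longrightarrow> norm (clip_vec R x - clip_vec R y) \<le> norm (x - y)"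
  by (rule norm_le_componentwise_cart) (simp add: clip_vec_def clip_lipschitz)

text \<open>A cube and not a ball: clipping acts on each coordinate separately, so it fixes the
  points of a cube and maps into a cube.\<close>

definition cube :: "real \<Rightarrow> (real ^ 'n::finite) set" where
  "cube R = cbox (\<chi> h. - R) (\<chi> h. R)"

lemma mem_cube: "x \<in> cube R \<longleftrightarrow> (\<forall>h. \<bar>x $ h\<bar> \<le> R)"
  by (auto simp: cube_def mem_box_cart abs_le_iff) (metis minus_le_iff)+

lemma clip_vec_in_cube: "0 \<le> R \<Longrightarrow> clip_vec R x \<in> cube (R + 1)"
  by (simp add: mem_cube clip_vec_def clip_bound)

lemma clip_vec_id: "x \<in> cube R \<Longrightarrow> clip_vec R x = x"
  by (simp add: mem_cube clip_vec_def clip_id vec_eq_iff)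

lemma locally_lipschitz_on_compact:
  fixes g :: "'a::euclidean_space \<Rightarrow> real"
  assumes "\<And>x. \<exists>\<epsilon>>0. \<exists>L. L-lipschitz_on (ball x \<epsilon>) g" and S: "compact S"
  obtains L where "0 \<le> L" "L-lipschitz_on S g"
proof -
  \<comment> \<open>The notion concerns functions depending on time; a single time 0 makes it apply
    to \<open>g\<close>.\<close>
  have "local_lipschitz {0::real} S (\<lambda>_. g)"
  proof (rule local_lipschitzI)
    fix t :: real and x :: 'a
    obtain \<epsilon> L where "\<epsilon> > 0" "L-lipschitz_on (ball x \<epsilon>) g" using assms(1) by blast
    have "L-lipschitz_on (cball x (\<epsilon> / 2) \<inter> S) g"
      by (rule lipschitz_on_subset[OF \<open>L-lipschitz_on (ball x \<epsilon>) g\<close>]) (use \<open>\<epsilon> > 0\<close> in auto)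
    then show "\<exists>u>0. \<exists>L. \<forall>t\<in>cball t u \<inter> {0::real}. L-lipschitz_on (cball x u \<inter> S) g"
      using \<open>\<epsilon> > 0\<close> by (intro exI[of _ "\<epsilon> / 2"]) auto
  qed
  note loc = this
  obtain L where L: "\<And>t::real. t \<in> {0} \<Longrightarrow> L-lipschitz_on S g"
  proof (rule local_lipschitz_compact_implies_lipschitz[OF loc S])
    fix L assume "\<And>t::real. t \<in> {0} \<Longrightarrow> L-lipschitz_on S g"
    then show thesis by (rule that)
  qed auto
  have "L-lipschitz_on S g" by (rule L[of 0]) simp
  from that[OF lipschitz_on_nonneg[OF this] this] show thesis .
qed


lemma bounded_on_cube:
  fixes p :: "real ^ 'n::finite \<Rightarrow> real"
  assumes "L-lipschitz_on (cube R) p" "0 \<le> R"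
  obtains B where "0 \<le> B" "\<And>x. x \<in> cube R \<Longrightarrow> \<bar>p x\<bar> \<le> B"
proof -
  have "compact (p ` cube R)"
    using lipschitz_on_continuous_on[OF assms(1)] by (intro compact_continuous_image) (auto simp: cube_def)
  then obtain B where "\<forall>x\<in>cube R. \<bar>p x\<bar> \<le> B"
    by (auto dest!: compact_imp_bounded simp: bounded_iff)
  then show thesis using that[of "max B 0"] by fastforce
qed

lemma C2_coeff_partial:
  assumes "C2_coeff f"
  shows "((\<lambda>t. f i j (x + t *\<^sub>R axis h 1)) has_real_derivative partial_deriv h (f i j) x) (at 0)"
  using assms unfolding C2_coeff_def partial_deriv_def DERIV_deriv_iff_field_differentiable by blast

context
  fixes f :: "'n::finite \<Rightarrow> 'd::finite \<Rightarrow> real ^ 'n \<Rightarrow> real" and R :: real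
  assumes f: "C2_coeff f" and R: "0 \<le> R"
begin

lemma clipped_partial:
  "((\<lambda>t. f i j (clip_vec R (x + t *\<^sub>R axis h 1))) has_real_derivative
     clip_deriv R (x $ h) * partial_deriv h (f i j) (clip_vec R x)) (at 0)"
proof -
  let ?u = "\<lambda>t. clip R (x $ h + t) - clip R (x $ h)"
  have eq: "clip_vec R (x + t *\<^sub>R axis h 1) = clip_vec R x + ?u t *\<^sub>R axis h 1" for t
    by (auto simp: clip_vec_def vec_eq_iff axis_def)
  have "((\<lambda>t. clip R (t + x $ h)) has_real_derivative clip_deriv R (x $ h)) (at 0)"
    using DERIV_clip[of R "x $ h"] DERIV_shift[of "clip R" "clip_deriv R (x $ h)" 0 "x $ h"] by simp
  then have u: "(?u has_real_derivative clip_deriv R (x $ h)) (at 0)"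
    by (auto intro!: derivative_eq_intros simp: add.commute)
  have "((\<lambda>s. f i j (clip_vec R x + s *\<^sub>R axis h 1)) has_real_derivative partial_deriv h (f i j) (clip_vec R x)) (at (?u 0))"
    using C2_coeff_partial[OF f, of i j "clip_vec R x" h] by simp
  from DERIV_chain2[OF this u] show ?thesis by (simp only: eq mult.commute)
qed

lemma clipped_partial_bounds:
  obtains B where "0 \<le> B" "\<And>x. \<bar>clip_deriv R (x $ h) * partial_deriv h (f i j) (clip_vec R x)\<bar> \<le> B"
    "\<And>x y. \<bar>clip_deriv R (x $ h) * partial_deriv h (f i j) (clip_vec R x)
       - clip_deriv R (y $ h) * partial_deriv h (f i j) (clip_vec R y)\<bar> \<le> B * norm (x - y)"
proof -
  let ?p = "partial_deriv h (f i j)"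
  obtain l where l: "0 \<le> l" "l-lipschitz_on (cube (R + 1)) ?p"
  proof (rule locally_lipschitz_on_compact)
    show "\<exists>\<epsilon>>0. \<exists>L. L-lipschitz_on (ball x \<epsilon>) ?p" for x using f unfolding C2_coeff_def by blast
    show "compact (cube (R + 1) :: (real ^ 'n) set)" by (simp add: cube_def)
  qed
  obtain b where b: "0 \<le> b" "\<And>x. x \<in> cube (R + 1) \<Longrightarrow> \<bar>?p x\<bar> \<le> b"
    using bounded_on_cube[OF l(2)] R by (metis add_nonneg_nonneg zero_le_one)
  have pb: "\<bar>?p (clip_vec R x)\<bar> \<le> b" for x by (intro b clip_vec_in_cube R)
  have pl: "\<bar>?p (clip_vec R x) - ?p (clip_vec R y)\<bar> \<le> l * norm (x - y)" for x y
  proof -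
    have "\<bar>?p (clip_vec R x) - ?p (clip_vec R y)\<bar> \<le> l * norm (clip_vec R x - clip_vec R y)"
      using lipschitz_onD[OF l(2) clip_vec_in_cube[OF R] clip_vec_in_cube[OF R]] by (simp add: dist_norm)
    also have "\<dots> \<le> l * norm (x - y)" by (intro mult_left_mono clip_vec_lipschitz R l)
    finally show ?thesis .
  qed
  show thesis
  \<comment> \<open>Product rule for Lipschitz constants: 4 from \<open>clip_deriv\<close> times the
    bound \<open>b\<close> of the partial derivative, and 1 from \<open>clip_deriv\<close> times the
    constant \<open>l\<close>.\<close>
  proof (rule that[of "4 * b + l"])
    show "0 \<le> 4 * b + l" using b l by simp
    fix x y :: "real ^ 'n"
    let ?c = "\<lambda>x. clip_deriv R (x $ h)" and ?q = "\<lambda>x. ?p (clip_vec R x)"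
    have "\<bar>?c x * ?q x\<bar> \<le> 1 * b"
      unfolding abs_mult by (intro mult_mono pb clip_deriv_bounds R) auto
    then show "\<bar>?c x * ?q x\<bar> \<le> 4 * b + l" using b l by linarith
    have "?c x * ?q x - ?c y * ?q y = (?c x - ?c y) * ?q x + ?c y * (?q x - ?q y)"
      by (simp add: algebra_simps)
    also have "\<bar>\<dots>\<bar> \<le> \<bar>?c x - ?c y\<bar> * \<bar>?q x\<bar> + \<bar>?c y\<bar> * \<bar>?q x - ?q y\<bar>"
      unfolding abs_mult[symmetric] by (rule abs_triangle_ineq)
    also have "\<dots> \<le> (4 * norm (x - y)) * b + 1 * (l * norm (x - y))"
    proof (intro add_mono mult_mono pb pl clip_deriv_bounds R)
      show "\<bar>?c x - ?c y\<bar> \<le> 4 * norm (x - y)"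
        using clip_deriv_lipschitz[of R "x $ h" "y $ h"] component_le_norm_cart[of "x - y" h] by simp
    qed auto
    finally show "\<bar>?c x * ?q x - ?c y * ?q y\<bar> \<le> (4 * b + l) * norm (x - y)"
      by (simp add: algebra_simps)
  qed
qed

lemma clipped_has_derivative:
  "((\<lambda>x. f i j (clip_vec R x)) has_derivative
     (\<lambda>v. \<Sum>h\<in>UNIV. clip_deriv R (x $ h) * partial_deriv h (f i j) (clip_vec R x) * v $ h)) (at x)"
proof -
  have "\<exists>B. 0 \<le> B \<and> (\<forall>x y. \<bar>clip_deriv R (x $ h) * partial_deriv h (f i j) (clip_vec R x)
       - clip_deriv R (y $ h) * partial_deriv h (f i j) (clip_vec R y)\<bar> \<le> B * norm (x - y))" for h
    using clipped_partial_bounds[of h i j] by metis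
  then obtain B where B: "\<And>h. 0 \<le> B h" "\<And>h x y. \<bar>clip_deriv R (x $ h) * partial_deriv h (f i j) (clip_vec R x)
       - clip_deriv R (y $ h) * partial_deriv h (f i j) (clip_vec R y)\<bar> \<le> B h * norm (x - y)" by metis
  show ?thesis
  proof (rule has_derivative_of_partials[OF clipped_partial])
    have "B h \<le> sum B UNIV" for h using B(1) by (intro member_le_sum) auto
    then show "\<bar>clip_deriv R (x $ h) * partial_deriv h (f i j) (clip_vec R x)
       - clip_deriv R (y $ h) * partial_deriv h (f i j) (clip_vec R y)\<bar> \<le> sum B UNIV * norm (x - y)" for h x y
      using B(2) mult_right_mono[OF _ norm_ge_zero] order_trans by blast
    show "0 \<le> sum B UNIV" using B(1) by (intro sum_nonneg) auto
  qed
qed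

end

lemma smooth_fields_cutoff:
  fixes f :: "'n::finite \<Rightarrow> 'd::finite \<Rightarrow> real ^ 'n \<Rightarrow> real"
  assumes f: "C2_coeff f" and R: "0 \<le> R"
  obtains F D L where "smooth_fields F D L"
    "\<And>j i x. norm x \<le> R \<Longrightarrow> F j x $ i = f i j x"
    "\<And>j i x v. norm x \<le> R \<Longrightarrow> D j x v $ i = (\<Sum>h\<in>UNIV. partial_deriv h (f i j) x * v $ h)"
proof -
  define F where "F j x = (\<chi> i. f i j (clip_vec R x))" for j x
  define p where "p i j h x = clip_deriv R (x $ h) * partial_deriv h (f i j) (clip_vec R x)" for i j h x
  define D where "D j x v = (\<chi> i. \<Sum>h\<in>UNIV. p i j h x * v $ h)" for j x v
  have "\<exists>b\<ge>0. \<forall>x. \<bar>f i j (clip_vec R x)\<bar> \<le> b" for i j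
  proof -
    \<comment> \<open>\<open>C2_coeff\<close> speaks only of partial derivatives. On
      \<open>cube (R + 1)\<close> the coefficient agrees with its truncation at R + 1, which has a
      total derivative, and this gives continuity.\<close>
    have "continuous_on (cube (R + 1)) (\<lambda>x. f i j (clip_vec (R + 1) x))"
      using clipped_has_derivative[OF f, of "R + 1" i j] R
      by (intro continuous_at_imp_continuous_on ballI has_derivative_continuous) auto
    then have "continuous_on (cube (R + 1)) (f i j)"
      by (rule continuous_on_eq) (simp add: clip_vec_id)
    then have "compact (f i j ` cube (R + 1))"
      by (intro compact_continuous_image) (auto simp: cube_def)
    then obtain B where "\<forall>x\<in>cube (R + 1). \<bar>f i j x\<bar> \<le> B"
      by (auto dest!: compact_imp_bounded simp: bounded_iff)
    then show ?thesis using clip_vec_in_cube[OF R] by (intro exI[of _ "max B 0"]) (auto simp: le_max_iff_disj)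
  qed
  then obtain b where b: "\<And>i j. 0 \<le> b i j" "\<And>i j x. \<bar>f i j (clip_vec R x)\<bar> \<le> b i j" by metis
  have "\<exists>B\<ge>0. (\<forall>x. \<bar>p i j h x\<bar> \<le> B) \<and> (\<forall>x y. \<bar>p i j h x - p i j h y\<bar> \<le> B * norm (x - y))" for i j h
    using clipped_partial_bounds[OF f R, of h i j] unfolding p_def by metis
  then obtain B where B: "\<And>i j h. 0 \<le> B i j h" "\<And>i j h x. \<bar>p i j h x\<bar> \<le> B i j h"
    "\<And>i j h x y. \<bar>p i j h x - p i j h y\<bar> \<le> B i j h * norm (x - y)" by metis
  \<comment> \<open>Summing all bounds and Lipschitz constants over the indices gives one constant
    for every field.\<close>
  define L where "L = (\<Sum>i\<in>UNIV. \<Sum>j\<in>UNIV. b i j) + (\<Sum>j\<in>UNIV. \<Sum>i\<in>UNIV. \<Sum>h\<in>UNIV. B i j h)"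
  have nn: "0 \<le> (\<Sum>i\<in>UNIV. \<Sum>j\<in>UNIV. b i j)" "0 \<le> (\<Sum>j\<in>UNIV. \<Sum>i\<in>UNIV. \<Sum>h\<in>UNIV. B i j h)"
    using b(1) B(1) by (auto intro!: sum_nonneg)
  have bL: "(\<Sum>i\<in>UNIV. b i j) \<le> L" for j
  proof -
    have "(\<Sum>i\<in>UNIV. b i j) \<le> (\<Sum>i\<in>UNIV. \<Sum>j\<in>UNIV. b i j)"
      using b(1) by (intro sum_mono member_le_sum) auto
    then show ?thesis using nn by (simp add: L_def)
  qed
  have BL: "(\<Sum>i\<in>UNIV. \<Sum>h\<in>UNIV. B i j h) \<le> L" for j
  proof -
    have "(\<Sum>i\<in>UNIV. \<Sum>h\<in>UNIV. B i j h) \<le> (\<Sum>j\<in>UNIV. \<Sum>i\<in>UNIV. \<Sum>h\<in>UNIV. B i j h)"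
      using B(1) by (intro member_le_sum[of j UNIV "\<lambda>j. \<Sum>i\<in>UNIV. \<Sum>h\<in>UNIV. B i j h"] sum_nonneg) auto
    then show ?thesis using nn by (simp add: L_def)
  qed
  \<comment> \<open>Used for the matrix of partial derivatives and again for its difference at two
    points.\<close>
  have sum_bound: "norm (\<chi> i. \<Sum>h\<in>UNIV. q i h * v $ h) \<le> (\<Sum>i\<in>UNIV. \<Sum>h\<in>UNIV. Q i h) * norm v"
    if "\<And>i h. \<bar>q i h\<bar> \<le> Q i h" for q Q :: "'n \<Rightarrow> 'n \<Rightarrow> real" and v :: "real ^ 'n"
  proof -
    have "norm (\<chi> i. \<Sum>h\<in>UNIV. q i h * v $ h) \<le> (\<Sum>i\<in>UNIV. \<bar>\<Sum>h\<in>UNIV. q i h * v $ h\<bar>)"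
      using norm_le_l1_cart[of "\<chi> i. \<Sum>h\<in>UNIV. q i h * v $ h"] by simp
    also have "\<dots> \<le> (\<Sum>i\<in>UNIV. \<Sum>h\<in>UNIV. Q i h * norm v)"
    proof (intro sum_mono order_trans[OF sum_abs])
      fix i h
      show "\<bar>q i h * v $ h\<bar> \<le> Q i h * norm v"
        unfolding abs_mult using that[of i h] by (intro mult_mono component_le_norm_cart) auto
    qed
    finally show ?thesis by (simp add: sum_distrib_right)
  qed
  have "smooth_fields F D L"
  proof
    show "0 \<le> L" using nn by (simp add: L_def)
    show "(F j has_derivative D j x) (at x)" for j x
    proof (subst has_derivative_componentwise_within, intro ballI)
      fix e :: "real ^ 'n" assume "e \<in> Basis"
      then obtain i where e: "e = axis i 1" by (auto simp: Basis_vec_def)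
      show "((\<lambda>x. F j x \<bullet> e) has_derivative (\<lambda>v. D j x v \<bullet> e)) (at x)"
        unfolding e cart_eq_inner_axis[symmetric] F_def D_def p_def vec_lambda_beta
        by (rule clipped_has_derivative[OF f R])
    qed
    show "norm (F j x) \<le> L" for j x
    proof -
      have "norm (F j x) \<le> (\<Sum>i\<in>UNIV. \<bar>f i j (clip_vec R x)\<bar>)"
        using norm_le_l1_cart[of "F j x"] by (simp add: F_def)
      also have "\<dots> \<le> (\<Sum>i\<in>UNIV. b i j)" by (intro sum_mono b)
      finally show ?thesis using bL order_trans by blast
    qed
    show "norm (D j x v) \<le> L * norm v" for j x v
      unfolding D_def using sum_bound[of "\<lambda>i h. p i j h x" "\<lambda>i h. B i j h" v] B(2)
        mult_right_mono[OF BL[of j] norm_ge_zero[of v]] by (meson order_trans)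
    show "norm (D j x v - D j y v) \<le> L * norm (x - y) * norm v" for j x y v
    proof -
      have "D j x v - D j y v = (\<chi> i. \<Sum>h\<in>UNIV. (p i j h x - p i j h y) * v $ h)"
        by (simp add: D_def vec_eq_iff sum_subtractf left_diff_distrib)
      also have "norm \<dots> \<le> (\<Sum>i\<in>UNIV. \<Sum>h\<in>UNIV. B i j h * norm (x - y)) * norm v"
        by (rule sum_bound) (rule B)
      also have "(\<Sum>i\<in>UNIV. \<Sum>h\<in>UNIV. B i j h * norm (x - y)) = (\<Sum>i\<in>UNIV. \<Sum>h\<in>UNIV. B i j h) * norm (x - y)"
        by (simp add: sum_distrib_right)
      also have "\<dots> * norm v \<le> L * norm (x - y) * norm v"
        by (intro mult_right_mono BL) auto
      finally show ?thesis .
    qed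
  qed
  moreover have "norm x \<le> R \<Longrightarrow> x \<in> cube R" for x :: "real ^ 'n"
    using component_le_norm_cart order_trans by (auto simp: mem_cube) blast
  ultimately show thesis
    using that[of F D L] by (auto simp: F_def D_def p_def clip_vec_id mem_cube clip_id)
qed

section \<open>Remainders of approximate solutions\<close>

definition increment_sum :: "('d::finite \<Rightarrow> real \<Rightarrow> real) \<Rightarrow> real \<Rightarrow> real \<Rightarrow> real" where
  "increment_sum w s t = (\<Sum>j\<in>UNIV. \<bar>w j t - w j s\<bar>)"

definition area_sum :: "('d::finite \<Rightarrow> 'd \<Rightarrow> real \<Rightarrow> real \<Rightarrow> real) \<Rightarrow> real \<Rightarrow> real \<Rightarrow> real" where
  "area_sum a s t = (\<Sum>r\<in>UNIV. \<Sum>j\<in>UNIV. \<bar>a r j s t\<bar>)"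

lemma increment_sum_nonneg [simp]: "0 \<le> increment_sum w s t"
  by (simp add: increment_sum_def sum_nonneg)

lemma area_sum_nonneg [simp]: "0 \<le> area_sum a s t"
  by (simp add: area_sum_def sum_nonneg)

locale rough_equation = smooth_fields F D L
  for F :: "'d::finite \<Rightarrow> 'e::euclidean_space \<Rightarrow> 'e" and D :: "'d \<Rightarrow> 'e \<Rightarrow> 'e \<Rightarrow> 'e" and L :: real +
  fixes w :: "'d \<Rightarrow> real \<Rightarrow> real" and a :: "'d \<Rightarrow> 'd \<Rightarrow> real \<Rightarrow> real \<Rightarrow> real" and c \<alpha> T :: real
  assumes chen: "chen_relation w a"
    and increment_bound: "0 \<le> s \<Longrightarrow> s \<le> t \<Longrightarrow> t \<le> T \<Longrightarrow> increment_sum w s t \<le> c * (t - s) powr \<alpha>"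
    and area_bound: "0 \<le> s \<Longrightarrow> s \<le> t \<Longrightarrow> t \<le> T \<Longrightarrow> area_sum a s t \<le> c * (t - s) powr (2 * \<alpha>)"
    and c_nonneg: "0 \<le> c" and \<alpha>_gt: "1 / 3 < \<alpha>" and T_pos: "0 < T"
begin

abbreviation "N1 \<equiv> increment_sum w"
abbreviation "N2 \<equiv> area_sum a"

text \<open>\<open>L\<close> serves \<open>F\<close>, \<open>L * L\<close> bounds \<open>G\<close>,
  and \<open>2 * L * L\<close> is the Lipschitz constant of \<open>G\<close>; the sum serves all
  four estimates.\<close>

definition M :: real where "M = L + L * L + 2 * L * L"

lemma M: "0 \<le> M" "L \<le> M" "norm (F j x) \<le> M" "norm (F j x - F j y) \<le> M * norm (x - y)"
  "norm (G r j x) \<le> M" "norm (G r j x - G r j y) \<le> M * norm (x - y)"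
proof -
  show "0 \<le> M" "L \<le> M" using L_nonneg by (auto simp: M_def)
  then show "norm (F j x) \<le> M" "norm (F j x - F j y) \<le> M * norm (x - y)"
    using F_bound[of j x] order_trans[OF F_lipschitz[of j x y] mult_right_mono, of M] by auto
  have "L * L \<le> M" "2 * L * L \<le> M" using L_nonneg by (auto simp: M_def)
  then show "norm (G r j x) \<le> M" "norm (G r j x - G r j y) \<le> M * norm (x - y)"
    using G_bound[of r j x] order_trans[OF G_lipschitz[of r j x y] mult_right_mono, of M] by auto
qed

text \<open>The increment \<open>\<phi>\<^sub>s\<^sub>t(x) - x\<close> of one Milstein step.\<close>

definition inc :: "real \<Rightarrow> real \<Rightarrow> 'e \<Rightarrow> 'e" where
  "inc s t x = (\<Sum>j\<in>UNIV. (w j t - w j s) *\<^sub>R F j x) + (\<Sum>r\<in>UNIV. \<Sum>j\<in>UNIV. a r j s t *\<^sub>R G r j x)"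

lemma norm_sum_increment:
  assumes "\<And>j. norm (f j) \<le> B"
  shows "norm (\<Sum>j\<in>UNIV. (w j t - w j s) *\<^sub>R f j) \<le> N1 s t * B"
  unfolding increment_sum_def sum_distrib_right
  by (rule sum_norm_le) (simp add: assms mult_left_mono)

lemma norm_sum_area:
  assumes "\<And>r j. norm (f r j) \<le> B"
  shows "norm (\<Sum>r\<in>UNIV. \<Sum>j\<in>UNIV. a r j s t *\<^sub>R f r j) \<le> N2 s t * B"
  unfolding area_sum_def sum_distrib_right
  by (intro sum_norm_le) (simp add: assms mult_left_mono)

lemma inc_bound: "norm (inc s t x) \<le> M * (N1 s t + N2 s t)"
  unfolding inc_def
  using norm_triangle_mono[OF norm_sum_increment[OF M(3)] norm_sum_area[OF M(5)]]
  by (simp add: algebra_simps)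

lemma inc_lipschitz: "norm (inc s t x - inc s t y) \<le> M * (N1 s t + N2 s t) * norm (x - y)"
proof -
  have "inc s t x - inc s t y = (\<Sum>j\<in>UNIV. (w j t - w j s) *\<^sub>R (F j x - F j y))
      + (\<Sum>r\<in>UNIV. \<Sum>j\<in>UNIV. a r j s t *\<^sub>R (G r j x - G r j y))"
    by (simp add: inc_def scaleR_diff_right sum_subtractf)
  also have "norm \<dots> \<le> N1 s t * (M * norm (x - y)) + N2 s t * (M * norm (x - y))"
    by (rule norm_triangle_mono[OF norm_sum_increment[OF M(4)] norm_sum_area[OF M(6)]])
  finally show ?thesis by (simp add: algebra_simps)
qed

text \<open>The second point \<open>x'\<close> is left free: it can be the Milstein point reached
  from \<open>x\<close>, or the value at time t of a path that passes through \<open>x\<close> at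
  time s.\<close>

definition defect :: "real \<Rightarrow> real \<Rightarrow> real \<Rightarrow> 'e \<Rightarrow> 'e \<Rightarrow> 'e" where
  "defect s t u x x' = inc s t x + inc t u x' - inc s u x"

text \<open>By the Chen relation \<open>a r j s u\<close> exceeds the sum of its two parts by a
  product of increments. This product is the first order prediction of
  \<open>F j x' - F j x\<close>, so it is subtracted inside the sum over the increments of
  \<open>w\<close> on [t, u].\<close>

lemma defect_eq:
  assumes "0 \<le> s" "s \<le> t" "t \<le> u"
  shows "defect s t u x x' =
    (\<Sum>j\<in>UNIV. (w j u - w j t) *\<^sub>R (F j x' - F j x - (\<Sum>r\<in>UNIV. (w r t - w r s) *\<^sub>R G r j x)))
    + (\<Sum>r\<in>UNIV. \<Sum>j\<in>UNIV. a r j t u *\<^sub>R (G r j x' - G r j x))"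
proof -
  have a: "a r j s u = a r j s t + a r j t u + (w r t - w r s) * (w j u - w j t)" for r j
    using chen assms unfolding chen_relation_def by blast
  have w: "w j u - w j s = (w j t - w j s) + (w j u - w j t)" for j by simp
  have "inc s u x = (\<Sum>j\<in>UNIV. (w j t - w j s) *\<^sub>R F j x) + (\<Sum>j\<in>UNIV. (w j u - w j t) *\<^sub>R F j x)
      + (\<Sum>r\<in>UNIV. \<Sum>j\<in>UNIV. a r j s t *\<^sub>R G r j x) + (\<Sum>r\<in>UNIV. \<Sum>j\<in>UNIV. a r j t u *\<^sub>R G r j x)
      + (\<Sum>j\<in>UNIV. \<Sum>r\<in>UNIV. ((w r t - w r s) * (w j u - w j t)) *\<^sub>R G r j x)"
    unfolding inc_def w a scaleR_add_left sum.distrib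
    using sum.swap[of "\<lambda>r j. ((w r t - w r s) * (w j u - w j t)) *\<^sub>R G r j x" UNIV UNIV]
    by (simp add: algebra_simps)
  moreover have "(\<Sum>j\<in>UNIV. \<Sum>r\<in>UNIV. ((w r t - w r s) * (w j u - w j t)) *\<^sub>R G r j x)
      = (\<Sum>j\<in>UNIV. (w j u - w j t) *\<^sub>R (\<Sum>r\<in>UNIV. (w r t - w r s) *\<^sub>R G r j x))"
    by (simp add: scaleR_sum_right mult.commute)
  ultimately show ?thesis
    unfolding defect_def inc_def[of s t] inc_def[of t u] scaleR_diff_right sum_subtractf
    by (simp add: algebra_simps)
qed

text \<open>\<open>c1\<close> is the constant in N1 + N2 \<le> c1 h^\<alpha>, where h^(2\<alpha>) is
  traded for T^\<alpha> h^\<alpha>; then C h^\<alpha> is a Lipschitz constant of \<open>inc\<close>.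
  \<open>C1\<close> collects three third order terms: the Taylor remainder, the derivative along the
  second order part of the step, and the change of \<open>G\<close>. \<open>weight\<close> turns the
  condition C + weight 2^-\<alpha> \<le> weight of \<open>sewing_bound\<close> into an
  equality.\<close>

definition c1 :: real where "c1 = c * (1 + T powr \<alpha>)"
definition C :: real where "C = M * c1"
definition C1 :: real where "C1 = c * (L * (M * c1)\<^sup>2 + L * M * c) + c * M * (M * c1)"
definition weight :: real where "weight = C / (1 - 2 powr - \<alpha>)"

lemma c1_nonneg: "0 \<le> c1" and c_le_c1: "c \<le> c1"
  and C_nonneg: "0 \<le> C" and C1_nonneg: "0 \<le> C1"
  using c_nonneg M L_nonneg by (auto simp: c1_def C_def C1_def mult_le_cancel_left1)

lemma weight: "0 \<le> weight" "C + weight * 2 powr - \<alpha> \<le> weight"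
proof -
  have "2 powr - \<alpha> < 2 powr (0::real)" using \<alpha>_gt by (intro powr_less_mono) auto
  then have *: "0 < 1 - 2 powr - \<alpha>" by simp
  then show "0 \<le> weight" using C_nonneg by (simp add: weight_def)
  have "weight * (1 - 2 powr - \<alpha>) = C" unfolding weight_def using less_imp_neq[OF *] by (metis nonzero_divide_eq_eq)
  then show "C + weight * 2 powr - \<alpha> \<le> weight" by (simp add: algebra_simps)
qed

lemma N1_le:
  assumes "0 \<le> s" "s \<le> t" "t \<le> T" "t - s \<le> h"
  shows "N1 s t \<le> c * h powr \<alpha>"
  using assms \<alpha>_gt c_nonneg
  by (intro order_trans[OF increment_bound] mult_left_mono powr_mono2) auto

lemma N2_le:
  assumes "0 \<le> s" "s \<le> t" "t \<le> T" "t - s \<le> h"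
  shows "N2 s t \<le> c * h powr (2 * \<alpha>)"
  using assms \<alpha>_gt c_nonneg
  by (intro order_trans[OF area_bound] mult_left_mono powr_mono2) auto

lemma N12_le:
  assumes "0 \<le> s" "s \<le> t" "t \<le> T" "t - s \<le> h" "h \<le> T"
  shows "N1 s t + N2 s t \<le> c1 * h powr \<alpha>"
proof -
  have "h powr (2 * \<alpha>) = h powr \<alpha> * h powr \<alpha>" by (simp add: powr_add[symmetric])
  also have "\<dots> \<le> T powr \<alpha> * h powr \<alpha>"
    using assms \<alpha>_gt by (intro mult_right_mono powr_mono2) auto
  finally have "c * h powr (2 * \<alpha>) \<le> c * (T powr \<alpha> * h powr \<alpha>)" using c_nonneg mult_left_mono by blast
  then show ?thesis using N1_le[OF assms(1-4)] N2_le[OF assms(1-4)] by (simp add: c1_def algebra_simps)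
qed

lemma inc_le:
  assumes "0 \<le> s" "s \<le> t" "t \<le> T" "t - s \<le> h" "h \<le> T"
  shows "norm (inc s t x) \<le> M * c1 * h powr \<alpha>"
  using order_trans[OF inc_bound mult_left_mono[OF N12_le[OF assms] M(1)]] by (simp add: mult.assoc)

lemma defect_step_bound:
  assumes s: "0 \<le> s" "s \<le> t" "t \<le> u" "u \<le> T" and h: "h = u - s"
  shows "norm (defect s t u x (x + inc s t x)) \<le> C1 * h powr (3 * \<alpha>)"
proof -
  let ?x = "x + inc s t x"
  let ?h = "h powr \<alpha>"
  have hT: "t - s \<le> h" "h \<le> T" "u - t \<le> h" "t \<le> T" "0 \<le> t" using s h by auto
  have h2: "h powr (2 * \<alpha>) = ?h * ?h" by (simp add: powr_add[symmetric])
  have h3: "h powr (3 * \<alpha>) = ?h * (?h * ?h)" by (simp add: powr_add[symmetric])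
  have i: "norm (inc s t x) \<le> M * c1 * ?h" using inc_le s hT by blast
  have 1: "norm (F j ?x - F j x - (\<Sum>r\<in>UNIV. (w r t - w r s) *\<^sub>R G r j x)) \<le> (L * (M * c1)\<^sup>2 + L * M * c) * (?h * ?h)" for j
  proof -
    \<comment> \<open>Along the first order part of the step the derivative reproduces exactly the
      sum of \<open>G\<close> that the defect subtracts; what remains is of second order.\<close>
    have "D j x (inc s t x) = (\<Sum>r\<in>UNIV. (w r t - w r s) *\<^sub>R G r j x)
        + D j x (\<Sum>r\<in>UNIV. \<Sum>l\<in>UNIV. a r l s t *\<^sub>R G r l x)"
      unfolding inc_def by (simp add: linear_add[OF D_linear] linear_sum[OF D_linear] linear_scale[OF D_linear] G_def)
    then have "F j ?x - F j x - (\<Sum>r\<in>UNIV. (w r t - w r s) *\<^sub>R G r j x)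
       = (F j ?x - F j x - D j x (?x - x)) + D j x (\<Sum>r\<in>UNIV. \<Sum>l\<in>UNIV. a r l s t *\<^sub>R G r l x)"
      by (simp add: algebra_simps)
    also have "norm \<dots> \<le> L * (norm (inc s t x))\<^sup>2 + L * (N2 s t * M)"
      using F_taylor[of j ?x x] order_trans[OF D_bound mult_left_mono[OF norm_sum_area[OF M(5)] L_nonneg], of j x s t]
      by (intro norm_triangle_mono) auto
    also have "\<dots> \<le> L * (M * c1 * ?h)\<^sup>2 + L * ((c * (?h * ?h)) * M)"
      using i N2_le[OF s(1,2) hT(4,1)] M L_nonneg h2
      by (intro add_mono mult_left_mono mult_right_mono power_mono) auto
    finally show ?thesis by (simp add: power2_eq_square algebra_simps)
  qed
  have 2: "norm (G r j ?x - G r j x) \<le> M * (M * c1 * ?h)" for r j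
    by (rule order_trans[OF M(6)], rule mult_left_mono) (simp_all add: i M(1))
  have "norm (defect s t u x ?x) \<le> N1 t u * ((L * (M * c1)\<^sup>2 + L * M * c) * (?h * ?h)) + N2 t u * (M * (M * c1 * ?h))"
    unfolding defect_eq[OF s(1-3)]
    by (rule norm_triangle_mono[OF norm_sum_increment[OF 1] norm_sum_area[OF 2]])
  also have "\<dots> \<le> (c * ?h) * ((L * (M * c1)\<^sup>2 + L * M * c) * (?h * ?h)) + (c * (?h * ?h)) * (M * (M * c1 * ?h))"
    using N1_le[OF hT(5) s(3,4) hT(3)] N2_le[OF hT(5) s(3,4) hT(3)] h2 L_nonneg M c1_nonneg c_nonneg
    by (intro add_mono mult_right_mono) auto
  also have "\<dots> = C1 * h powr (3 * \<alpha>)"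
    unfolding h3 by (simp add: C1_def algebra_simps)
  finally show ?thesis .
qed

text \<open>The free point is compared with the Milstein point \<open>x + inc s t x\<close>. The
  Lipschitz bound of \<open>inc t u\<close> charges the deviation to the remainder on [s, t], with a
  small factor.\<close>

lemma defect_bound:
  assumes s: "0 \<le> s" "s \<le> t" "t \<le> u" "u \<le> T" and h: "h = u - s"
  shows "norm (defect s t u x x') \<le> C * h powr \<alpha> * norm (x' - x - inc s t x) + C1 * h powr (3 * \<alpha>)"
proof -
  have *: "defect s t u x x' = (inc t u x' - inc t u (x + inc s t x)) + defect s t u x (x + inc s t x)"
    by (simp add: defect_def)
  have "norm (defect s t u x x') \<le> (M * (N1 t u + N2 t u)) * norm (x' - x - inc s t x) + C1 * h powr (3 * \<alpha>)"
    using inc_lipschitz[of t u x' "x + inc s t x"] defect_step_bound[OF assms]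
    by (subst *, intro norm_triangle_mono) (auto simp: diff_diff_add)
  also have "\<dots> \<le> (M * (c1 * h powr \<alpha>)) * norm (x' - x - inc s t x) + C1 * h powr (3 * \<alpha>)"
    using s h M by (intro add_right_mono mult_right_mono mult_left_mono N12_le) auto
  finally show ?thesis by (simp add: C_def mult.assoc)
qed

definition rem :: "(real \<Rightarrow> 'e) \<Rightarrow> real \<Rightarrow> real \<Rightarrow> 'e" where
  "rem y s t = y t - y s - inc s t (y s)"

lemma rem_split: "rem y s u = rem y s t + rem y t u + defect s t u (y s) (y t)"
  by (simp add: rem_def defect_def)

lemma norm_rem_split:
  assumes "0 \<le> s" "s \<le> t" "t \<le> u" "u \<le> T"
  shows "norm (rem y s u) \<le> (1 + C * (u - s) powr \<alpha>) * (norm (rem y s t) + norm (rem y t u)) + C1 * (u - s) powr (3 * \<alpha>)"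
proof -
  have "norm (rem y s u) \<le> norm (rem y s t) + norm (rem y t u) + norm (defect s t u (y s) (y t))"
    unfolding rem_split[of y s u t] by (intro norm_triangle_le add_right_mono norm_triangle_ineq)
  also have "norm (defect s t u (y s) (y t)) \<le> C * (u - s) powr \<alpha> * norm (rem y s t) + C1 * (u - s) powr (3 * \<alpha>)"
    using defect_bound[OF assms refl] by (simp add: rem_def)
  finally show ?thesis
    using mult_nonneg_nonneg[OF mult_nonneg_nonneg[OF C_nonneg powr_ge_zero], of "norm (rem y t u)" "u - s" \<alpha>]
    by (simp add: algebra_simps)
qed

text \<open>The quotient is the number B with B (1 - 2^(1-3\<alpha>)) = B0 + C1, which meets the
  condition of \<open>sewing_bound\<close> and dominates \<open>B0\<close>; the exponential is the
  weight on an interval of length T.\<close>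

definition K :: "real \<Rightarrow> real" where
  "K B0 = exp (weight * T powr \<alpha>) * ((B0 + C1) / (1 - 2 powr (1 - 3 * \<alpha>)))"

text \<open>An estimate at the scale \<delta> is carried to all larger scales with constants that do
  not depend on \<delta>. For solutions it is used with \<open>B0 = 0\<close> and a small multiple
  of \<Omega> as \<open>E\<close>, for the Milstein scheme with \<open>E = 0\<close>.\<close>

lemma rem_sewing_bound:
  assumes y: "0 \<le> lo" "hi \<le> T" and \<delta>: "0 < \<delta>" and E: "mono_on {lo..hi} E" and B0: "0 \<le> B0"
    and base: "\<And>s u. lo \<le> s \<Longrightarrow> u \<le> hi \<Longrightarrow> \<delta> / 2 < u - s \<Longrightarrow> u - s \<le> \<delta> \<Longrightarrow>
        norm (rem y s u) \<le> B0 * (u - s) powr (3 * \<alpha>) + (E u - E s)"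
    and su: "lo \<le> s" "u \<le> hi" "\<delta> / 2 < u - s"
  shows "norm (rem y s u) \<le> K B0 * (u - s) powr (3 * \<alpha>) + exp (weight * T powr \<alpha>) * (E u - E s)"
proof -
  define q :: real where "q = 1 - 2 powr (1 - 3 * \<alpha>)"
  define B where "B = (B0 + C1) / q"
  have "2 powr (1 - 3 * \<alpha>) < 2 powr (0::real)" using \<alpha>_gt by (intro powr_less_mono) auto
  then have q: "0 < q" "q \<le> 1" by (auto simp: q_def)
  have B: "B * 2 powr (1 - 3 * \<alpha>) + C1 \<le> B" "B0 \<le> B" "0 \<le> B"
  proof -
    have "B * q = B0 + C1" using q by (simp add: B_def)
    then show "B * 2 powr (1 - 3 * \<alpha>) + C1 \<le> B" using B0 by (simp add: q_def algebra_simps)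
    show "0 \<le> B" using q B0 C1_nonneg by (simp add: B_def)
    then show "B0 \<le> B" using \<open>B * q = B0 + C1\<close> q C1_nonneg mult_left_mono[of q 1 B] by simp
  qed
  have "norm (rem y s u) \<le> exp (weight * (u - s) powr \<alpha>) * (B * (u - s) powr (3 * \<alpha>) + E u - E s)"
  proof (rule sewing_bound[where J="\<lambda>s u. norm (rem y s u)", OF \<delta> _ _ C_nonneg C1_nonneg \<open>0 \<le> B\<close> E weight(2,1) B(1) _ _ su])
    fix s u assume *: "lo \<le> s" "u \<le> hi" "\<delta> / 2 < u - s" "u - s \<le> \<delta>"
    have "E s \<le> E u" using * \<delta> E by (auto intro: mono_onD)
    then have "B * (u - s) powr (3 * \<alpha>) + E u - E s \<le> exp (weight * (u - s) powr \<alpha>) * (B * (u - s) powr (3 * \<alpha>) + E u - E s)"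
      using B weight \<open>E s \<le> E u\<close> mult_right_mono[of 1 "exp (weight * (u - s) powr \<alpha>)" "B * (u - s) powr (3 * \<alpha>) + E u - E s"]
      by (auto simp: add_increasing)
    moreover have "B0 * (u - s) powr (3 * \<alpha>) \<le> B * (u - s) powr (3 * \<alpha>)" using B by (simp add: mult_right_mono)
    ultimately show "norm (rem y s u) \<le> exp (weight * (u - s) powr \<alpha>) * (B * (u - s) powr (3 * \<alpha>) + E u - E s)"
      using base[OF *] by linarith
  next
    fix s u assume *: "lo \<le> s" "u \<le> hi" "\<delta> < u - s"
    then show "norm (rem y s u) \<le> (1 + C * (u - s) powr \<alpha>) * (norm (rem y s ((s + u) / 2)) + norm (rem y ((s + u) / 2) u)) + C1 * (u - s) powr (3 * \<alpha>)"
      using y \<delta> by (intro norm_rem_split) auto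
  qed (use \<alpha>_gt in auto)
  also have "\<dots> \<le> exp (weight * T powr \<alpha>) * (B * (u - s) powr (3 * \<alpha>) + E u - E s)"
  proof (intro mult_right_mono)
    have "(u - s) powr \<alpha> \<le> T powr \<alpha>" using su y \<delta> \<alpha>_gt by (intro powr_mono2) auto
    then show "exp (weight * (u - s) powr \<alpha>) \<le> exp (weight * T powr \<alpha>)" using weight by (simp add: mult_left_mono)
    have "E s \<le> E u" using su \<delta> E by (auto intro: mono_onD)
    then show "0 \<le> B * (u - s) powr (3 * \<alpha>) + E u - E s"
      using mult_nonneg_nonneg[OF B(3) powr_ge_zero, of "u - s" "3 * \<alpha>"] by simp
  qed
  finally show ?thesis by (simp add: K_def B_def q_def algebra_simps)
qed

text \<open>At a sufficiently small scale the weak control is at most \<epsilon> times the increment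
  of \<Omega>, and such an error stays additive under bisection. Letting \<epsilon> tend to 0
  removes it altogether, so the final constant \<open>K 0\<close> knows neither \<theta> nor
  \<Omega>.\<close>

lemma rem_strong_bound:
  assumes y: "0 \<le> lo" "hi \<le> T" and \<Omega>: "continuous_on {lo..hi} \<Omega>" "mono_on {lo..hi} \<Omega>"
    and \<theta>: "\<theta> 0 = 0" "\<theta> \<in> o[at_right 0](\<lambda>\<delta>. \<delta>)"
    and weak: "\<And>s t. lo \<le> s \<Longrightarrow> s < t \<Longrightarrow> t \<le> hi \<Longrightarrow> norm (rem y s t) \<le> \<theta> (\<Omega> t - \<Omega> s)"
    and st: "lo \<le> s" "s \<le> t" "t \<le> hi"
  shows "norm (rem y s t) \<le> K 0 * (t - s) powr (3 * \<alpha>)"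
proof (cases "s = t")
  case True
  have "inc t t x = 0" for x
    using inc_bound[of t t x] increment_bound[of t t] area_bound[of t t] increment_sum_nonneg[of w t t] area_sum_nonneg[of a t t] y st M
    by (simp add: True)
  then show ?thesis by (simp add: True rem_def)
next
  case False
  define R where "R = exp (weight * T powr \<alpha>) * (\<Omega> t - \<Omega> s)"
  have R: "0 \<le> R" using mono_onD[OF \<Omega>(2), of s t] st by (simp add: R_def)
  have "norm (rem y s t) \<le> K 0 * (t - s) powr (3 * \<alpha>) + \<epsilon> * R" if \<epsilon>: "0 < \<epsilon>" for \<epsilon>
  proof -
    have "eventually (\<lambda>\<delta>. norm (\<theta> \<delta>) \<le> \<epsilon> * norm \<delta>) (at_right 0)"
      using landau_o.smallD[OF \<theta>(2) \<epsilon>] .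
    then obtain d0 where d0: "0 < d0" "\<And>\<delta>. 0 < \<delta> \<Longrightarrow> \<delta> < d0 \<Longrightarrow> \<bar>\<theta> \<delta>\<bar> \<le> \<epsilon> * \<delta>"
      unfolding eventually_at_right_field by auto
    have "uniformly_continuous_on {lo..hi} \<Omega>" using \<Omega> by (intro compact_uniformly_continuous) auto
    then obtain d1 where d1: "0 < d1" "\<And>x x'. x \<in> {lo..hi} \<Longrightarrow> x' \<in> {lo..hi} \<Longrightarrow> dist x' x < d1 \<Longrightarrow> dist (\<Omega> x') (\<Omega> x) < d0"
      using d0(1) unfolding uniformly_continuous_on_def by metis
    \<comment> \<open>The minimum with t - s ensures \<delta> / 2 < t - s, so that the sewing bound
      covers the given interval.\<close>
    define \<delta> where "\<delta> = min (d1 / 2) (t - s)"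
    have \<delta>: "0 < \<delta>" "\<delta> < d1" "\<delta> \<le> t - s" using d1 st False by (auto simp: \<delta>_def)
    have "norm (rem y s t) \<le> K 0 * (t - s) powr (3 * \<alpha>) + exp (weight * T powr \<alpha>) * (\<epsilon> * \<Omega> t - \<epsilon> * \<Omega> s)"
    proof (rule rem_sewing_bound[OF y \<delta>(1)])
      show "mono_on {lo..hi} (\<lambda>x. \<epsilon> * \<Omega> x)" using \<Omega>(2) \<epsilon> by (auto simp: mono_on_def)
      fix s u assume *: "lo \<le> s" "u \<le> hi" "\<delta> / 2 < u - s" "u - s \<le> \<delta>"
      have "\<Omega> s \<le> \<Omega> u" using * \<delta> \<Omega>(2) by (auto intro: mono_onD)
      moreover have "dist (\<Omega> u) (\<Omega> s) < d0" using * \<delta> by (intro d1) (auto simp: dist_real_def)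
      \<comment> \<open>Where \<Omega> does not increase, the little-o condition is silent, and
        \<theta> 0 = 0 decides.\<close>
      ultimately have "\<bar>\<theta> (\<Omega> u - \<Omega> s)\<bar> \<le> \<epsilon> * (\<Omega> u - \<Omega> s)"
        using d0(2)[of "\<Omega> u - \<Omega> s"] \<theta>(1) by (cases "\<Omega> u = \<Omega> s") (auto simp: dist_real_def)
      then show "norm (rem y s u) \<le> 0 * (u - s) powr (3 * \<alpha>) + (\<epsilon> * \<Omega> u - \<epsilon> * \<Omega> s)"
        using weak[of s u] * \<delta> by (simp add: algebra_simps)
    qed (use st \<delta> in auto)
    then show ?thesis by (simp add: R_def algebra_simps)
  qed
  note * = this
  show ?thesis
  proof (rule field_le_epsilon)
    fix e :: real assume "0 < e"
    then have "e / (R + 1) * R \<le> e" using R by (simp add: field_simps)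
    then show "norm (rem y s t) \<le> K 0 * (t - s) powr (3 * \<alpha>) + e"
      using *[of "e / (R + 1)"] \<open>0 < e\<close> R by (auto simp: add_nonneg_pos)
  qed
qed

end

section \<open>Uniqueness\<close>

text \<open>The pair (m, k) stands for the k-th dyadic interval of length T / 2^m, and 2k, 2k + 1 at
  level m + 1 for its halves; the root counts as the first of the n levels.\<close>

primrec tree_sum :: "(nat \<Rightarrow> nat \<Rightarrow> real) \<Rightarrow> nat \<Rightarrow> nat \<Rightarrow> nat \<Rightarrow> real" where
  "tree_sum V 0 m k = 0"
| "tree_sum V (Suc n) m k = V m k + tree_sum V n (Suc m) (2 * k) + tree_sum V n (Suc m) (2 * k + 1)"

definition dyadic :: "real \<Rightarrow> nat \<Rightarrow> nat \<Rightarrow> real" where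
  "dyadic T m k = T * real k / 2 ^ m"

text \<open>The quantity \<open>v\<close> of the overview. Squaring the increment gives it the order
  of the area.\<close>

definition roughness :: "('d::finite \<Rightarrow> real \<Rightarrow> real) \<Rightarrow> ('d \<Rightarrow> 'd \<Rightarrow> real \<Rightarrow> real \<Rightarrow> real) \<Rightarrow> real \<Rightarrow> real \<Rightarrow> real" where
  "roughness w a s t = (increment_sum w s t)\<^sup>2 + area_sum a s t"

text \<open>The roughness of the two halves of the k-th interval of level m. The length of the
  interval is added because the remainder of a solution, of order 3\<alpha> > 1, is at most a
  multiple of it.\<close>

definition dyadic_roughness :: "('d::finite \<Rightarrow> real \<Rightarrow> real) \<Rightarrow> ('d \<Rightarrow> 'd \<Rightarrow> real \<Rightarrow> real \<Rightarrow> real) \<Rightarrow> real \<Rightarrow> nat \<Rightarrow> nat \<Rightarrow> real" where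
  "dyadic_roughness w a T m k =
     roughness w a (dyadic T (Suc m) (2 * k)) (dyadic T (Suc m) (2 * k + 1))
     + roughness w a (dyadic T (Suc m) (2 * k + 1)) (dyadic T (Suc m) (2 * k + 2))
     + T / 2 ^ m"

text \<open>The Hoelder exponents alone do not seem to give uniqueness for derivatives that are merely
  Lipschitz; this is the additional property of Brownian paths that replaces them.\<close>

definition tame :: "('d::finite \<Rightarrow> real \<Rightarrow> real) \<Rightarrow> ('d \<Rightarrow> 'd \<Rightarrow> real \<Rightarrow> real \<Rightarrow> real) \<Rightarrow> real \<Rightarrow> bool" where
  "tame w a T \<longleftrightarrow> (\<forall>\<eta>>0. \<exists>m0. \<forall>m\<ge>m0. \<forall>k<2 ^ m.
      \<exists>\<^sub>\<infinity>n. tree_sum (dyadic_roughness w a T) n m k \<le> \<eta> * real n)"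

lemma roughness_nonneg [simp]: "0 \<le> roughness w a s t"
  by (simp add: roughness_def)

lemma dyadic_roughness_nonneg: "0 \<le> T \<Longrightarrow> 0 \<le> dyadic_roughness w a T m k"
  by (simp add: dyadic_roughness_def)

lemma tree_sum_nonneg: "(\<And>m k. 0 \<le> V m k) \<Longrightarrow> 0 \<le> tree_sum V n m k"
  by (induction n arbitrary: m k) (auto intro!: add_nonneg_nonneg)

lemma dyadic_halves:
  "dyadic T (Suc m) (2 * k) = dyadic T m k" "dyadic T (Suc m) (2 * k + 2) = dyadic T m (Suc k)"
  "dyadic T m (Suc k) - dyadic T m k = T / 2 ^ m"
  by (simp_all add: dyadic_def field_simps)

text \<open>Bernoulli's inequality for the power 1 + \<kappa> of exp x. It moves the factor 1 +
  \<kappa> into the exponent, where it only multiplies a tree sum.\<close>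

lemma exp_Bernoulli:
  fixes x \<kappa> :: real
  assumes "0 \<le> x" "0 \<le> \<kappa>"
  shows "(1 + \<kappa>) * (exp x - 1) \<le> exp ((1 + \<kappa>) * x) - 1"
proof -
  let ?f = "\<lambda>x. exp ((1 + \<kappa>) * x) - 1 - (1 + \<kappa>) * (exp x - 1)"
  have "?f 0 \<le> ?f x"
  proof (rule DERIV_nonneg_imp_nondecreasing[OF assms(1)])
    fix z :: real assume z: "0 \<le> z" "z \<le> x"
    have "(?f has_real_derivative (1 + \<kappa>) * (exp ((1 + \<kappa>) * z) - exp z)) (at z)"
      by (auto intro!: derivative_eq_intros simp: algebra_simps)
    moreover have "exp z \<le> exp ((1 + \<kappa>) * z)" using z assms by (simp add: algebra_simps)
    ultimately show "\<exists>y. (?f has_real_derivative y) (at z) \<and> 0 \<le> y"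
      using assms by (intro exI[of _ "(1 + \<kappa>) * (exp ((1 + \<kappa>) * z) - exp z)"]) auto
  qed
  then show ?thesis by simp
qed

text \<open>One node of the recursion, with numbers for norms: \<open>z\<close>, \<open>z'\<close>
  are the distances of two paths at the left end and at the midpoint, and \<open>q1\<close>,
  \<open>q2\<close>, \<open>q\<close> the differences of their remainders on the halves and on the
  whole. The form (exp x - 1) z + b exp (x + g) is preserved: the exponents of the halves add up,
  and the defect only adds a multiple of \<open>V\<close> to the exponent.\<close>

lemma tree_step:
  fixes z z' q q1 q2 x1 x2 b g g' \<kappa> \<kappa>m C V X :: real
  assumes nn: "0 \<le> z" "0 \<le> z'" "0 \<le> x1" "0 \<le> x2" "0 \<le> b" "0 \<le> \<kappa>" "\<kappa> \<le> \<kappa>m" "0 \<le> C" "0 \<le> V" "0 \<le> g"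
    and q1: "q1 \<le> (exp x1 - 1) * z + b * exp (x1 + g)"
    and z': "z' \<le> (1 + \<kappa>) * z + q1"
    and q2: "q2 \<le> (exp x2 - 1) * z' + b * exp (x2 + g)"
    and q: "q \<le> (1 + \<kappa>) * q1 + q2 + C * V * (z + z')"
    and X: "(1 + \<kappa>) * (x1 + x2) + C * (2 + \<kappa>m) * V \<le> X" and g': "\<kappa> + g \<le> g'"
  shows "q \<le> (exp X - 1) * z + 2 * b * exp (X + g')"
proof -
  let ?a1 = "exp x1 - 1" and ?a2 = "exp x2 - 1" and ?b1 = "b * exp (x1 + g)" and ?b2 = "b * exp (x2 + g)"
  let ?CV = "C * V"
  have CV: "0 \<le> ?CV" using nn by simp
  have a: "0 \<le> ?a1" "0 \<le> ?a2" using nn by auto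
  have b: "0 \<le> ?b1" "0 \<le> ?b2" using nn by auto
  have z'2: "z' \<le> (1 + \<kappa> + ?a1) * z + ?b1" using z' q1 by (simp add: algebra_simps)
  have "q \<le> (1 + \<kappa>) * (?a1 * z + ?b1) + (?a2 * z' + ?b2) + ?CV * (z + z')"
    using q q2 mult_left_mono[OF q1, of "1 + \<kappa>"] nn by linarith
  also have "\<dots> = (1 + \<kappa>) * (?a1 * z + ?b1) + ?b2 + ?CV * z + (?a2 + ?CV) * z'"
    by (simp add: algebra_simps)
  also have "\<dots> \<le> (1 + \<kappa>) * (?a1 * z + ?b1) + ?b2 + ?CV * z + (?a2 + ?CV) * ((1 + \<kappa> + ?a1) * z + ?b1)"
    using mult_left_mono[OF z'2, of "?a2 + ?CV"] a CV by linarith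
  also have "\<dots> = ((1 + \<kappa>) * (?a1 + ?a2) + ?a1 * ?a2 + ?CV * (2 + \<kappa> + ?a1)) * z
      + ((1 + \<kappa> + ?a2 + ?CV) * ?b1 + ?b2)"
    by (simp add: algebra_simps)
  also have "\<dots> \<le> (exp X - 1) * z + 2 * b * exp (X + g')"
  proof (intro add_mono mult_right_mono)
    define y where "y = x1 + x2"
    have y: "0 \<le> y" "x1 \<le> y" using nn by (auto simp: y_def)
    \<comment> \<open>Enlarging the mixed product by 1 + \<kappa> completes the sum to exp (x1 + x2)
      - 1.\<close>
    have "(1 + \<kappa>) * (?a1 + ?a2) + ?a1 * ?a2 \<le> (1 + \<kappa>) * (?a1 + ?a2 + ?a1 * ?a2)"
      using mult_nonneg_nonneg[OF nn(6) mult_nonneg_nonneg[OF a]] by (simp add: algebra_simps)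
    also have "\<dots> = (1 + \<kappa>) * (exp y - 1)"
      by (simp add: y_def exp_add algebra_simps)
    also have "\<dots> \<le> exp ((1 + \<kappa>) * y) - 1" using exp_Bernoulli y nn by blast
    finally have 1: "(1 + \<kappa>) * (?a1 + ?a2) + ?a1 * ?a2 \<le> exp ((1 + \<kappa>) * y) - 1" .
    \<comment> \<open>Passing from \<kappa> to its upper bound \<open>\<kappa>m\<close> makes the
      coefficient of \<open>V\<close> the same at all levels of the tree.\<close>
    have "2 + \<kappa> + ?a1 \<le> 1 + \<kappa>m + exp x1" using nn by simp
    also have "\<dots> \<le> (1 + \<kappa>m) * exp x1 + exp x1" using mult_left_mono[of 1 "exp x1" "1 + \<kappa>m"] nn by simp
    also have "\<dots> = (2 + \<kappa>m) * exp x1" by (simp add: algebra_simps)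
    also have "\<dots> \<le> (2 + \<kappa>m) * exp ((1 + \<kappa>) * y)"
    proof -
      have "x1 \<le> (1 + \<kappa>) * y" using y nn mult_right_mono[of 1 "1 + \<kappa>" y] by simp
      then show ?thesis using nn by (simp add: mult_left_mono)
    qed
    finally have "?CV * (2 + \<kappa> + ?a1) \<le> ?CV * ((2 + \<kappa>m) * exp ((1 + \<kappa>) * y))"
      using CV mult_left_mono by blast
    with 1 have "(1 + \<kappa>) * (?a1 + ?a2) + ?a1 * ?a2 + ?CV * (2 + \<kappa> + ?a1)
        \<le> exp ((1 + \<kappa>) * y) * (1 + C * (2 + \<kappa>m) * V) - 1"
      by (simp add: algebra_simps)
    also have "\<dots> \<le> exp ((1 + \<kappa>) * y) * exp (C * (2 + \<kappa>m) * V) - 1"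
      by (intro diff_right_mono mult_left_mono exp_ge_add_one_self) auto
    also have "\<dots> \<le> exp X - 1" using X by (simp add: exp_add[symmetric] y_def)
    finally show "(1 + \<kappa>) * (?a1 + ?a2) + ?a1 * ?a2 + ?CV * (2 + \<kappa> + ?a1) \<le> exp X - 1" .
    have CV2: "?CV \<le> C * (2 + \<kappa>m) * V" using CV nn mult_right_mono[of 1 "2 + \<kappa>m" "C * V"]
      by (simp add: algebra_simps)
    have ypos: "x1 + x2 \<le> (1 + \<kappa>) * y" using y nn mult_right_mono[of 1 "1 + \<kappa>" y] by (simp add: y_def)
    \<comment> \<open>The error of the left half enters a second time through \<open>z'\<close>,
      hence the larger coefficient. With the error of the right half there are two terms of size at
      most b exp (X + g'), whence the factor 2.\<close>
    have "1 + \<kappa> + ?a2 + ?CV \<le> exp (\<kappa> + x2 + ?CV)"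
    proof -
      have "exp x2 + \<kappa> + ?CV \<le> exp x2 * (1 + (\<kappa> + ?CV))"
        using mult_right_mono[of 1 "exp x2" "\<kappa> + ?CV"] CV nn by (simp add: algebra_simps)
      also have "\<dots> \<le> exp x2 * exp (\<kappa> + ?CV)" by (intro mult_left_mono exp_ge_add_one_self) auto
      finally show ?thesis by (simp add: exp_add mult_ac add_ac)
    qed
    then have "(1 + \<kappa> + ?a2 + ?CV) * ?b1 \<le> exp (\<kappa> + x2 + ?CV) * ?b1"
      using b by (intro mult_right_mono)
    also have "\<dots> = b * exp (x1 + x2 + ?CV + (\<kappa> + g))" by (simp add: exp_add)
    also have "\<dots> \<le> b * exp (X + g')" using nn CV2 ypos X g' by (intro mult_left_mono) (auto simp: y_def)
    finally have 2: "(1 + \<kappa> + ?a2 + ?CV) * ?b1 \<le> b * exp (X + g')" .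
    have "0 \<le> C * (2 + \<kappa>m) * V" using CV CV2 by linarith
    then have "x2 + g \<le> X + g'" using nn(3,6,4) ypos X g' unfolding y_def by linarith
    then have "?b2 \<le> b * exp (X + g')" using nn by (intro mult_left_mono) auto
    with 2 show "(1 + \<kappa> + ?a2 + ?CV) * ?b1 + ?b2 \<le> 2 * b * exp (X + g')" by linarith
  qed (use nn in auto)
  finally show ?thesis .
qed

text \<open>The termwise comparison for \<open>defect_difference_bound\<close>, where
  \<open>P\<close>, \<open>Q\<close>, \<open>R\<close> are products of an increment over [t, u] with
  a quantity over [s, t], and \<open>m\<close> is the area over [t, u].\<close>

lemma five_terms_mono:
  fixes L M P Q R V W R' l k q z z' m :: real
  assumes "l \<le> k" "P \<le> V" "Q \<le> W" "R \<le> R'" "m \<le> V"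
    and "0 \<le> q" "0 \<le> z" "0 \<le> z'" "0 \<le> L" "0 \<le> M" "0 \<le> P" "0 \<le> Q"
  shows "l * q + L * M * (P + Q) * z + L * (M * (P + Q) + R) * (z + z') + M * P * z + M * m * (z + z')
    \<le> k * q + L * M * (V + W) * (z + z') + L * (M * (V + W) + R') * (z + z') + M * V * (z + z') + M * V * (z + z')"
  using assms by (intro add_mono mult_right_mono mult_left_mono mult_mono mult_nonneg_nonneg add_nonneg_nonneg) auto

context rough_equation
begin

text \<open>The coefficients that multiply \<open>V (z + z')\<close> at the end of
  \<open>defect_difference_bound\<close>; the middle term comes from the remainder of the reference
  path.\<close>

definition C3 :: "real \<Rightarrow> real" where
  "C3 \<kappa> = 2 * L * M * (1 + c * T powr \<alpha>) + L * (\<kappa> * (c * T powr \<alpha>) * T powr (3 * \<alpha> - 1)) + 2 * M"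

lemma C3_nonneg: "0 \<le> \<kappa> \<Longrightarrow> 0 \<le> C3 \<kappa>"
  using L_nonneg M c_nonneg by (simp add: C3_def)

lemma N1_le_const:
  assumes "0 \<le> s" "s \<le> t" "t \<le> T"
  shows "N1 s t \<le> c * T powr \<alpha>"
  using assms by (intro N1_le) auto

text \<open>Only the reference points \<open>p\<close>, \<open>p'\<close> are assumed to nearly
  follow a Milstein step. The points \<open>x\<close>, \<open>x'\<close> are arbitrary, and their
  failure to do so appears through the difference of the two remainders, with a small factor. The
  other terms carry the distance of the paths times a product of two increments or an area.\<close>

lemma defect_difference_bound:
  assumes s: "0 \<le> s" "s \<le> t" "t \<le> u" "u \<le> T" and \<kappa>: "0 \<le> \<kappa>"
    and p: "norm (p' - p - inc s t p) \<le> \<kappa> * (t - s) powr (3 * \<alpha>)"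
  shows "norm (defect s t u x x' - defect s t u p p') \<le>
     C * (u - s) powr \<alpha> * norm ((x' - x - inc s t x) - (p' - p - inc s t p))
     + C3 \<kappa> * (roughness w a s t + roughness w a t u + (u - s)) * (norm (x - p) + norm (x' - p'))"
proof -
  define z where "z = norm (x - p)"
  define z' where "z' = norm (x' - p')"
  define q where "q = norm ((x' - x - inc s t x) - (p' - p - inc s t p))"
  define n1 where "n1 = N1 s t"
  define n2 where "n2 = N2 s t"
  define V where "V = roughness w a s t + roughness w a t u + (u - s)"
  have nn: "0 \<le> z" "0 \<le> z'" "0 \<le> q" "0 \<le> n1" "0 \<le> n2" by (auto simp: z_def z'_def q_def n1_def n2_def)
  \<comment> \<open>The displacements differ by the difference of the two steps, of order
    \<open>z\<close>, and by the difference of the remainders.\<close>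
  have zz: "norm ((x' - p') - (x - p)) \<le> M * (n1 + n2) * z + q"
  proof -
    have *: "(x' - p') - (x - p) = (inc s t x - inc s t p) + ((x' - x - inc s t x) - (p' - p - inc s t p))" by simp
    show ?thesis unfolding z_def q_def n1_def n2_def
      by (subst *) (intro norm_triangle_mono inc_lipschitz order_refl)
  qed
  define r where "r = M * (n1 + n2) + \<kappa> * (t - s) powr (3 * \<alpha>)"
  have pp: "norm (p' - p) \<le> r"
  proof -
    have "p' - p = inc s t p + (p' - p - inc s t p)" by simp
    then show ?thesis unfolding r_def n1_def n2_def using norm_triangle_mono[OF inc_bound p] by metis
  qed
  define b1 where "b1 = L * (M * (n1 + n2) * z + q) + L * (z + z') * r + n1 * (M * z)"
  have 1: "norm ((F j x' - F j x - (\<Sum>r\<in>UNIV. (w r t - w r s) *\<^sub>R G r j x))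
       - (F j p' - F j p - (\<Sum>r\<in>UNIV. (w r t - w r s) *\<^sub>R G r j p))) \<le> b1" (is "norm (?X - ?P) \<le> _") for j
  proof -
    have *: "?X - ?P = (F j x' - F j x - (F j p' - F j p)) - (\<Sum>r\<in>UNIV. (w r t - w r s) *\<^sub>R (G r j x - G r j p))"
      by (simp add: scaleR_diff_right sum_subtractf)
    have "norm (?X - ?P) \<le> norm (F j x' - F j x - (F j p' - F j p)) + norm (\<Sum>r\<in>UNIV. (w r t - w r s) *\<^sub>R (G r j x - G r j p))"
      unfolding * by (rule norm_triangle_ineq4)
    also have "norm (\<Sum>r\<in>UNIV. (w r t - w r s) *\<^sub>R (G r j x - G r j p)) \<le> n1 * (M * z)"
      unfolding n1_def z_def by (intro norm_sum_increment M)
    also have "norm (F j x' - F j x - (F j p' - F j p)) \<le> L * norm ((x' - p') - (x - p)) + L * (z + z') * norm (p' - p)"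
      unfolding z_def z'_def by (rule F_second_difference)
    also have "L * norm ((x' - p') - (x - p)) + L * (z + z') * norm (p' - p) \<le> L * (M * (n1 + n2) * z + q) + L * (z + z') * r"
      using zz pp L_nonneg nn by (intro add_mono mult_left_mono) auto
    finally show ?thesis by (simp add: b1_def)
  qed
  have 2: "norm ((G r j x' - G r j x) - (G r j p' - G r j p)) \<le> M * (z + z')" for r j
  proof -
    have "(G r j x' - G r j x) - (G r j p' - G r j p) = (G r j x' - G r j p') - (G r j x - G r j p)" by simp
    also have "norm \<dots> \<le> M * z' + M * z" unfolding z_def z'_def
      by (rule order_trans[OF norm_triangle_ineq4 add_mono[OF M(6) M(6)]])
    finally show ?thesis by (simp add: algebra_simps)
  qed
  have eq: "defect s t u x x' - defect s t u p p' =
      (\<Sum>j\<in>UNIV. (w j u - w j t) *\<^sub>R ((F j x' - F j x - (\<Sum>r\<in>UNIV. (w r t - w r s) *\<^sub>R G r j x))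
       - (F j p' - F j p - (\<Sum>r\<in>UNIV. (w r t - w r s) *\<^sub>R G r j p))))
    + (\<Sum>r\<in>UNIV. \<Sum>j\<in>UNIV. a r j t u *\<^sub>R ((G r j x' - G r j x) - (G r j p' - G r j p)))"
    unfolding defect_eq[OF s(1-3)] by (simp only: scaleR_diff_right sum_subtractf add_diff_add)
  have main: "norm (defect s t u x x' - defect s t u p p') \<le> N1 t u * b1 + N2 t u * (M * (z + z'))"
    unfolding eq by (rule norm_triangle_mono[OF norm_sum_increment[OF 1] norm_sum_area[OF 2]])
  define m1 where "m1 = N1 t u"
  define m2 where "m2 = N2 t u"
  define cT where "cT = c * T powr \<alpha>"
  have nnm: "0 \<le> m1" "0 \<le> m2" "m1 \<le> cT" "0 \<le> cT"
    using s c_nonneg by (auto simp: m1_def m2_def cT_def intro!: N1_le_const)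
  have V_def2: "V = n1\<^sup>2 + n2 + m1\<^sup>2 + m2 + (u - s)" by (simp add: V_def roughness_def n1_def n2_def m1_def m2_def)
  \<comment> \<open>The squares in \<open>roughness\<close> dominate the mixed product of increments
    on the two halves.\<close>
  have V1: "m1 * n1 \<le> V"
    using sum_squares_bound[of m1 n1] mult_nonneg_nonneg[OF nnm(1) nn(4)] nn(5) nnm(2) s unfolding V_def2 by linarith
  have V2: "n2 \<le> V" "m2 \<le> V" "u - s \<le> V" "0 \<le> V" using nn nnm s unfolding V_def2 by auto
  have V3: "m1 * n2 \<le> cT * V" using V2 nnm nn by (intro mult_mono) auto
  \<comment> \<open>Since 3\<alpha> > 1, the power h^(3\<alpha>) is at most T^(3\<alpha>-1) h, and
    the length h is a summand of \<open>V\<close>.\<close>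
  have V4: "m1 * (\<kappa> * (t - s) powr (3 * \<alpha>)) \<le> \<kappa> * cT * T powr (3 * \<alpha> - 1) * V"
  proof -
    have "(t - s) powr (3 * \<alpha>) \<le> (u - s) powr (3 * \<alpha>)" using s \<alpha>_gt by (intro powr_mono2) auto
    also have "\<dots> = (u - s) powr (3 * \<alpha> - 1) * (u - s)"
      using s by (cases "s = u") (auto simp: powr_diff)
    also have "\<dots> \<le> T powr (3 * \<alpha> - 1) * V"
      using s \<alpha>_gt V2 by (intro mult_mono powr_mono2) auto
    finally have *: "\<kappa> * (t - s) powr (3 * \<alpha>) \<le> \<kappa> * (T powr (3 * \<alpha> - 1) * V)" using \<kappa> mult_left_mono by blast
    then have "m1 * (\<kappa> * (t - s) powr (3 * \<alpha>)) \<le> cT * (\<kappa> * (T powr (3 * \<alpha> - 1) * V))"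
      by (rule mult_mono[OF nnm(3) _ nnm(4)]) (simp add: \<kappa>)
    then show ?thesis by (simp add: algebra_simps)
  qed
  have "m1 * b1 + m2 * (M * (z + z')) = (L * m1) * q + L * M * (m1 * n1 + m1 * n2) * z
     + L * (M * (m1 * n1 + m1 * n2) + m1 * (\<kappa> * (t - s) powr (3 * \<alpha>))) * (z + z')
     + M * (m1 * n1) * z + M * m2 * (z + z')"
    by (simp add: b1_def r_def algebra_simps)
  also have "\<dots> \<le> (C * (u - s) powr \<alpha>) * q + L * M * (V + cT * V) * (z + z')
     + L * (M * (V + cT * V) + \<kappa> * cT * T powr (3 * \<alpha> - 1) * V) * (z + z')
     + M * V * (z + z') + M * V * (z + z')"
  proof -
    have mn: "0 \<le> m1 * n1" "0 \<le> m1 * n2" using nn nnm by auto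
    have "m1 \<le> c1 * (u - s) powr \<alpha>"
      unfolding m1_def using s c_le_c1 by (intro order_trans[OF N1_le[where h="u - s"]] mult_right_mono) auto
    then have "L * m1 \<le> M * (c1 * (u - s) powr \<alpha>)" using nnm M L_nonneg by (intro mult_mono) auto
    then have "L * m1 \<le> C * (u - s) powr \<alpha>" by (simp add: C_def mult.assoc)
    then show ?thesis
      using mn V1 V2 V3 V4 nn M(1) L_nonneg by (intro five_terms_mono) auto
  qed
  also have "\<dots> = (C * (u - s) powr \<alpha>) * q + C3 \<kappa> * V * (z + z')"
    by (simp add: C3_def cT_def algebra_simps)
  finally show ?thesis using main
    unfolding z_def[symmetric] z'_def[symmetric] q_def[symmetric] V_def[symmetric] m1_def[symmetric] m2_def[symmetric]
    by linarith
qed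

text \<open>The coefficient C (2 + \<kappa>m) of \<open>tree_step\<close>, with C = C3 and with C
  T^\<alpha> as the bound of \<kappa> for all intervals.\<close>

definition \<Lambda> :: "real \<Rightarrow> real" where
  "\<Lambda> \<kappa> = C3 \<kappa> * (2 + C * T powr \<alpha>)"

text \<open>Bisection is stopped after n levels. The 2^n intervals at the bottom contribute the
  crude size of both remainders, and everything above them contributes to the exponent. The
  exponential in front of the tree sum absorbs the factors 1 + C h^\<alpha> met on the way
  up.\<close>

lemma difference_tree_bound:
  assumes t1: "t1 \<le> T" and \<kappa>: "0 \<le> \<kappa>"
    and y: "\<And>s t. 0 \<le> s \<Longrightarrow> s \<le> t \<Longrightarrow> t \<le> t1 \<Longrightarrow> norm (rem y s t) \<le> \<kappa> * (t - s) powr (3 * \<alpha>)"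
    and p: "\<And>s t. 0 \<le> s \<Longrightarrow> s \<le> t \<Longrightarrow> t \<le> t1 \<Longrightarrow> norm (rem p s t) \<le> \<kappa> * (t - s) powr (3 * \<alpha>)"
  shows "dyadic T m (Suc k) \<le> t1 \<Longrightarrow>
    norm (rem y (dyadic T m k) (dyadic T m (Suc k)) - rem p (dyadic T m k) (dyadic T m (Suc k))) \<le>
    (exp (\<Lambda> \<kappa> * exp (weight * (T / 2 ^ m) powr \<alpha>) * tree_sum (dyadic_roughness w a T) n m k) - 1)
      * norm (y (dyadic T m k) - p (dyadic T m k))
    + 2 ^ n * (2 * \<kappa> * (T / 2 ^ (m + n)) powr (3 * \<alpha>))
      * exp (\<Lambda> \<kappa> * exp (weight * (T / 2 ^ m) powr \<alpha>) * tree_sum (dyadic_roughness w a T) n m k + weight * (T / 2 ^ m) powr \<alpha>)"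
proof (induction n arbitrary: m k)
  case 0
  let ?s = "dyadic T m k" and ?u = "dyadic T m (Suc k)"
  have su: "0 \<le> ?s" "?s \<le> ?u" "?u - ?s = T / 2 ^ m"
    using dyadic_halves(3)[of T m k] T_pos by (auto simp: dyadic_def divide_right_mono)
  \<comment> \<open>At depth 0 the tree sum is 0 and the factor of the distance vanishes, so the
    triangle inequality alone has to do.\<close>
  have "norm (rem y ?s ?u - rem p ?s ?u) \<le> norm (rem y ?s ?u) + norm (rem p ?s ?u)" by (rule norm_triangle_ineq4)
  also have "\<dots> \<le> 2 * \<kappa> * (T / 2 ^ m) powr (3 * \<alpha>)"
    using y[OF su(1,2) 0] p[OF su(1,2) 0] unfolding su(3) by simp
  also have "\<dots> \<le> (2 * \<kappa> * (T / 2 ^ m) powr (3 * \<alpha>)) * exp (weight * (T / 2 ^ m) powr \<alpha>)"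
    using \<kappa> weight mult_left_mono[of 1 "exp (weight * (T / 2 ^ m) powr \<alpha>)" "2 * \<kappa> * (T / 2 ^ m) powr (3 * \<alpha>)"] by simp
  finally show ?case by simp
next
  case (Suc n)
  let ?s = "dyadic T m k" and ?u = "dyadic T m (Suc k)" and ?t = "dyadic T (Suc m) (2 * k + 1)"
  let ?V = "dyadic_roughness w a T"
  let ?h = "T / 2 ^ m"
  let ?S1 = "tree_sum ?V n (Suc m) (2 * k)" and ?S2 = "tree_sum ?V n (Suc m) (2 * k + 1)"
  let ?g = "weight * (?h / 2) powr \<alpha>"
  let ?g' = "weight * ?h powr \<alpha>"
  have h: "?u - ?s = ?h" "T / 2 ^ Suc m = ?h / 2" "?h \<le> T" using T_pos
    by (auto simp: dyadic_halves(3) field_simps)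
  have st: "0 \<le> ?s" "?s \<le> ?t" "?t \<le> ?u" "?u \<le> t1" "?t - ?s \<le> ?h" "?t \<le> T" "?u \<le> T"
  proof -
    show "0 \<le> ?s" "?s \<le> ?t" "?t \<le> ?u" "?t - ?s \<le> ?h"
      using T_pos by (auto simp: dyadic_def field_simps)
    then show "?u \<le> t1" "?t \<le> T" "?u \<le> T" using Suc.prems t1 by auto
  qed
  have nn: "0 \<le> \<Lambda> \<kappa>" "0 \<le> ?S1" "0 \<le> ?S2" "0 \<le> ?V m k" "0 \<le> C * ?h powr \<alpha>"
    using C3_nonneg[OF \<kappa>] C_nonneg T_pos
    by (auto simp: \<Lambda>_def intro!: tree_sum_nonneg dyadic_roughness_nonneg)
  let ?z = "norm (y ?s - p ?s)" and ?z' = "norm (y ?t - p ?t)"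
  let ?q1 = "norm (rem y ?s ?t - rem p ?s ?t)" and ?q2 = "norm (rem y ?t ?u - rem p ?t ?u)"
  have d: "dyadic T (Suc m) (2 * k) = ?s" "dyadic T (Suc m) (Suc (2 * k)) = ?t" "dyadic T (Suc m) (Suc (2 * k + 1)) = ?u"
    using dyadic_halves(1,2)[of T m k] by auto
  have b: "2 ^ n * (2 * \<kappa> * (T / 2 ^ (Suc m + n)) powr (3 * \<alpha>)) = 2 ^ n * (2 * \<kappa> * (T / 2 ^ (m + Suc n)) powr (3 * \<alpha>))" by simp
  have hp: "(C + weight * 2 powr - \<alpha>) * ?h powr \<alpha> \<le> weight * ?h powr \<alpha>"
    using weight(2) by (intro mult_right_mono) auto
  have "(x / 2) powr \<alpha> = 2 powr - \<alpha> * x powr \<alpha>" if "0 \<le> x" for x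
    using that by (simp add: powr_divide powr_minus field_simps)
  from this[of ?h] have hg: "C * ?h powr \<alpha> + ?g \<le> ?g'"
    using hp T_pos by (simp del: divide_divide_eq_left add: algebra_simps)
  have "norm (rem y ?s ?u - rem p ?s ?u) \<le>
     (exp (\<Lambda> \<kappa> * exp ?g' * tree_sum ?V (Suc n) m k) - 1) * ?z
     + 2 * (2 ^ n * (2 * \<kappa> * (T / 2 ^ (m + Suc n)) powr (3 * \<alpha>))) * exp (\<Lambda> \<kappa> * exp ?g' * tree_sum ?V (Suc n) m k + ?g')"
  \<comment> \<open>\<kappa> is the Lipschitz constant of \<open>inc\<close> on the present
    interval, and \<open>\<kappa>m\<close> its value for length T.\<close>
  proof (rule tree_step[where ?z'="?z'" and ?q1.0="?q1" and ?q2.0="?q2" and \<kappa>="C * ?h powr \<alpha>" and \<kappa>m="C * T powr \<alpha>" and C="C3 \<kappa>"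
        and V="?V m k" and ?x1.0="\<Lambda> \<kappa> * exp ?g * ?S1" and ?x2.0="\<Lambda> \<kappa> * exp ?g * ?S2" and g="?g"])
    show "?q1 \<le> (exp (\<Lambda> \<kappa> * exp ?g * ?S1) - 1) * ?z + 2 ^ n * (2 * \<kappa> * (T / 2 ^ (m + Suc n)) powr (3 * \<alpha>)) * exp (\<Lambda> \<kappa> * exp ?g * ?S1 + ?g)"
      using Suc.IH[of "Suc m" "2 * k"] st unfolding d h(2) b by linarith
    show "?q2 \<le> (exp (\<Lambda> \<kappa> * exp ?g * ?S2) - 1) * ?z' + 2 ^ n * (2 * \<kappa> * (T / 2 ^ (m + Suc n)) powr (3 * \<alpha>)) * exp (\<Lambda> \<kappa> * exp ?g * ?S2 + ?g)"
      using Suc.IH[of "Suc m" "2 * k + 1"] st unfolding d h(2) b by simp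
    show "?z' \<le> (1 + C * ?h powr \<alpha>) * ?z + ?q1"
    proof -
      have eq: "y ?t - p ?t = (y ?s - p ?s) + (inc ?s ?t (y ?s) - inc ?s ?t (p ?s)) + (rem y ?s ?t - rem p ?s ?t)"
        by (simp add: rem_def)
      have "norm (inc ?s ?t (y ?s) - inc ?s ?t (p ?s)) \<le> (M * (c1 * ?h powr \<alpha>)) * ?z"
        using st h M by (intro order_trans[OF inc_lipschitz] mult_right_mono mult_left_mono N12_le) auto
      then have "?z' \<le> ?z + (M * (c1 * ?h powr \<alpha>)) * ?z + ?q1"
        unfolding eq by (intro norm_triangle_mono order_refl)
      then show ?thesis by (simp add: C_def algebra_simps)
    qed
    show "norm (rem y ?s ?u - rem p ?s ?u) \<le> (1 + C * ?h powr \<alpha>) * ?q1 + ?q2 + C3 \<kappa> * ?V m k * (?z + ?z')"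
    proof -
      have eq: "rem y ?s ?u - rem p ?s ?u = (rem y ?s ?t - rem p ?s ?t) + (rem y ?t ?u - rem p ?t ?u)
         + (defect ?s ?t ?u (y ?s) (y ?t) - defect ?s ?t ?u (p ?s) (p ?t))"
        by (simp add: rem_def defect_def)
      have V: "?V m k = roughness w a ?s ?t + roughness w a ?t ?u + (?u - ?s)"
        unfolding dyadic_roughness_def h(1) using dyadic_halves[of T m k] by simp
      have "norm (defect ?s ?t ?u (y ?s) (y ?t) - defect ?s ?t ?u (p ?s) (p ?t)) \<le>
          C * ?h powr \<alpha> * ?q1 + C3 \<kappa> * ?V m k * (?z + ?z')"
        unfolding V h(1)[symmetric] rem_def
        using st p[of ?s ?t] by (intro defect_difference_bound \<kappa>) (auto simp: rem_def)
      then have "norm (rem y ?s ?u - rem p ?s ?u) \<le> ?q1 + ?q2 + (C * ?h powr \<alpha> * ?q1 + C3 \<kappa> * ?V m k * (?z + ?z'))"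
        unfolding eq by (intro norm_triangle_mono order_refl)
      then show ?thesis by (simp add: algebra_simps)
    qed
    show "C * ?h powr \<alpha> + ?g \<le> ?g'" by (fact hg)
    show "(1 + C * ?h powr \<alpha>) * (\<Lambda> \<kappa> * exp ?g * ?S1 + \<Lambda> \<kappa> * exp ?g * ?S2) + C3 \<kappa> * (2 + C * T powr \<alpha>) * ?V m k
       \<le> \<Lambda> \<kappa> * exp ?g' * tree_sum ?V (Suc n) m k"
    proof -
      \<comment> \<open>The factor 1 + C h^\<alpha> in front of the tree sums of the halves is
        absorbed by passing from the weight at h / 2 to the weight at h.\<close>
      have "(1 + C * ?h powr \<alpha>) * exp ?g \<le> exp (C * ?h powr \<alpha>) * exp ?g"
        by (intro mult_right_mono exp_ge_add_one_self) auto
      also have "\<dots> \<le> exp ?g'" using hg by (simp add: exp_add[symmetric])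
      finally have "((1 + C * ?h powr \<alpha>) * exp ?g) * (\<Lambda> \<kappa> * (?S1 + ?S2)) \<le> exp ?g' * (\<Lambda> \<kappa> * (?S1 + ?S2))"
        using nn by (intro mult_right_mono) auto
      moreover have "1 * (\<Lambda> \<kappa> * ?V m k) \<le> exp ?g' * (\<Lambda> \<kappa> * ?V m k)"
        using nn weight by (intro mult_right_mono) auto
      ultimately show ?thesis unfolding \<Lambda>_def[symmetric] by (simp add: algebra_simps)
    qed
  qed (use nn \<kappa> weight C_nonneg C3_nonneg[OF \<kappa>] h(3) T_pos \<alpha>_gt in \<open>auto intro!: mult_left_mono powr_mono2\<close>)
  then show ?case by (simp add: mult.assoc)
qed

text \<open>With equal values at the left end only the error from the bottom of the tree remains. It
  decays like exp (-2 \<rho> n), and at the depths supplied by tameness it is amplified by at most a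
  constant times exp (\<rho> n). The distance at the right end does not depend on n, so infinitely
  many such depths suffice to make it 0.\<close>

lemma dyadic_step_unique:
  assumes tame: "\<exists>\<^sub>\<infinity>n. tree_sum (dyadic_roughness w a T) n m k \<le> \<eta> * real n"
    and \<eta>: "\<Lambda> \<kappa> * exp (weight * T powr \<alpha>) * \<eta> \<le> (3 * \<alpha> - 1) * ln 2 / 2"
    and t1: "t1 \<le> T" and \<kappa>: "0 \<le> \<kappa>"
    and y: "\<And>s t. 0 \<le> s \<Longrightarrow> s \<le> t \<Longrightarrow> t \<le> t1 \<Longrightarrow> norm (rem y s t) \<le> \<kappa> * (t - s) powr (3 * \<alpha>)"
    and p: "\<And>s t. 0 \<le> s \<Longrightarrow> s \<le> t \<Longrightarrow> t \<le> t1 \<Longrightarrow> norm (rem p s t) \<le> \<kappa> * (t - s) powr (3 * \<alpha>)"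
    and k: "dyadic T m (Suc k) \<le> t1" and eq: "y (dyadic T m k) = p (dyadic T m k)"
  shows "y (dyadic T m (Suc k)) = p (dyadic T m (Suc k))"
proof (rule ccontr)
  assume "y (dyadic T m (Suc k)) \<noteq> p (dyadic T m (Suc k))"
  let ?s = "dyadic T m k" and ?u = "dyadic T m (Suc k)"
  define S where "S n = tree_sum (dyadic_roughness w a T) n m k" for n
  define e where "e = norm (y ?u - p ?u)"
  have e: "0 < e" using \<open>y ?u \<noteq> p ?u\<close> by (simp add: e_def)
  define \<rho> where "\<rho> = (3 * \<alpha> - 1) * ln 2 / 2"
  have \<rho>: "0 < \<rho>" using \<alpha>_gt by (simp add: \<rho>_def)
  let ?g = "weight * (T / 2 ^ m) powr \<alpha>"
  have S: "0 \<le> S n" for n unfolding S_def using T_pos by (intro tree_sum_nonneg dyadic_roughness_nonneg) auto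
  have \<Lambda>: "0 \<le> \<Lambda> \<kappa>" using C3_nonneg[OF \<kappa>] C_nonneg by (simp add: \<Lambda>_def)
  define X where "X = 2 * \<kappa> * (T / 2 ^ m) powr (3 * \<alpha>) * exp ?g"
  have X: "0 \<le> X" using \<kappa> by (simp add: X_def)
  have "e = norm (rem y ?s ?u - rem p ?s ?u)" by (simp add: e_def rem_def eq)
  then have main: "e \<le> 2 ^ n * (2 * \<kappa> * (T / 2 ^ (m + n)) powr (3 * \<alpha>)) * exp (\<Lambda> \<kappa> * exp ?g * S n + ?g)" for n
    using difference_tree_bound[OF t1 \<kappa> y p k, of n] by (simp add: eq S_def)
  have *: "e \<le> X * exp (- \<rho> * real n)" if "S n \<le> \<eta> * real n" for n
  proof -
    have "(T / 2 ^ (m + n)) powr (3 * \<alpha>) = (T / 2 ^ m) powr (3 * \<alpha>) / (2 ^ n) powr (3 * \<alpha>)"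
      using T_pos by (simp add: power_add powr_divide powr_mult)
    moreover have "(2 ^ n :: real) = exp (real n * ln 2)" by (simp add: exp_of_nat_mult)
    ultimately have "2 ^ n * (T / 2 ^ (m + n)) powr (3 * \<alpha>) = (T / 2 ^ m) powr (3 * \<alpha>) * exp (real n * ln 2 - 3 * \<alpha> * (real n * ln 2))"
      by (simp add: powr_def exp_diff)
    also have "real n * ln 2 - 3 * \<alpha> * (real n * ln 2) = - 2 * \<rho> * real n"
      by (simp add: \<rho>_def algebra_simps)
    finally have 1: "2 ^ n * (T / 2 ^ (m + n)) powr (3 * \<alpha>) = (T / 2 ^ m) powr (3 * \<alpha>) * exp (- 2 * \<rho> * real n)" .
    have "exp ?g \<le> exp (weight * T powr \<alpha>)"
      using T_pos \<alpha>_gt weight by (simp, intro mult_left_mono powr_mono2) (auto simp: field_simps)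
    then have "\<Lambda> \<kappa> * exp ?g * S n \<le> \<Lambda> \<kappa> * exp (weight * T powr \<alpha>) * (\<eta> * real n)"
      using that \<Lambda> S by (intro mult_mono) auto
    also have "\<dots> \<le> \<rho> * real n" using mult_right_mono[OF \<eta>, of "real n"] by (simp add: \<rho>_def mult.assoc)
    finally have 2: "exp (\<Lambda> \<kappa> * exp ?g * S n + ?g) \<le> exp (\<rho> * real n + ?g)" by simp
    have "e \<le> 2 * \<kappa> * (2 ^ n * (T / 2 ^ (m + n)) powr (3 * \<alpha>)) * exp (\<Lambda> \<kappa> * exp ?g * S n + ?g)"
      using main[of n] by (simp add: mult_ac)
    also have "\<dots> \<le> 2 * \<kappa> * ((T / 2 ^ m) powr (3 * \<alpha>) * exp (- 2 * \<rho> * real n)) * exp (\<rho> * real n + ?g)"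
      unfolding 1 using 2 \<kappa> by (intro mult_left_mono) auto
    also have "\<dots> = X * (exp (- 2 * \<rho> * real n) * exp (\<rho> * real n))"
      unfolding X_def exp_add by (simp add: mult_ac)
    also have "\<dots> = X * exp (- \<rho> * real n)" by (simp add: exp_add[symmetric])
    finally show ?thesis .
  qed
  have "((\<lambda>n. X * exp (- \<rho> * real n)) \<longlongrightarrow> X * 0) sequentially"
  proof (intro tendsto_mult tendsto_const filterlim_compose[OF exp_at_bot])
    show "filterlim (\<lambda>n. - \<rho> * real n) at_bot sequentially"
      using \<rho> by (intro filterlim_tendsto_neg_mult_at_bot[OF tendsto_const] filterlim_real_sequentially) auto
  qed
  then have "eventually (\<lambda>n. X * exp (- \<rho> * real n) < e) sequentially"
    using e by (auto dest: order_tendstoD)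
  then obtain N where N: "\<And>n. N \<le> n \<Longrightarrow> X * exp (- \<rho> * real n) < e" by (auto simp: eventually_sequentially)
  obtain n where "N \<le> n" "S n \<le> \<eta> * real n"
    using tame unfolding INFM_nat_le S_def by blast
  with N * show False by fastforce
qed

lemma path_bound:
  assumes "norm (rem y s t) \<le> \<kappa> * (t - s) powr (3 * \<alpha>)" "0 \<le> s" "s \<le> t" "t \<le> T" "0 \<le> \<kappa>"
  shows "norm (y t - y s) \<le> (C + \<kappa> * T powr (2 * \<alpha>)) * (t - s) powr \<alpha>"
proof -
  have "y t - y s = inc s t (y s) + rem y s t" by (simp add: rem_def)
  then have "norm (y t - y s) \<le> M * c1 * (t - s) powr \<alpha> + \<kappa> * (t - s) powr (3 * \<alpha>)"
    using norm_triangle_mono[OF inc_le assms(1)] assms by auto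
  also have "(t - s) powr (3 * \<alpha>) = (t - s) powr (2 * \<alpha>) * (t - s) powr \<alpha>" by (simp add: powr_add[symmetric])
  also have "\<kappa> * \<dots> \<le> \<kappa> * (T powr (2 * \<alpha>) * (t - s) powr \<alpha>)"
    using assms \<alpha>_gt by (intro mult_left_mono mult_right_mono powr_mono2) auto
  finally show ?thesis by (simp add: C_def algebra_simps)
qed

lemma tame_unique:
  assumes tame: "tame w a T" and t1: "0 \<le> t1" "t1 \<le> T" and \<kappa>: "0 \<le> \<kappa>"
    and y: "\<And>s t. 0 \<le> s \<Longrightarrow> s \<le> t \<Longrightarrow> t \<le> t1 \<Longrightarrow> norm (rem y s t) \<le> \<kappa> * (t - s) powr (3 * \<alpha>)"
    and p: "\<And>s t. 0 \<le> s \<Longrightarrow> s \<le> t \<Longrightarrow> t \<le> t1 \<Longrightarrow> norm (rem p s t) \<le> \<kappa> * (t - s) powr (3 * \<alpha>)"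
    and eq: "y 0 = p 0" and s: "s \<in> {0..t1}"
  shows "y s = p s"
proof -
  define l where "l = \<Lambda> \<kappa> * exp (weight * T powr \<alpha>)"
  have l: "0 \<le> l" using C3_nonneg[OF \<kappa>] C_nonneg by (simp add: \<Lambda>_def l_def)
  \<comment> \<open>Half the decay rate divided by the amplification rate; l + 1 excludes a zero
    denominator.\<close>
  define \<eta> where "\<eta> = (3 * \<alpha> - 1) * ln 2 / 2 / (l + 1)"
  have \<eta>: "0 < \<eta>" using \<alpha>_gt l by (simp add: \<eta>_def)
  have "(l + 1) * \<eta> = (3 * \<alpha> - 1) * ln 2 / 2" using l by (simp add: \<eta>_def field_simps)
  then have \<eta>2: "l * \<eta> \<le> (3 * \<alpha> - 1) * ln 2 / 2" using \<eta> by (simp add: algebra_simps)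
  obtain m0 where m0: "\<And>m k. m0 \<le> m \<Longrightarrow> k < 2 ^ m \<Longrightarrow> \<exists>\<^sub>\<infinity>n. tree_sum (dyadic_roughness w a T) n m k \<le> \<eta> * real n"
    using tame \<eta> unfolding tame_def by blast
  \<comment> \<open>From left to right over the intervals of one level, which is why
    \<open>m0\<close> may not depend on k.\<close>
  have d: "m0 \<le> m \<Longrightarrow> dyadic T m k \<le> t1 \<Longrightarrow> y (dyadic T m k) = p (dyadic T m k)" for m k
  proof (induction k)
    case 0
    then show ?case by (simp add: dyadic_def eq)
  next
    case (Suc k)
    have "T * real (Suc k) \<le> T * 2 ^ m" using order_trans[OF Suc.prems(2) t1(2)] by (simp add: dyadic_def field_simps)
    then have "real (Suc k) \<le> real (2 ^ m)" using T_pos by simp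
    then have k: "k < 2 ^ m" unfolding of_nat_le_iff by simp
    have "dyadic T m k \<le> t1"
      using order_trans[OF _ Suc.prems(2)] T_pos by (simp add: dyadic_def divide_right_mono)
    then have e: "y (dyadic T m k) = p (dyadic T m k)" using Suc by blast
    have "\<exists>\<^sub>\<infinity>n. tree_sum (dyadic_roughness w a T) n m k \<le> \<eta> * real n" using m0 Suc.prems(1) k by blast
    moreover have "\<Lambda> \<kappa> * exp (weight * T powr \<alpha>) * \<eta> \<le> (3 * \<alpha> - 1) * ln 2 / 2" using \<eta>2 by (simp only: l_def)
    ultimately show ?case
      using dyadic_step_unique[where y=y and p=p, OF _ _ t1(2) \<kappa> _ _ Suc.prems(2) e] y p by blast
  qed
  define R where "R = C + \<kappa> * T powr (2 * \<alpha>)"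
  \<comment> \<open>Both paths are Hoelder continuous and agree at the grid point of level m just
    left of s.\<close>
  have "norm (y s - p s) \<le> 2 * R * (T / 2 ^ m) powr \<alpha>" if m: "m0 \<le> m" for m
  proof -
    define k where "k = nat \<lfloor>s * 2 ^ m / T\<rfloor>"
    define r where "r = dyadic T m k"
    have "real k \<le> s * 2 ^ m / T" "s * 2 ^ m / T < real k + 1" using s T_pos unfolding k_def by (auto simp: floor_less_iff)
    then have "T * real k \<le> s * 2 ^ m" "s * 2 ^ m \<le> T * real k + T"
      using T_pos by (auto simp: field_simps)
    then have "T * real k / 2 ^ m \<le> s" "s \<le> (T * real k + T) / 2 ^ m"
      by (simp_all add: pos_le_divide_eq pos_divide_le_eq)
    then have r: "r \<le> s" "s - r \<le> T / 2 ^ m" "0 \<le> r"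
      using T_pos by (simp_all add: r_def dyadic_def add_divide_distrib)
    have "y r = p r" unfolding r_def using r s m by (intro d) (auto simp: r_def)
    then have "norm (y s - p s) \<le> norm (y s - y r) + norm (p s - p r)"
      using norm_triangle_ineq4[of "y s - y r" "p s - p r"] by simp
    also have "\<dots> \<le> R * (s - r) powr \<alpha> + R * (s - r) powr \<alpha>"
      unfolding R_def using r s t1 path_bound[OF y, of r s] path_bound[OF p, of r s] \<kappa>
      by (intro add_mono) auto
    also have "\<dots> \<le> R * (T / 2 ^ m) powr \<alpha> + R * (T / 2 ^ m) powr \<alpha>"
      using r \<alpha>_gt C_nonneg \<kappa> by (intro add_mono mult_left_mono powr_mono2) (auto simp: R_def)
    finally show ?thesis by simp
  qed
  moreover have "(\<lambda>m. 2 * R * (T / 2 ^ m) powr \<alpha>) \<longlonglongrightarrow> 2 * R * 0"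
  proof (intro tendsto_mult tendsto_const)
    have "(\<lambda>m. T * (1 / 2) ^ m) \<longlonglongrightarrow> T * 0" by (intro tendsto_mult tendsto_const LIMSEQ_realpow_zero) auto
    then have "(\<lambda>m. T / 2 ^ m) \<longlonglongrightarrow> 0" by (simp add: power_divide)
    then have "(\<lambda>m. (T / 2 ^ m) powr \<alpha>) \<longlonglongrightarrow> 0 powr \<alpha>"
      using \<alpha>_gt T_pos by (intro tendsto_powr2) auto
    then show "(\<lambda>m. (T / 2 ^ m) powr \<alpha>) \<longlonglongrightarrow> 0" by simp
  qed
  ultimately have "norm (y s - p s) \<le> 2 * R * 0"
    by (intro LIMSEQ_le_const) blast+
  then show ?thesis by simp
qed

end

section \<open>Existence\<close>

context rough_equation
begin

lemma inc_refl: "0 \<le> t \<Longrightarrow> t \<le> T \<Longrightarrow> inc t t x = 0"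
  using inc_bound[of t t x] increment_bound[of t t] area_bound[of t t]
    increment_sum_nonneg[of w t t] area_sum_nonneg[of a t t] by simp

primrec milstein :: "real \<Rightarrow> 'e \<Rightarrow> nat \<Rightarrow> 'e" where
  "milstein \<delta> y0 0 = y0"
| "milstein \<delta> y0 (Suc k) = milstein \<delta> y0 k + inc (real k * \<delta>) (real (Suc k) * \<delta>) (milstein \<delta> y0 k)"

definition milstein_path :: "real \<Rightarrow> 'e \<Rightarrow> real \<Rightarrow> 'e" where
  "milstein_path \<delta> y0 t = (let k = nat \<lfloor>t / \<delta>\<rfloor> in
     milstein \<delta> y0 k + inc (real k * \<delta>) t (milstein \<delta> y0 k))"

text \<open>The right end of the cell is included. There the floor already selects the next grid
  point, but the step from that point is \<open>inc t t\<close>, which vanishes.\<close>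

lemma milstein_path_cell:
  assumes "0 < \<delta>" "real k * \<delta> \<le> t" "t \<le> real (Suc k) * \<delta>" "t \<le> T"
  shows "milstein_path \<delta> y0 t = milstein \<delta> y0 k + inc (real k * \<delta>) t (milstein \<delta> y0 k)"
proof (cases "t = real (Suc k) * \<delta>")
  case True
  then have "nat \<lfloor>t / \<delta>\<rfloor> = Suc k" using assms(1) by simp
  moreover have "inc t t x = 0" for x using assms by (intro inc_refl) (auto simp: True)
  ultimately show ?thesis unfolding milstein_path_def Let_def by (simp only: True[symmetric] milstein.simps) simp
next
  case False
  with assms have "real k \<le> t / \<delta>" "t / \<delta> < real k + 1"
    by (auto simp: field_simps)
  then have "\<lfloor>t / \<delta>\<rfloor> = int k" by (intro floor_unique) auto
  then show ?thesis by (simp add: milstein_path_def Let_def)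
qed

lemma cell_obtain:
  fixes s \<delta> :: real
  assumes "0 < \<delta>" "0 \<le> s"
  obtains k :: nat where "real k * \<delta> \<le> s" "s \<le> real (Suc k) * \<delta>"
proof
  define k where "k = nat \<lfloor>s / \<delta>\<rfloor>"
  have "real k = of_int \<lfloor>s / \<delta>\<rfloor>" using assms by (simp add: k_def)
  then have "real k \<le> s / \<delta>" "s / \<delta> \<le> real k + 1" by linarith+
  then show "real k * \<delta> \<le> s" "s \<le> real (Suc k) * \<delta>" using assms by (auto simp: field_simps)
qed

text \<open>Inside a cell both values are partial steps from one grid point, so the remainder is
  minus a defect.\<close>

lemma milstein_rem_cell:
  assumes \<delta>: "0 < \<delta>" and k: "real k * \<delta> \<le> s" "s \<le> t" "t \<le> real (Suc k) * \<delta>" "t \<le> T"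
  shows "norm (rem (milstein_path \<delta> y0) s t) \<le> C1 * \<delta> powr (3 * \<alpha>)"
proof -
  let ?q = "real k * \<delta>" and ?X = "milstein \<delta> y0 k"
  have q: "0 \<le> ?q" using \<delta> by simp
  have x: "milstein_path \<delta> y0 s = ?X + inc ?q s ?X" "milstein_path \<delta> y0 t = ?X + inc ?q t ?X"
    using assms by (intro milstein_path_cell; auto)+
  have "rem (milstein_path \<delta> y0) s t = - defect ?q s t ?X (?X + inc ?q s ?X)"
    by (simp add: rem_def defect_def x)
  then have "norm (rem (milstein_path \<delta> y0) s t) \<le> C1 * (t - ?q) powr (3 * \<alpha>)"
    using defect_step_bound[OF q k(1,2,4) refl] by simp
  also have "\<dots> \<le> C1 * \<delta> powr (3 * \<alpha>)"
    using k \<alpha>_gt C1_nonneg by (intro mult_left_mono powr_mono2) (auto simp: algebra_simps)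
  finally show ?thesis .
qed

text \<open>An interval of length h in (\<delta> / 2, \<delta>] meets at most two adjacent cells,
  which costs one application of \<open>norm_rem_split\<close>; the factor 2^(3\<alpha>) comes from
  \<delta> < 2 h.\<close>

definition B0 :: real where
  "B0 = (1 + C * T powr \<alpha>) * (2 * (C1 * 2 powr (3 * \<alpha>))) + C1"

lemma B0_nonneg: "0 \<le> B0"
  using C_nonneg C1_nonneg by (simp add: B0_def)

text \<open>On much shorter intervals the bound in the cell is a power of the mesh and not of the
  length, hence the restriction on t - s. It disappears in the limit of vanishing mesh.\<close>

lemma milstein_rem_bound:
  assumes \<delta>: "0 < \<delta>" and st: "0 \<le> s" "t \<le> T" "\<delta> / 2 < t - s"
  shows "norm (rem (milstein_path \<delta> y0) s t) \<le> K B0 * (t - s) powr (3 * \<alpha>)"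
proof -
  let ?x = "milstein_path \<delta> y0"
  have "norm (rem ?x s t) \<le> K B0 * (t - s) powr (3 * \<alpha>) + exp (weight * T powr \<alpha>) * (0 - 0)"
  proof (rule rem_sewing_bound[where E="\<lambda>_. 0" and lo=0 and hi=T, OF _ _ \<delta> _ B0_nonneg _ st])
    fix s u assume *: "0 \<le> s" "u \<le> T" "\<delta> / 2 < u - s" "u - s \<le> \<delta>"
    obtain k where k: "real k * \<delta> \<le> s" "s \<le> real (Suc k) * \<delta>" using cell_obtain \<delta> *(1) by blast
    let ?t = "real (Suc k) * \<delta>"
    have "\<delta> powr (3 * \<alpha>) \<le> (2 * (u - s)) powr (3 * \<alpha>)" using * \<delta> \<alpha>_gt by (intro powr_mono2) auto
    also have "\<dots> = 2 powr (3 * \<alpha>) * (u - s) powr (3 * \<alpha>)" using * \<delta> by (subst powr_mult) auto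
    finally have d: "C1 * \<delta> powr (3 * \<alpha>) \<le> C1 * 2 powr (3 * \<alpha>) * (u - s) powr (3 * \<alpha>)"
      using C1_nonneg mult_left_mono by (metis mult.assoc)
    have e: "norm (rem ?x s u) \<le> (1 + C * (u - s) powr \<alpha>) * (2 * (C1 * \<delta> powr (3 * \<alpha>))) + C1 * (u - s) powr (3 * \<alpha>)"
    proof (cases "u \<le> ?t")
      case True
      then have "norm (rem ?x s u) \<le> C1 * \<delta> powr (3 * \<alpha>)"
        using * k \<delta> by (intro milstein_rem_cell) auto
      also have "\<dots> \<le> (1 + C * (u - s) powr \<alpha>) * (2 * (C1 * \<delta> powr (3 * \<alpha>)))"
        using C_nonneg C1_nonneg mult_mono[of 1 "1 + C * (u - s) powr \<alpha>" "C1 * \<delta> powr (3 * \<alpha>)" "2 * (C1 * \<delta> powr (3 * \<alpha>))"]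
        by simp
      finally show ?thesis using C1_nonneg by (simp add: add_increasing2)
    next
      case False
      have "norm (rem ?x s ?t) \<le> C1 * \<delta> powr (3 * \<alpha>)"
        using * k \<delta> False by (intro milstein_rem_cell[OF \<delta> k(1)]) auto
      moreover have "norm (rem ?x ?t u) \<le> C1 * \<delta> powr (3 * \<alpha>)"
        using * k \<delta> False by (intro milstein_rem_cell[OF \<delta>, of "Suc k"]) (auto simp: algebra_simps)
      ultimately have "(1 + C * (u - s) powr \<alpha>) * (norm (rem ?x s ?t) + norm (rem ?x ?t u))
          \<le> (1 + C * (u - s) powr \<alpha>) * (2 * (C1 * \<delta> powr (3 * \<alpha>)))"
        using C_nonneg by (intro mult_left_mono) auto
      then show ?thesis using norm_rem_split[of s ?t u ?x] * k False by simp
    qed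
    also have "\<dots> \<le> (1 + C * T powr \<alpha>) * (2 * (C1 * 2 powr (3 * \<alpha>) * (u - s) powr (3 * \<alpha>))) + C1 * (u - s) powr (3 * \<alpha>)"
      using d * C_nonneg C1_nonneg \<alpha>_gt \<delta>
      by (intro add_mono mult_mono[OF _ mult_left_mono[OF d]] mult_left_mono powr_mono2 order_refl) auto
    also have "\<dots> = B0 * (u - s) powr (3 * \<alpha>)" by (simp add: B0_def algebra_simps)
    finally show "norm (rem ?x s u) \<le> B0 * (u - s) powr (3 * \<alpha>) + (0 - 0)" by simp
  qed (auto simp: mono_on_def)
  then show ?thesis by simp
qed

text \<open>The three terms come from a Milstein step, from the defect inside a cell, and from the
  remainder on intervals longer than half the mesh.\<close>

definition equicont_const :: real where
  "equicont_const = C + c * (c * T powr \<alpha> * M) + K B0 * T powr (2 * \<alpha>)"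

lemma K_nonneg: "0 \<le> b \<Longrightarrow> 0 \<le> K b"
proof -
  have "2 powr (1 - 3 * \<alpha>) < 2 powr (0::real)" using \<alpha>_gt by (intro powr_less_mono) auto
  then show "0 \<le> b \<Longrightarrow> 0 \<le> K b" using C1_nonneg by (simp add: K_def)
qed

lemma equicont_const_nonneg: "0 \<le> equicont_const"
  using C_nonneg c_nonneg M K_nonneg[OF B0_nonneg] by (simp add: equicont_const_def)

text \<open>Below the mesh size the Hoelder bound is read off from the scheme: the difference of two
  partial steps from one grid point is \<open>inc s t\<close> up to a defect that is linear in the
  increment over [s, t].\<close>

lemma milstein_path_cell_diff:
  assumes \<delta>: "0 < \<delta>" and k: "real k * \<delta> \<le> s" "s \<le> t" "t \<le> real (Suc k) * \<delta>" "t \<le> T"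
  shows "norm (milstein_path \<delta> y0 t - milstein_path \<delta> y0 s) \<le> equicont_const * (t - s) powr \<alpha>"
proof -
  let ?q = "real k * \<delta>" and ?X = "milstein \<delta> y0 k"
  have q: "0 \<le> ?q" "?q \<le> T" "s \<le> T" using \<delta> k by auto
  have x: "milstein_path \<delta> y0 s = ?X + inc ?q s ?X" "milstein_path \<delta> y0 t = ?X + inc ?q t ?X"
    using assms by (intro milstein_path_cell; auto)+
  \<comment> \<open>Both arguments of the defect are the grid value, so the differences of
    \<open>F\<close> and \<open>G\<close> vanish and only the sum over \<open>G\<close> is
    left.\<close>
  have dq: "defect ?q s t ?X ?X = (\<Sum>j\<in>UNIV. (w j t - w j s) *\<^sub>R (- (\<Sum>r\<in>UNIV. (w r s - w r ?q) *\<^sub>R G r j ?X)))"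
    unfolding defect_eq[OF q(1) k(1,2)] by simp
  have eq: "milstein_path \<delta> y0 t - milstein_path \<delta> y0 s = inc s t ?X - defect ?q s t ?X ?X"
    by (simp add: x defect_def)
  have "norm (- (\<Sum>r\<in>UNIV. (w r s - w r ?q) *\<^sub>R G r j ?X)) \<le> c * T powr \<alpha> * M" for j
  proof -
    have "norm (\<Sum>r\<in>UNIV. (w r s - w r ?q) *\<^sub>R G r j ?X) \<le> N1 ?q s * M"
      by (intro norm_sum_increment M)
    also have "\<dots> \<le> c * T powr \<alpha> * M" using q k M(1) by (intro mult_right_mono N1_le) auto
    finally show ?thesis by simp
  qed
  then have "norm (defect ?q s t ?X ?X) \<le> N1 s t * (c * T powr \<alpha> * M)"
    unfolding dq by (intro norm_sum_increment)
  also have "\<dots> \<le> c * (t - s) powr \<alpha> * (c * T powr \<alpha> * M)"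
    using q k M(1) c_nonneg by (intro mult_right_mono N1_le) auto
  finally have "norm (inc s t ?X - defect ?q s t ?X ?X) \<le> M * c1 * (t - s) powr \<alpha> + c * (t - s) powr \<alpha> * (c * T powr \<alpha> * M)"
    using q k inc_le[of s t "t - s" ?X] norm_triangle_ineq4[of "inc s t ?X" "defect ?q s t ?X ?X"] by linarith
  also have "\<dots> \<le> equicont_const * (t - s) powr \<alpha>"
    using K_nonneg[OF B0_nonneg] by (simp add: equicont_const_def C_def algebra_simps)
  finally show ?thesis by (simp only: eq)
qed

lemma milstein_path_diff:
  assumes \<delta>: "0 < \<delta>" and st: "0 \<le> s" "s \<le> t" "t \<le> T"
  shows "norm (milstein_path \<delta> y0 t - milstein_path \<delta> y0 s) \<le> 2 * equicont_const * (t - s) powr \<alpha>"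
proof (cases "\<delta> / 2 < t - s")
  case True
  let ?x = "milstein_path \<delta> y0"
  have "?x t - ?x s = inc s t (?x s) + rem ?x s t" by (simp add: rem_def)
  moreover have "norm (inc s t (?x s)) \<le> M * c1 * (t - s) powr \<alpha>" using st by (intro inc_le) auto
  moreover have "norm (rem ?x s t) \<le> K B0 * T powr (2 * \<alpha>) * (t - s) powr \<alpha>"
  proof -
    have "norm (rem ?x s t) \<le> K B0 * ((t - s) powr (2 * \<alpha>) * (t - s) powr \<alpha>)"
      using milstein_rem_bound[OF \<delta> st(1,3) True] by (simp add: powr_add[symmetric])
    also have "\<dots> \<le> K B0 * (T powr (2 * \<alpha>) * (t - s) powr \<alpha>)"
      using st \<alpha>_gt K_nonneg[OF B0_nonneg] by (intro mult_left_mono mult_right_mono powr_mono2) auto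
    finally show ?thesis by simp
  qed
  ultimately have "norm (?x t - ?x s) \<le> M * c1 * (t - s) powr \<alpha> + K B0 * T powr (2 * \<alpha>) * (t - s) powr \<alpha>"
    using norm_triangle_mono by metis
  also have "\<dots> \<le> equicont_const * (t - s) powr \<alpha>"
    using c_nonneg M(1) by (simp add: equicont_const_def C_def algebra_simps)
  also have "\<dots> \<le> 2 * (equicont_const * (t - s) powr \<alpha>)" using equicont_const_nonneg by simp
  finally show ?thesis by (simp add: mult.assoc)
next
  case False
  let ?x = "milstein_path \<delta> y0"
  obtain k where k: "real k * \<delta> \<le> s" "s \<le> real (Suc k) * \<delta>" using cell_obtain \<delta> st(1) by blast
  let ?t = "real (Suc k) * \<delta>"
  show ?thesis
  proof (cases "t \<le> ?t")
    case True
    have "norm (?x t - ?x s) \<le> equicont_const * (t - s) powr \<alpha>"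
      using st k True by (intro milstein_path_cell_diff[OF \<delta> k(1)]) auto
    also have "\<dots> \<le> 2 * (equicont_const * (t - s) powr \<alpha>)" using equicont_const_nonneg by simp
    finally show ?thesis by (simp add: mult.assoc)
  next
    case f: False
    \<comment> \<open>Here t - s is at most half the mesh, so a single grid point separates s from
      t; this is the origin of the factor 2.\<close>
    have tt: "t \<le> real (Suc (Suc k)) * \<delta>" using False k \<delta> by (simp add: algebra_simps)
    have "norm (?x t - ?x s) \<le> norm (?x t - ?x ?t) + norm (?x ?t - ?x s)"
      using norm_triangle_ineq[of "?x t - ?x ?t" "?x ?t - ?x s"] by simp
    also have "\<dots> \<le> equicont_const * (t - ?t) powr \<alpha> + equicont_const * (?t - s) powr \<alpha>"
      using st k f tt by (intro add_mono milstein_path_cell_diff[OF \<delta>, of "Suc k"] milstein_path_cell_diff[OF \<delta> k(1)]) auto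
    also have "\<dots> \<le> equicont_const * (t - s) powr \<alpha> + equicont_const * (t - s) powr \<alpha>"
      using st k f equicont_const_nonneg \<alpha>_gt by (intro add_mono mult_left_mono powr_mono2) auto
    finally show ?thesis by simp
  qed
qed

lemma strong_solution_exists:
  obtains y \<kappa> where "y 0 = y0" "0 \<le> \<kappa>"
    "\<And>s t. 0 \<le> s \<Longrightarrow> s \<le> t \<Longrightarrow> t \<le> T \<Longrightarrow> norm (rem y s t) \<le> \<kappa> * (t - s) powr (3 * \<alpha>)"
proof -
  define x where "x n = milstein_path (T / real (Suc n)) y0" for n
  have \<delta>: "0 < T / real (Suc n)" for n using T_pos by simp
  let ?R = "2 * equicont_const"
  have R: "0 \<le> ?R" using equicont_const_nonneg by simp
  have diff: "norm (x n t - x n s) \<le> ?R * (t - s) powr \<alpha>" if "0 \<le> s" "s \<le> t" "t \<le> T" for n s t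
    unfolding x_def by (rule milstein_path_diff[OF \<delta> that])
  have diff': "norm (x n s - x n t) \<le> ?R * \<bar>s - t\<bar> powr \<alpha>" if "s \<in> {0..T}" "t \<in> {0..T}" for n s t
    using diff[of s t n] diff[of t s n] that by (cases "s \<le> t") (auto simp: norm_minus_commute abs_minus_commute)
  have x0: "x n 0 = y0" for n
    using T_pos milstein_path_cell[OF \<delta>[of n], of 0 0 y0] inc_refl[of 0] by (simp add: x_def)
  have bound: "norm (x n t) \<le> norm y0 + ?R * T powr \<alpha>" if "t \<in> {0..T}" for n t
  proof -
    have "norm (x n t - y0) \<le> ?R * t powr \<alpha>" using diff[of 0 t n] that x0 by simp
    also have "\<dots> \<le> ?R * T powr \<alpha>" using R that \<alpha>_gt by (intro mult_left_mono powr_mono2) auto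
    finally show ?thesis using norm_triangle_sub[of "x n t" y0] by linarith
  qed
  obtain g k where g: "strict_mono (k :: nat \<Rightarrow> nat)"
    and lim: "\<And>e. 0 < e \<Longrightarrow> \<exists>N. \<forall>n t. n \<ge> N \<and> t \<in> {0..T} \<longrightarrow> norm (x (k n) t - g t) < e"
  proof (rule Arzela_Ascoli[of "{0..T}" x "norm y0 + ?R * T powr \<alpha>"])
    fix s e :: real assume s: "s \<in> {0..T}" and e: "0 < e"
    \<comment> \<open>The inverse of the Hoelder modulus; R + 1 excludes division by zero and makes
      the final inequality strict.\<close>
    define d where "d = (e / (?R + 1)) powr (1 / \<alpha>)"
    have d: "0 < d" using e R by (simp add: d_def)
    have "norm (x n s - x n t) < e" if t: "t \<in> {0..T}" "norm (s - t) < d" for n t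
    proof -
      have "\<bar>s - t\<bar> powr \<alpha> \<le> d powr \<alpha>" using t \<alpha>_gt by (intro powr_mono2) auto
      also have "\<dots> = e / (?R + 1)" using \<alpha>_gt e R by (simp add: d_def powr_powr)
      finally have "norm (x n s - x n t) \<le> ?R * (e / (?R + 1))"
        using diff'[OF s t(1), of n] mult_left_mono[OF _ R] by (meson order_trans)
      also have "\<dots> < e" using e R by (simp add: field_simps)
      finally show ?thesis .
    qed
    with d show "\<exists>d>0. \<forall>n t. t \<in> {0..T} \<and> norm (s - t) < d \<longrightarrow> norm (x n s - x n t) < e" by blast
  next
    fix g' :: "real \<Rightarrow> 'e" and k' :: "nat \<Rightarrow> nat"
    assume "strict_mono k'" "\<And>e. 0 < e \<Longrightarrow> \<exists>N. \<forall>n t. n \<ge> N \<and> t \<in> {0..T} \<longrightarrow> norm (x (k' n) t - g' t) < e"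
    then show thesis by (rule that)
  qed (use bound in simp_all)
  have conv: "(\<lambda>n. x (k n) t) \<longlonglongrightarrow> g t" if "t \<in> {0..T}" for t
    unfolding LIMSEQ_iff using lim that by meson
  have "norm (rem g s t) \<le> K B0 * (t - s) powr (3 * \<alpha>)" if st: "0 \<le> s" "s \<le> t" "t \<le> T" for s t
  proof (cases "s = t")
    case True
    then show ?thesis using st inc_refl by (simp add: rem_def)
  next
    case False
    have "(\<lambda>n. inc s t (x (k n) s)) \<longlonglongrightarrow> inc s t (g s)"
    proof (rule Lim_null_comparison[THEN LIM_zero_cancel])
      show "eventually (\<lambda>n. norm (inc s t (x (k n) s) - inc s t (g s)) \<le> M * (N1 s t + N2 s t) * norm (x (k n) s - g s)) sequentially"
        by (intro always_eventually allI inc_lipschitz)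
      have "(\<lambda>n. norm (x (k n) s - g s)) \<longlonglongrightarrow> 0"
        using conv[of s] st by (intro tendsto_norm_zero LIM_zero) auto
      then show "(\<lambda>n. M * (N1 s t + N2 s t) * norm (x (k n) s - g s)) \<longlonglongrightarrow> 0"
        by (rule tendsto_mult_right_zero)
    qed
    then have l: "(\<lambda>n. norm (rem (x (k n)) s t)) \<longlonglongrightarrow> norm (rem g s t)"
      unfolding rem_def using conv st by (intro tendsto_intros) auto
    have half: "r / 2 < q" if "0 < r" "r < q" for r q :: real using that by simp
    \<comment> \<open>For fixed s < t the mesh is eventually smaller than t - s, and the uniform
      remainder bound passes to the limit.\<close>
    have "(\<lambda>n. T / real (Suc n)) \<longlonglongrightarrow> 0"
      using tendsto_mult[OF tendsto_const[of T] LIMSEQ_inverse_real_of_nat] by (simp add: divide_inverse)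
    moreover have "0 < t - s" using False st by simp
    ultimately have "eventually (\<lambda>n. T / real (Suc n) < t - s) sequentially"
      by (rule order_tendstoD)
    then have "eventually (\<lambda>n. T / real (Suc (k n)) < t - s) sequentially"
      using filterlim_subseq[OF g] unfolding filterlim_iff by blast
    then have "eventually (\<lambda>n. norm (rem (x (k n)) s t) \<le> K B0 * (t - s) powr (3 * \<alpha>)) sequentially"
    proof eventually_elim
      case (elim n)
      have "T / real (Suc (k n)) / 2 < t - s"
        by (rule half[OF \<delta> elim])
      then show ?case unfolding x_def using st by (intro milstein_rem_bound[OF \<delta>]) auto
    qed
    then show ?thesis by (rule tendsto_upperbound[OF l]) simp
  qed
  moreover have "g 0 = y0" using conv[of 0] T_pos x0 LIMSEQ_const_iff[of y0 "g 0"] by simp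
  ultimately show ?thesis using that K_nonneg[OF B0_nonneg] by blast
qed

end

section \<open>The maximal solution\<close>

lemma cutoff_system:
  fixes f :: "'n::finite \<Rightarrow> 'd::finite \<Rightarrow> real ^ 'n \<Rightarrow> real"
  assumes f: "C2_coeff f" and R: "0 \<le> R"
    and chen: "chen_relation w a"
    and increment: "\<And>s t. 0 \<le> s \<Longrightarrow> s \<le> t \<Longrightarrow> t \<le> T \<Longrightarrow> increment_sum w s t \<le> c * (t - s) powr \<alpha>"
    and area: "\<And>s t. 0 \<le> s \<Longrightarrow> s \<le> t \<Longrightarrow> t \<le> T \<Longrightarrow> area_sum a s t \<le> c * (t - s) powr (2 * \<alpha>)"
    and c: "0 \<le> c" and \<alpha>: "1 / 3 < \<alpha>" and T: "0 < T"
  obtains F D L where "rough_equation F D L w a c \<alpha> T"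
    "\<And>s t x i. norm x \<le> R \<Longrightarrow> rough_equation.inc F D w a s t x $ i =
       (\<Sum>j\<in>UNIV. f i j x * (w j t - w j s))
       + (\<Sum>h\<in>UNIV. \<Sum>r\<in>UNIV. \<Sum>j\<in>UNIV. f h r x * partial_deriv h (f i j) x * a r j s t)"
proof -
  obtain F D L where sf: "smooth_fields F D L"
    and F: "\<And>j i x. norm x \<le> R \<Longrightarrow> F j x $ i = f i j x"
    and D: "\<And>j i x v. norm x \<le> R \<Longrightarrow> D j x v $ i = (\<Sum>h\<in>UNIV. partial_deriv h (f i j) x * v $ h)"
    by (rule smooth_fields_cutoff[OF f R], rule that)
  interpret sf: smooth_fields F D L by (fact sf)
  have re: "rough_equation F D L w a c \<alpha> T"
    by (intro rough_equation.intro rough_equation_axioms.intro) (fact sf chen increment area c \<alpha> T)+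
  then interpret re: rough_equation F D L w a c \<alpha> T .
  have "re.inc s t x $ i = (\<Sum>j\<in>UNIV. f i j x * (w j t - w j s))
       + (\<Sum>h\<in>UNIV. \<Sum>r\<in>UNIV. \<Sum>j\<in>UNIV. f h r x * partial_deriv h (f i j) x * a r j s t)"
    if x: "norm x \<le> R" for s t x i
  proof -
    \<comment> \<open>In coordinates \<open>G\<close> produces the sum over h innermost; two
      exchanges move it outside, as in \<open>solution_on_def\<close>.\<close>
    have "(\<Sum>r\<in>UNIV. \<Sum>j\<in>UNIV. a r j s t * sf.G r j x $ i)
        = (\<Sum>r\<in>UNIV. \<Sum>j\<in>UNIV. \<Sum>h\<in>UNIV. f h r x * partial_deriv h (f i j) x * a r j s t)"
      by (simp add: sf.G_def D[OF x] F[OF x] sum_distrib_left mult_ac)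
    also have "\<dots> = (\<Sum>r\<in>UNIV. \<Sum>h\<in>UNIV. \<Sum>j\<in>UNIV. f h r x * partial_deriv h (f i j) x * a r j s t)"
      by (intro sum.cong refl sum.swap)
    also have "\<dots> = (\<Sum>h\<in>UNIV. \<Sum>r\<in>UNIV. \<Sum>j\<in>UNIV. f h r x * partial_deriv h (f i j) x * a r j s t)"
      by (rule sum.swap)
    finally show ?thesis by (simp add: re.inc_def F[OF x] mult.commute)
  qed
  with re show thesis by (rule that)
qed

text \<open>Besides shortening the interval this replaces the path by one that agrees with it there;
  \<open>max_sol\<close> is recognised as a solution in this way.\<close>

lemma solution_on_restrict:
  assumes sol: "solution_on f w a y0 t1 y" and t: "0 \<le> t2" "t2 \<le> t1"
    and eq: "\<And>s. 0 \<le> s \<Longrightarrow> s \<le> t2 \<Longrightarrow> y' s = y s"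
  shows "solution_on f w a y0 t2 y'"
proof -
  obtain \<Omega> \<theta> where *: "continuous_on {0..t1} \<Omega>" "mono_on {0..t1} \<Omega>"
     "\<forall>\<delta>\<ge>0. 0 \<le> \<theta> \<delta>" "\<theta> 0 = 0" "\<theta> \<in> o[at_right 0](\<lambda>\<delta>. \<delta>)"
     and b: "\<And>i s t. 0 \<le> s \<Longrightarrow> s < t \<Longrightarrow> t \<le> t1 \<Longrightarrow>
           \<bar>y t $ i - y s $ i
             - (\<Sum>j\<in>UNIV. f i j (y s) * (w j t - w j s))
             - (\<Sum>h\<in>UNIV. \<Sum>r\<in>UNIV. \<Sum>j\<in>UNIV.
                  f h r (y s) * partial_deriv h (f i j) (y s) * a r j s t)\<bar>
           \<le> \<theta> (\<Omega> t - \<Omega> s)"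
    and y0: "y 0 = y0"
    using sol unfolding solution_on_def by blast
  have "continuous_on {0..t2} \<Omega>" "mono_on {0..t2} \<Omega>"
    using continuous_on_subset[OF *(1)] mono_on_subset[OF *(2)] t by auto
  then show ?thesis
    unfolding solution_on_def using *(3-5) y0 b eq t
    by (intro conjI exI[of _ \<Omega>] exI[of _ \<theta>]) auto
qed

section \<open>Boundedness, uniqueness and maximality for one fixed tame path\<close>

locale tame_equation =
  fixes f :: "'n::finite \<Rightarrow> 'd::finite \<Rightarrow> real ^ 'n \<Rightarrow> real"
    and w :: "'d \<Rightarrow> real \<Rightarrow> real" and a :: "'d \<Rightarrow> 'd \<Rightarrow> real \<Rightarrow> real \<Rightarrow> real"
    and c \<alpha> T :: real and y0 :: "real ^ 'n"
  assumes f: "C2_coeff f" and chen: "chen_relation w a"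
    and increment: "\<And>s t. 0 \<le> s \<Longrightarrow> s \<le> t \<Longrightarrow> t \<le> T \<Longrightarrow> increment_sum w s t \<le> c * (t - s) powr \<alpha>"
    and area: "\<And>s t. 0 \<le> s \<Longrightarrow> s \<le> t \<Longrightarrow> t \<le> T \<Longrightarrow> area_sum a s t \<le> c * (t - s) powr (2 * \<alpha>)"
    and c: "0 \<le> c" and \<alpha>: "1 / 3 < \<alpha>" and T: "0 < T" and tame: "tame w a T"
begin

abbreviation sol :: "real \<Rightarrow> (real \<Rightarrow> real ^ 'n) \<Rightarrow> bool" where
  "sol t y \<equiv> solution_on f w a y0 t y"

text \<open>A predicate and not a locale, since one argument may involve several truncations with
  different radii.\<close>

definition cutoff :: "real \<Rightarrow> ('d \<Rightarrow> real ^ 'n \<Rightarrow> real ^ 'n) \<Rightarrow> ('d \<Rightarrow> real ^ 'n \<Rightarrow> real ^ 'n \<Rightarrow> real ^ 'n) \<Rightarrow> real \<Rightarrow> bool" where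
  "cutoff R F D L \<longleftrightarrow> rough_equation F D L w a c \<alpha> T \<and>
    (\<forall>s t x i. norm x \<le> R \<longrightarrow> rough_equation.inc F D w a s t x $ i =
       (\<Sum>j\<in>UNIV. f i j x * (w j t - w j s))
       + (\<Sum>h\<in>UNIV. \<Sum>r\<in>UNIV. \<Sum>j\<in>UNIV. f h r x * partial_deriv h (f i j) x * a r j s t))"

lemma cutoff_exists:
  assumes "0 \<le> R"
  obtains F D L where "cutoff R F D L"
proof (rule cutoff_system[OF f assms chen increment area c \<alpha> T])
  fix F D L
  assume "rough_equation F D L w a c \<alpha> T"
    "\<And>s t x i. norm x \<le> R \<Longrightarrow> rough_equation.inc F D w a s t x $ i =
       (\<Sum>j\<in>UNIV. f i j x * (w j t - w j s))
       + (\<Sum>h\<in>UNIV. \<Sum>r\<in>UNIV. \<Sum>j\<in>UNIV. f h r x * partial_deriv h (f i j) x * a r j s t)"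
  then have "cutoff R F D L" unfolding cutoff_def by blast
  then show thesis by (rule that)
qed

text \<open>The control is fixed before the truncation, so the same \<Omega> and \<theta> serve
  every radius. Only the left end point has to lie inside the radius, because the expansion is
  evaluated there.\<close>

lemma solution_weak_rem:
  assumes "sol t1 y"
  obtains \<Omega> \<theta> where "continuous_on {0..t1} \<Omega>" "mono_on {0..t1} \<Omega>" "\<theta> 0 = 0" "\<theta> \<in> o[at_right 0](\<lambda>\<delta>. \<delta>)"
    "\<And>R F D L s t. cutoff R F D L \<Longrightarrow> 0 \<le> s \<Longrightarrow> s < t \<Longrightarrow> t \<le> t1 \<Longrightarrow> norm (y s) \<le> R \<Longrightarrow>
       norm (rough_equation.rem F D w a y s t) \<le> \<theta> (\<Omega> t - \<Omega> s)"
proof -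
  obtain \<Omega> \<theta> where *: "continuous_on {0..t1} \<Omega>" "mono_on {0..t1} \<Omega>"
     "\<theta> 0 = 0" "\<theta> \<in> o[at_right 0](\<lambda>\<delta>. \<delta>)"
     and b: "\<And>i s t. 0 \<le> s \<Longrightarrow> s < t \<Longrightarrow> t \<le> t1 \<Longrightarrow>
           \<bar>y t $ i - y s $ i
             - (\<Sum>j\<in>UNIV. f i j (y s) * (w j t - w j s))
             - (\<Sum>h\<in>UNIV. \<Sum>r\<in>UNIV. \<Sum>j\<in>UNIV.
                  f h r (y s) * partial_deriv h (f i j) (y s) * a r j s t)\<bar>
           \<le> \<theta> (\<Omega> t - \<Omega> s)"
    using assms unfolding solution_on_def by blast
  show thesis
  proof (rule that[OF *(1,2)])
    show "real CARD('n) * \<theta> 0 = 0" using * by simp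
    show "(\<lambda>\<delta>. real CARD('n) * \<theta> \<delta>) \<in> o[at_right 0](\<lambda>\<delta>. \<delta>)" using * by simp
    fix R F D L s t assume cut: "cutoff R F D L" and st: "0 \<le> s" "s < t" "t \<le> t1" "norm (y s) \<le> R"
    interpret re: rough_equation F D L w a c \<alpha> T using cut by (simp add: cutoff_def)
    have "norm (re.rem y s t) \<le> (\<Sum>i\<in>UNIV. \<bar>re.rem y s t $ i\<bar>)" by (rule norm_le_l1_cart)
    also have "\<dots> \<le> (\<Sum>i\<in>(UNIV :: 'n set). \<theta> (\<Omega> t - \<Omega> s))"
      using b[OF st(1-3)] cut st by (intro sum_mono) (simp add: re.rem_def cutoff_def diff_diff_add add.assoc)
    finally show "norm (re.rem y s t) \<le> real CARD('n) * \<theta> (\<Omega> t - \<Omega> s)" by simp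
  qed
qed

text \<open>The definition of a solution does not mention boundedness. A bound up to one time gives
  a truncation valid at that time, and the weak estimate then bounds the path over a further step
  whose length depends only on \<Omega> and \<theta>. Finitely many steps, each with its own
  truncation, reach t1.\<close>

lemma solution_bounded:
  assumes sol: "sol t1 y" and t1: "t1 \<le> T"
  obtains R where "0 \<le> R" "\<And>s. 0 \<le> s \<Longrightarrow> s \<le> t1 \<Longrightarrow> norm (y s) \<le> R"
proof -
  obtain \<Omega> \<theta> where \<Omega>: "continuous_on {0..t1} \<Omega>" "mono_on {0..t1} \<Omega>" and \<theta>: "\<theta> 0 = 0" "\<theta> \<in> o[at_right 0](\<lambda>\<delta>. \<delta>)"
    and weak: "\<And>R F D L s t. cutoff R F D L \<Longrightarrow> 0 \<le> s \<Longrightarrow> s < t \<Longrightarrow> t \<le> t1 \<Longrightarrow> norm (y s) \<le> R \<Longrightarrow>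
       norm (rough_equation.rem F D w a y s t) \<le> \<theta> (\<Omega> t - \<Omega> s)"
    using solution_weak_rem[OF sol] by metis
  have "eventually (\<lambda>\<delta>. norm (\<theta> \<delta>) \<le> 1 * norm \<delta>) (at_right 0)"
    by (rule landau_o.smallD[OF \<theta>(2)]) simp
  then obtain d0 where d0: "0 < d0" "\<And>\<delta>. 0 < \<delta> \<Longrightarrow> \<delta> < d0 \<Longrightarrow> \<bar>\<theta> \<delta>\<bar> \<le> \<delta>"
    unfolding eventually_at_right_field by auto
  have "uniformly_continuous_on {0..t1} \<Omega>" using \<Omega> by (intro compact_uniformly_continuous) auto
  then obtain d1 where d1: "0 < d1" "\<And>x x'. x \<in> {0..t1} \<Longrightarrow> x' \<in> {0..t1} \<Longrightarrow> dist x' x < d1 \<Longrightarrow> dist (\<Omega> x') (\<Omega> x) < d0"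
    using d0(1) unfolding uniformly_continuous_on_def by metis
  define d where "d = d1 / 2"
  have d: "0 < d" using d1 by (simp add: d_def)
  have "\<exists>R\<ge>0. \<forall>s. 0 \<le> s \<and> s \<le> t1 \<and> s \<le> real n * d \<longrightarrow> norm (y s) \<le> R" for n
  proof (induction n)
    case 0
    show ?case by (rule exI[of _ "norm (y 0)"]) auto
  next
    case (Suc n)
    then obtain R where R: "0 \<le> R" "\<And>s. 0 \<le> s \<Longrightarrow> s \<le> t1 \<Longrightarrow> s \<le> real n * d \<Longrightarrow> norm (y s) \<le> R" by blast
    obtain F D L where cut: "cutoff R F D L" using cutoff_exists[OF R(1)] .
    interpret re: rough_equation F D L w a c \<alpha> T using cut by (simp add: cutoff_def)
    let ?s = "real n * d"
    define B where "B = re.M * re.c1 * T powr \<alpha>"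
    have B: "0 \<le> B" using re.M re.c1_nonneg by (simp add: B_def)
    have "norm (y t) \<le> R + B + d0" if t: "0 \<le> t" "t \<le> t1" "t \<le> real (Suc n) * d" for t
    proof (cases "t \<le> ?s")
      case True
      then show ?thesis using R t B d0 by (meson add_increasing2 less_imp_le)
    next
      case False
      then have s: "0 \<le> ?s" "?s < t" "?s \<le> t1" using d t by auto
      have "dist (\<Omega> t) (\<Omega> ?s) < d0"
      proof (rule d1(2))
        show "?s \<in> {0..t1}" "t \<in> {0..t1}" using s(1,3) t(1,2) by auto
        show "dist t ?s < d1" using s(2) t(3) d by (simp add: dist_real_def d_def algebra_simps)
      qed
      moreover have "\<Omega> ?s \<le> \<Omega> t" using s t \<Omega>(2) by (auto intro: mono_onD)
      ultimately have "\<theta> (\<Omega> t - \<Omega> ?s) \<le> d0"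
        using d0(2)[of "\<Omega> t - \<Omega> ?s"] \<theta>(1) d0(1) by (cases "\<Omega> t = \<Omega> ?s") (auto simp: dist_real_def)
      then have r: "norm (re.rem y ?s t) \<le> d0"
        using weak[OF cut s(1,2) t(2) R(2)] s by simp
      have "norm (re.inc ?s t (y ?s)) \<le> B"
        unfolding B_def using s t t1 by (intro re.inc_le) auto
      moreover have "norm (y ?s) \<le> R" using R(2)[of ?s] s by simp
      ultimately have "norm (y ?s + re.inc ?s t (y ?s) + re.rem y ?s t) \<le> R + B + d0"
        using r by (intro norm_triangle_mono)
      then show ?thesis by (simp add: re.rem_def)
    qed
    then show ?case using R B d0 by (intro exI[of _ "R + B + d0"]) auto
  qed
  moreover obtain n :: nat where "t1 / d < real n" using reals_Archimedean2 by blast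
  then have "t1 \<le> real n * d" using d by (simp add: field_simps)
  ultimately obtain R where "R\<ge>0" "\<forall>s. 0 \<le> s \<and> s \<le> t1 \<and> s \<le> real n * d \<longrightarrow> norm (y s) \<le> R" by blast
  then show thesis using that \<open>t1 \<le> real n * d\<close> by (meson order_trans)
qed

text \<open>The radius is imposed for s < hi only, so the interval may end at a time when the path
  has just left the ball.\<close>

lemma solution_strong_rem:
  assumes sol: "sol t1 y" and t1: "t1 \<le> T" and lo: "0 \<le> lo" "hi \<le> t1"
    and R: "\<And>s. lo \<le> s \<Longrightarrow> s < hi \<Longrightarrow> norm (y s) \<le> R" and cut: "cutoff R F D L"
    and st: "lo \<le> s" "s \<le> t" "t \<le> hi"
  shows "norm (rough_equation.rem F D w a y s t) \<le> rough_equation.K L c \<alpha> T 0 * (t - s) powr (3 * \<alpha>)"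
proof -
  obtain \<Omega> \<theta> where \<Omega>: "continuous_on {0..t1} \<Omega>" "mono_on {0..t1} \<Omega>" and \<theta>: "\<theta> 0 = 0" "\<theta> \<in> o[at_right 0](\<lambda>\<delta>. \<delta>)"
    and weak: "\<And>R F D L s t. cutoff R F D L \<Longrightarrow> 0 \<le> s \<Longrightarrow> s < t \<Longrightarrow> t \<le> t1 \<Longrightarrow> norm (y s) \<le> R \<Longrightarrow>
       norm (rough_equation.rem F D w a y s t) \<le> \<theta> (\<Omega> t - \<Omega> s)"
    using solution_weak_rem[OF sol] by metis
  interpret re: rough_equation F D L w a c \<alpha> T using cut by (simp add: cutoff_def)
  show ?thesis
  proof (rule re.rem_strong_bound[OF lo(1) _ _ _ \<theta> _ st])
    show "hi \<le> T" using lo t1 by simp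
    show "continuous_on {lo..hi} \<Omega>" "mono_on {lo..hi} \<Omega>"
      using continuous_on_subset[OF \<Omega>(1)] mono_on_subset[OF \<Omega>(2)] lo by auto
    fix s t assume "lo \<le> s" "s < t" "t \<le> hi"
    then show "norm (re.rem y s t) \<le> \<theta> (\<Omega> t - \<Omega> s)" using lo by (intro weak[OF cut] R) auto
  qed
qed

lemma solution_of_strong_rem:
  assumes cut: "cutoff R F D L" and y: "y 0 = y0" and \<kappa>: "0 \<le> \<kappa>" and t1: "t1 \<le> T"
    and rem: "\<And>s t. 0 \<le> s \<Longrightarrow> s \<le> t \<Longrightarrow> t \<le> t1 \<Longrightarrow> norm (rough_equation.rem F D w a y s t) \<le> \<kappa> * (t - s) powr (3 * \<alpha>)"
    and R: "\<And>s. 0 \<le> s \<Longrightarrow> s \<le> t1 \<Longrightarrow> norm (y s) \<le> R"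
  shows "sol t1 y"
proof -
  interpret re: rough_equation F D L w a c \<alpha> T using cut by (simp add: cutoff_def)
  have "(\<lambda>x. x powr (3 * \<alpha>)) \<in> o[at_right 0](\<lambda>x::real. x)"
    using \<alpha> by real_asymp
  then have o: "(\<lambda>x. \<kappa> * x powr (3 * \<alpha>)) \<in> o[at_right 0](\<lambda>x::real. x)" by simp
  show ?thesis
    unfolding solution_on_def
  proof (rule conjI, fact y, rule exI[of _ "\<lambda>t::real. t"], rule exI[of _ "\<lambda>x. \<kappa> * x powr (3 * \<alpha>)"], intro conjI allI impI)
    fix i s t assume st: "0 \<le> s \<and> s < t \<and> t \<le> t1"
    have "norm (y s) \<le> R" using R st by auto
    then have "y t $ i - y s $ i - (\<Sum>j\<in>UNIV. f i j (y s) * (w j t - w j s))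
             - (\<Sum>h\<in>UNIV. \<Sum>r\<in>UNIV. \<Sum>j\<in>UNIV. f h r (y s) * partial_deriv h (f i j) (y s) * a r j s t)
        = re.rem y s t $ i"
      using cut by (simp add: re.rem_def cutoff_def)
    also have "\<bar>\<dots>\<bar> \<le> \<kappa> * (t - s) powr (3 * \<alpha>)"
      using rem[of s t] st component_le_norm_cart[of "re.rem y s t" i] by simp
    finally show "\<bar>y t $ i - y s $ i - (\<Sum>j\<in>UNIV. f i j (y s) * (w j t - w j s))
             - (\<Sum>h\<in>UNIV. \<Sum>r\<in>UNIV. \<Sum>j\<in>UNIV. f h r (y s) * partial_deriv h (f i j) (y s) * a r j s t)\<bar>
       \<le> \<kappa> * (t - s) powr (3 * \<alpha>)" .
  qed (use \<kappa> y o in \<open>auto simp: mono_on_def\<close>)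
qed

lemma solution_unique:
  assumes y: "sol t1 y" and p: "sol t1 p" and t1: "0 \<le> t1" "t1 \<le> T" and s: "s \<in> {0..t1}"
  shows "y s = p s"
proof -
  obtain R1 where R1: "0 \<le> R1" "\<And>s. 0 \<le> s \<Longrightarrow> s \<le> t1 \<Longrightarrow> norm (y s) \<le> R1" using solution_bounded[OF y t1(2)] by metis
  obtain R2 where R2: "0 \<le> R2" "\<And>s. 0 \<le> s \<Longrightarrow> s \<le> t1 \<Longrightarrow> norm (p s) \<le> R2" using solution_bounded[OF p t1(2)] by metis
  obtain F D L where cut: "cutoff (max R1 R2) F D L" by (rule cutoff_exists[of "max R1 R2"]) (use R1(1) in auto)
  interpret re: rough_equation F D L w a c \<alpha> T using cut by (simp add: cutoff_def)
  show ?thesis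
  proof (rule re.tame_unique[OF tame t1 re.K_nonneg[OF order_refl] _ _ _ s])
    show "y 0 = p 0" using y p by (simp add: solution_on_def)
    fix s t assume st: "0 \<le> s" "s \<le> t" "t \<le> t1"
    show "norm (re.rem y s t) \<le> re.K 0 * (t - s) powr (3 * \<alpha>)"
      by (rule solution_strong_rem[OF y t1(2) order_refl order_refl _ cut st]) (use R1 in \<open>auto simp: le_max_iff_disj\<close>)
    show "norm (re.rem p s t) \<le> re.K 0 * (t - s) powr (3 * \<alpha>)"
      by (rule solution_strong_rem[OF p t1(2) order_refl order_refl _ cut st]) (use R2 in \<open>auto simp: le_max_iff_disj\<close>)
  qed
qed

lemma small_powr:
  obtains \<delta> where "0 < \<delta>" "\<And>h. 0 \<le> h \<Longrightarrow> h \<le> \<delta> \<Longrightarrow> B * h powr \<alpha> < 1"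
proof
  let ?\<delta> = "(1 / (2 * (\<bar>B\<bar> + 1))) powr (1 / \<alpha>)"
  show "0 < ?\<delta>" by simp
  fix h assume h: "0 \<le> h" "h \<le> ?\<delta>"
  have "h powr \<alpha> \<le> ?\<delta> powr \<alpha>" using h \<alpha> by (intro powr_mono2) auto
  also have "\<dots> = 1 / (2 * (\<bar>B\<bar> + 1))" using \<alpha> by (simp add: powr_powr)
  finally have "\<bar>B\<bar> * h powr \<alpha> \<le> \<bar>B\<bar> * (1 / (2 * (\<bar>B\<bar> + 1)))" by (rule mult_left_mono) simp
  also have "\<dots> < 1" by (simp add: field_simps)
  finally show "B * h powr \<alpha> < 1" using mult_right_mono[OF abs_ge_self[of B] powr_ge_zero[of h \<alpha>]] by linarith
qed

lemma local_solution: "\<exists>t y. 0 < t \<and> t \<le> T \<and> sol t y"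
proof -
  obtain F D L where cut: "cutoff (norm y0 + 1) F D L" by (rule cutoff_exists[of "norm y0 + 1"]) auto
  interpret re: rough_equation F D L w a c \<alpha> T using cut by (simp add: cutoff_def)
  obtain y \<kappa> where y: "y 0 = y0" "0 \<le> \<kappa>"
    "\<And>s t. 0 \<le> s \<Longrightarrow> s \<le> t \<Longrightarrow> t \<le> T \<Longrightarrow> norm (re.rem y s t) \<le> \<kappa> * (t - s) powr (3 * \<alpha>)"
    using re.strong_solution_exists[of y0] by metis
  obtain \<delta> where \<delta>: "0 < \<delta>" "\<And>h. 0 \<le> h \<Longrightarrow> h \<le> \<delta> \<Longrightarrow> (re.C + \<kappa> * T powr (2 * \<alpha>)) * h powr \<alpha> < 1"
    using small_powr[of "re.C + \<kappa> * T powr (2 * \<alpha>)"] by metis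
  have "sol (min \<delta> T) y"
  proof (rule solution_of_strong_rem[where y=y, OF cut y(1,2)])
    fix s assume s: "0 \<le> s" "s \<le> min \<delta> T"
    have "norm (y s - y 0) \<le> (re.C + \<kappa> * T powr (2 * \<alpha>)) * (s - 0) powr \<alpha>"
      using s y(2) by (intro re.path_bound y(3)) auto
    also have "\<dots> < 1" using \<delta>(2)[of s] s by simp
    finally show "norm (y s) \<le> norm y0 + 1" using norm_triangle_sub[of "y s" y0] y(1) by simp
  qed (use y in auto)
  then show ?thesis using \<delta> T by (intro exI[of _ "min \<delta> T"] exI[of _ y]) auto
qed

definition lifetime :: real where
  "lifetime = Sup {t. 0 < t \<and> t \<le> T \<and> (\<exists>y. sol t y)}"

text \<open>For each t an independent choice of a solution on [0, t]; uniqueness makes the choices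
  fit together.\<close>

definition max_sol :: "real \<Rightarrow> real ^ 'n" where
  "max_sol t = (SOME y. sol t y) t"

lemma lifetime: "0 < lifetime" "lifetime \<le> T" "0 < t \<Longrightarrow> t \<le> T \<Longrightarrow> sol t y \<Longrightarrow> t \<le> lifetime"
proof -
  let ?S = "{t. 0 < t \<and> t \<le> T \<and> (\<exists>y. sol t y)}"
  have bdd: "bdd_above ?S" by (rule bdd_aboveI[of _ T]) auto
  then show up: "0 < t \<Longrightarrow> t \<le> T \<Longrightarrow> sol t y \<Longrightarrow> t \<le> lifetime" for t y
    unfolding lifetime_def by (intro cSup_upper) auto
  obtain t y where t: "0 < t" "t \<le> T" "sol t y" using local_solution by blast
  with up[OF t] show "0 < lifetime" by simp
  show "lifetime \<le> T" unfolding lifetime_def using t by (intro cSup_least) auto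
qed

lemma max_sol_eq:
  assumes "sol t y" "0 \<le> s" "s \<le> t" "t \<le> T"
  shows "max_sol s = y s"
proof -
  have "sol s y" by (rule solution_on_restrict[OF assms(1-3)]) simp
  then have "sol s (SOME y. sol s y)" by (rule someI[of "sol s"])
  from solution_unique[OF this \<open>sol s y\<close>] show ?thesis using assms by (simp add: max_sol_def)
qed

lemma sol_max_sol:
  assumes "0 \<le> t" "t < lifetime"
  shows "sol t max_sol"
proof -
  let ?S = "{t. 0 < t \<and> t \<le> T \<and> (\<exists>y. sol t y)}"
  have "?S \<noteq> {}" using local_solution by blast
  then obtain t' where "t' \<in> ?S" "t < t'"
    using assms(2) less_cSup_iff[of ?S t] unfolding lifetime_def by (auto simp: bdd_above_def)
  then obtain y where y: "sol t' y" "t' \<le> T" "t < t'" by blast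
  show ?thesis
    by (rule solution_on_restrict[OF y(1) assms(1)]) (use y max_sol_eq[OF y(1)] in auto)
qed

text \<open>Otherwise the norm falls below some Z at times arbitrarily close to the lifetime. From a
  close enough such time on, the path cannot move by 1, so it is bounded up to the lifetime. The
  truncated equation for a larger radius has a solution on all of [0, T]; it coincides with
  \<open>max_sol\<close> before the lifetime and remains inside the radius a little longer, which
  contradicts maximality.\<close>

lemma explosion:
  assumes less: "lifetime < T"
  shows "filterlim (\<lambda>t. norm (max_sol t)) at_top (at_left lifetime)"
proof (rule ccontr)
  assume "\<not> ?thesis"
  then obtain Z0 where Z0: "\<not> eventually (\<lambda>t. Z0 \<le> norm (max_sol t)) (at_left lifetime)"
    unfolding filterlim_at_top by blast
  define Z where "Z = max Z0 0"
  have Z: "0 \<le> Z" by (simp add: Z_def)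
  have near: "\<exists>t. r < t \<and> t < lifetime \<and> norm (max_sol t) < Z" if "r < lifetime" for r
  proof (rule ccontr)
    assume "\<not> ?thesis"
    then have "\<not> norm (max_sol t) < Z" if "r < t" "t < lifetime" for t
      using that by blast
    then have "Z0 \<le> norm (max_sol t)" if "r < t" "t < lifetime" for t
      using that by (fastforce simp: Z_def not_less)
    with Z0 \<open>r < lifetime\<close> show False unfolding eventually_at_left_field by blast
  qed
  obtain F D L where cut: "cutoff (Z + 1) F D L" by (rule cutoff_exists[of "Z + 1"]) (use Z in auto)
  interpret re: rough_equation F D L w a c \<alpha> T using cut by (simp add: cutoff_def)
  define B where "B = re.C + re.K 0 * T powr (2 * \<alpha>)"
  obtain \<delta> where \<delta>: "0 < \<delta>" "\<And>h. 0 \<le> h \<Longrightarrow> h \<le> \<delta> \<Longrightarrow> B * h powr \<alpha> < 1"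
    using small_powr[of B] by metis
  obtain t0 where t0: "max 0 (lifetime - \<delta>) < t0" "t0 < lifetime" "norm (max_sol t0) < Z"
    using near[of "max 0 (lifetime - \<delta>)"] lifetime(1) \<delta>(1) by auto
  have stay: "norm (max_sol t1) \<le> Z + 1" if t1: "t0 \<le> t1" "t1 < lifetime" for t1
  proof (rule ccontr)
    assume big: "\<not> norm (max_sol t1) \<le> Z + 1"
    have sol1: "sol t1 max_sol" using t0 t1 by (intro sol_max_sol) auto
    have T1: "t1 \<le> T" using t1 lifetime(2) by simp
    \<comment> \<open>Continuity makes the exit set closed, so that it contains its infimum, the
      first exit time.\<close>
    have cont: "continuous_on {0..t1} max_sol"
    proof -
      obtain R where R: "0 \<le> R" "\<And>s. 0 \<le> s \<Longrightarrow> s \<le> t1 \<Longrightarrow> norm (max_sol s) \<le> R" using solution_bounded[OF sol1 T1] by metis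
      obtain F' D' L' where cut': "cutoff R F' D' L'" using cutoff_exists[OF R(1)] .
      interpret re': rough_equation F' D' L' w a c \<alpha> T using cut' by (simp add: cutoff_def)
      define B' where "B' = re'.C + re'.K 0 * T powr (2 * \<alpha>)"
      have *: "dist (max_sol t) (max_sol s) \<le> B' * \<bar>t - s\<bar> powr \<alpha>" if "s \<in> {0..t1}" "t \<in> {0..t1}" "s \<le> t" for s t
        unfolding B'_def dist_norm abs_of_nonneg[of "t - s", OF diff_ge_0_iff_ge[THEN iffD2, OF that(3)]]
        using that T1 R re'.K_nonneg[of 0]
        by (intro re'.path_bound solution_strong_rem[OF sol1 T1 order_refl order_refl _ cut']) auto
      have *: "dist (max_sol t) (max_sol s) \<le> B' * \<bar>t - s\<bar> powr \<alpha>" if "s \<in> {0..t1}" "t \<in> {0..t1}" for s t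
        using *[of s t] *[of t s] that by (cases "s \<le> t") (auto simp: dist_commute abs_minus_commute)
      show ?thesis unfolding continuous_on_def
      proof
        fix s assume s: "s \<in> {0..t1}"
        have "((\<lambda>t. dist (max_sol t) (max_sol s)) \<longlongrightarrow> 0) (at s within {0..t1})"
        proof (rule Lim_null_comparison)
          show "eventually (\<lambda>t. norm (dist (max_sol t) (max_sol s)) \<le> B' * \<bar>t - s\<bar> powr \<alpha>) (at s within {0..t1})"
            using * s by (auto simp: eventually_at_filter)
          have "((\<lambda>t. B' * \<bar>t - s\<bar> powr \<alpha>) \<longlongrightarrow> B' * (\<bar>s - s\<bar> powr \<alpha>)) (at s within {0..t1})"
            using \<alpha> by (intro tendsto_intros tendsto_powr2) auto
          then show "((\<lambda>t. B' * \<bar>t - s\<bar> powr \<alpha>) \<longlongrightarrow> 0) (at s within {0..t1})" by simp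
        qed
        then show "(max_sol \<longlongrightarrow> max_sol s) (at s within {0..t1})" by (subst tendsto_dist_iff)
      qed
    qed
    define E where "E = {t \<in> {t0..t1}. Z + 1 \<le> norm (max_sol t)}"
    have "closed E" unfolding E_def
      using continuous_on_subset[OF cont, of "{t0..t1}"] t0
      by (intro continuous_on_closed_Collect_le continuous_intros) auto
    moreover have "t1 \<in> E" using big t1 by (simp add: E_def)
    moreover have "bdd_below E" by (rule bdd_belowI[of _ t0]) (auto simp: E_def)
    ultimately have t2: "Inf E \<in> E" by (intro closed_contains_Inf) auto
    define t2 where "t2 = Inf E"
    have before: "norm (max_sol s) \<le> Z + 1" if "t0 \<le> s" "s < t2" for s
    proof (rule ccontr)
      assume "\<not> norm (max_sol s) \<le> Z + 1"
      then have "s \<in> E" using that t2 by (auto simp: E_def t2_def)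
      then have "t2 \<le> s" unfolding t2_def by (rule cInf_lower) fact
      with that show False by simp
    qed
    have t2': "t0 \<le> t2" "t2 \<le> t1" "Z + 1 \<le> norm (max_sol t2)" using t2 by (auto simp: E_def t2_def)
    \<comment> \<open>The path is inside the radius before \<open>t2\<close>, which is all that the
      remainder bound up to \<open>t2\<close> asks for.\<close>
    have "norm (re.rem max_sol t0 t2) \<le> re.K 0 * (t2 - t0) powr (3 * \<alpha>)"
      using t0 t2' before by (intro solution_strong_rem[where lo=t0, OF sol1 T1 _ t2'(2) _ cut]) auto
    then have "norm (max_sol t2 - max_sol t0) \<le> B * (t2 - t0) powr \<alpha>"
      unfolding B_def using t0 t2' T1 re.K_nonneg[of 0] by (intro re.path_bound) auto
    also have "\<dots> < 1" using t0 t2' t1 by (intro \<delta>(2)) auto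
    finally show False using t0(3) t2'(3) norm_triangle_sub[of "max_sol t2" "max_sol t0"] by linarith
  qed
  obtain R0 where R0: "0 \<le> R0" "\<And>s. 0 \<le> s \<Longrightarrow> s \<le> t0 \<Longrightarrow> norm (max_sol s) \<le> R0"
    using solution_bounded[OF sol_max_sol[of t0]] t0 lifetime(2) by auto
  define R where "R = max R0 (Z + 1)"
  have R: "norm (max_sol s) \<le> R" "0 \<le> R" if "0 \<le> s" "s < lifetime" for s
    using R0 stay[of s] that by (cases "s \<le> t0"; fastforce simp: R_def le_max_iff_disj)+
  then have Rnn: "0 \<le> R" using R0 by (simp add: R_def)
  \<comment> \<open>The additional 1 is the room for moving beyond the lifetime.\<close>
  obtain F' D' L' where cut': "cutoff (R + 1) F' D' L'" by (rule cutoff_exists[of "R + 1"]) (use Rnn in auto)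
  interpret re': rough_equation F' D' L' w a c \<alpha> T using cut' by (simp add: cutoff_def)
  obtain y \<kappa> where y: "y 0 = y0" "0 \<le> \<kappa>"
    "\<And>s t. 0 \<le> s \<Longrightarrow> s \<le> t \<Longrightarrow> t \<le> T \<Longrightarrow> norm (re'.rem y s t) \<le> \<kappa> * (t - s) powr (3 * \<alpha>)"
    using re'.strong_solution_exists[of y0] by metis
  have eq: "y s = max_sol s" if s: "0 \<le> s" "s < lifetime" for s
  proof (rule re'.tame_unique[OF tame s(1) _ _ _ _ _ , where \<kappa>="max \<kappa> (re'.K 0)"])
    show "s \<le> T" "0 \<le> max \<kappa> (re'.K 0)" "s \<in> {0..s}" using s lifetime(2) y by auto
    have sols: "sol s max_sol" using s by (intro sol_max_sol) auto
    then show "y 0 = max_sol 0" using y by (simp add: solution_on_def)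
    fix r t assume rt: "0 \<le> r" "r \<le> t" "t \<le> s"
    have "norm (re'.rem y r t) \<le> \<kappa> * (t - r) powr (3 * \<alpha>)" using y rt \<open>s \<le> T\<close> by auto
    also have "\<dots> \<le> max \<kappa> (re'.K 0) * (t - r) powr (3 * \<alpha>)" by (intro mult_right_mono) auto
    finally show "norm (re'.rem y r t) \<le> max \<kappa> (re'.K 0) * (t - r) powr (3 * \<alpha>)" .
    have "norm (re'.rem max_sol r t) \<le> re'.K 0 * (t - r) powr (3 * \<alpha>)"
      using R s by (intro solution_strong_rem[OF sols \<open>s \<le> T\<close> order_refl order_refl _ cut' rt]) force
    also have "\<dots> \<le> max \<kappa> (re'.K 0) * (t - r) powr (3 * \<alpha>)" by (intro mult_right_mono) auto
    finally show "norm (re'.rem max_sol r t) \<le> max \<kappa> (re'.K 0) * (t - r) powr (3 * \<alpha>)" .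
  qed
  obtain d where d: "0 < d" "\<And>h. 0 \<le> h \<Longrightarrow> h \<le> d \<Longrightarrow> (re'.C + \<kappa> * T powr (2 * \<alpha>)) * h powr \<alpha> < 1"
    using small_powr[of "re'.C + \<kappa> * T powr (2 * \<alpha>)"] by metis
  \<comment> \<open>A time before the lifetime, where \<open>y\<close> is known to be at most R, so
    close to \<open>t1\<close> that \<open>y\<close> moves by less than 1 between them.\<close>
  define q where "q = max 0 (lifetime - d / 2)"
  define t1 where "t1 = min T (lifetime + d / 2)"
  have q: "0 \<le> q" "q < lifetime" "lifetime < t1" "t1 \<le> T" "t1 - q \<le> d" using lifetime(1) d(1) less by (auto simp: q_def t1_def)
  have "sol t1 y"
  proof (rule solution_of_strong_rem[where y=y, OF cut' y(1,2) q(4)])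
    fix s assume s: "0 \<le> s" "s \<le> t1"
    show "norm (y s) \<le> R + 1"
    proof (cases "s < lifetime")
      case True
      then show ?thesis using R s eq by (simp add: add_increasing2)
    next
      case False
      have "norm (y s - y q) \<le> (re'.C + \<kappa> * T powr (2 * \<alpha>)) * (s - q) powr \<alpha>"
        using s y(2) q False by (intro re'.path_bound y(3)) auto
      also have "\<dots> < 1" using s q False by (intro d(2)) auto
      finally show ?thesis using norm_triangle_sub[of "y s" "y q"] eq[OF q(1,2)] R(1)[OF q(1,2)] by simp
    qed
  qed (use y q in auto)
  then have "t1 \<le> lifetime" using lifetime(1) q by (intro lifetime(3)) auto
  with q show False by simp
qed

lemma pathwise_theorem:
  "\<exists>\<tau> y. 0 < \<tau> \<and> \<tau> \<le> T \<and> solution_before f w a y0 \<tau> y \<and>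
     (\<tau> < T \<longrightarrow> filterlim (\<lambda>t. norm (y t)) at_top (at_left \<tau>)) \<and>
     (\<forall>t y'. 0 \<le> t \<and> t < \<tau> \<and> solution_on f w a y0 t y' \<longrightarrow> (\<forall>s\<in>{0..t}. y' s = y s))"
proof (intro exI[of _ lifetime] exI[of _ max_sol] conjI allI impI ballI)
  show "solution_before f w a y0 lifetime max_sol"
    unfolding solution_before_def using sol_max_sol by blast
  fix t y' s assume "0 \<le> t \<and> t < lifetime \<and> sol t y'" "s \<in> {0..t}"
  then show "y' s = max_sol s" using max_sol_eq[of t y' s] lifetime(2) by auto
qed (use lifetime explosion in auto)

end

section \<open>Roughness of Brownian paths\<close>

text \<open>Cauchy-Schwarz with weights 1 and n for the root and the two subtrees. With this choice
  the bound n^2 of the induction becomes (n + 1) (1 + n), which is exactly (n + 1)^2.\<close>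

lemma weighted_square_sum:
  fixes x y z n :: real
  assumes "0 < n"
  shows "(x + y + z)\<^sup>2 \<le> (n + 1) * (x\<^sup>2 + (2 / n) * (y\<^sup>2 + z\<^sup>2))"
proof -
  define u where "u = y + z"
  have u: "u\<^sup>2 \<le> 2 * (y\<^sup>2 + z\<^sup>2)" unfolding u_def using zero_le_power2[of "y - z"] by (simp add: power2_eq_square algebra_simps)
  have "(n + 1) * (x\<^sup>2 + u\<^sup>2 / n) - (x + u)\<^sup>2 = (n * x - u)\<^sup>2 / n"
    using assms by (simp add: power2_eq_square field_simps)
  then have "(x + u)\<^sup>2 \<le> (n + 1) * (x\<^sup>2 + u\<^sup>2 / n)"
    using assms by (metis diff_ge_0_iff_ge less_imp_le divide_nonneg_pos zero_le_power2)
  also have "\<dots> \<le> (n + 1) * (x\<^sup>2 + (2 * (y\<^sup>2 + z\<^sup>2)) / n)"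
    using assms u by (intro mult_left_mono add_left_mono divide_right_mono) auto
  finally show ?thesis by (simp add: u_def add.assoc)
qed

lemma tree_sum_measurable:
  assumes "\<And>m k. (\<lambda>\<omega>. V \<omega> m k) \<in> borel_measurable M"
  shows "(\<lambda>\<omega>. tree_sum (V \<omega>) n m k) \<in> borel_measurable M"
  by (induction n arbitrary: m k) (auto intro!: borel_measurable_add assms)

text \<open>The triangle inequality in mean square, level by level; no independence is involved.\<close>

lemma tree_sum_second_moment:
  assumes V: "\<And>m k. (\<lambda>\<omega>. V \<omega> m k) \<in> borel_measurable M"
    and bound: "\<And>m k. (\<integral>\<^sup>+\<omega>. ennreal ((V \<omega> m k)\<^sup>2) \<partial>M) \<le> ennreal (K * (T / 2 ^ m)\<^sup>2)" and K: "0 \<le> K"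
  shows "(\<integral>\<^sup>+\<omega>. ennreal ((tree_sum (V \<omega>) n m k)\<^sup>2) \<partial>M) \<le> ennreal (K * (real n * (T / 2 ^ m))\<^sup>2)"
proof (induction n arbitrary: m k)
  case 0
  show ?case by simp
next
  case (Suc n)
  show ?case
  proof (cases "n = 0")
    case True
    then show ?thesis using bound by simp
  next
    case False
    let ?x = "\<lambda>\<omega>. V \<omega> m k" and ?y = "\<lambda>\<omega>. tree_sum (V \<omega>) n (Suc m) (2 * k)"
      and ?z = "\<lambda>\<omega>. tree_sum (V \<omega>) n (Suc m) (2 * k + 1)"
    note [measurable] = V tree_sum_measurable[of V M, OF V]
    have "(\<integral>\<^sup>+\<omega>. ennreal ((tree_sum (V \<omega>) (Suc n) m k)\<^sup>2) \<partial>M)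
       \<le> (\<integral>\<^sup>+\<omega>. ennreal (real n + 1) * (ennreal ((?x \<omega>)\<^sup>2) + ennreal (2 / real n) * (ennreal ((?y \<omega>)\<^sup>2) + ennreal ((?z \<omega>)\<^sup>2))) \<partial>M)"
    proof (rule nn_integral_mono)
      fix \<omega>
      show "ennreal ((tree_sum (V \<omega>) (Suc n) m k)\<^sup>2) \<le> ennreal (real n + 1) * (ennreal ((?x \<omega>)\<^sup>2) + ennreal (2 / real n) * (ennreal ((?y \<omega>)\<^sup>2) + ennreal ((?z \<omega>)\<^sup>2)))"
        using weighted_square_sum[of "real n" "?x \<omega>" "?y \<omega>" "?z \<omega>"] False
        by (simp add: ennreal_plus[symmetric] ennreal_mult[symmetric] del: ennreal_plus)
    qed
    also have "\<dots> = ennreal (real n + 1) * ((\<integral>\<^sup>+\<omega>. ennreal ((?x \<omega>)\<^sup>2) \<partial>M)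
        + ennreal (2 / real n) * ((\<integral>\<^sup>+\<omega>. ennreal ((?y \<omega>)\<^sup>2) \<partial>M) + (\<integral>\<^sup>+\<omega>. ennreal ((?z \<omega>)\<^sup>2) \<partial>M)))"
      by (simp add: nn_integral_cmult nn_integral_add)
    also have "\<dots> \<le> ennreal (real n + 1) * (ennreal (K * (T / 2 ^ m)\<^sup>2)
        + ennreal (2 / real n) * (ennreal (K * (real n * (T / 2 ^ Suc m))\<^sup>2) + ennreal (K * (real n * (T / 2 ^ Suc m))\<^sup>2)))"
      by (intro mult_left_mono add_mono bound Suc.IH) auto
    also have "\<dots> = ennreal ((real n + 1) * (K * (T / 2 ^ m)\<^sup>2
        + (2 / real n) * (K * (real n * (T / 2 ^ Suc m))\<^sup>2 + K * (real n * (T / 2 ^ Suc m))\<^sup>2)))"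
      using K by (simp add: ennreal_plus[symmetric] ennreal_mult[symmetric] del: ennreal_plus)
    also have "(real n + 1) * (K * (T / 2 ^ m)\<^sup>2
        + (2 / real n) * (K * (real n * (T / 2 ^ Suc m))\<^sup>2 + K * (real n * (T / 2 ^ Suc m))\<^sup>2))
       = K * (real (Suc n) * (T / 2 ^ m))\<^sup>2"
      using False by (simp add: power2_eq_square field_simps)
    finally show ?thesis .
  qed
qed

text \<open>By Fatou the liminf of (S_n / n)^2 has mean at most K (T / 2^m)^2 on an interval of
  level m. Summed over 2^m intervals this is K T^2 / 2^m, which is summable over m; hence almost
  surely the level sums tend to 0.\<close>

lemma tree_sum_tame_AE:
  assumes V: "\<And>m k. (\<lambda>\<omega>. V \<omega> m k) \<in> borel_measurable M"
    and bound: "\<And>m k. (\<integral>\<^sup>+\<omega>. ennreal ((V \<omega> m k)\<^sup>2) \<partial>M) \<le> ennreal (K * (T / 2 ^ m)\<^sup>2)" and K: "0 \<le> K"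
  shows "AE \<omega> in M. \<forall>\<eta>>0. \<exists>m0. \<forall>m\<ge>m0. \<forall>k<2 ^ m. \<exists>\<^sub>\<infinity>n. tree_sum (V \<omega>) n m k \<le> \<eta> * real n"
proof -
  note [measurable] = V tree_sum_measurable[of V M, OF V]
  \<comment> \<open>\<open>Suc n\<close> keeps depth 0, with its zero denominator, out of the
    quotient.\<close>
  define Y where "Y m k \<omega> = liminf (\<lambda>n. ennreal ((tree_sum (V \<omega>) (Suc n) m k / real (Suc n))\<^sup>2))" for m k \<omega>
  have [measurable]: "Y m k \<in> borel_measurable M" for m k unfolding Y_def by measurable
  have Y: "(\<integral>\<^sup>+\<omega>. Y m k \<omega> \<partial>M) \<le> ennreal (K * (T / 2 ^ m)\<^sup>2)" for m k
  proof -
    have b: "(\<integral>\<^sup>+\<omega>. ennreal ((tree_sum (V \<omega>) (Suc n) m k / real (Suc n))\<^sup>2) \<partial>M) \<le> ennreal (K * (T / 2 ^ m)\<^sup>2)" for n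
    proof -
      let ?c = "1 / (real (Suc n))\<^sup>2"
      have "(\<integral>\<^sup>+\<omega>. ennreal ((tree_sum (V \<omega>) (Suc n) m k / real (Suc n))\<^sup>2) \<partial>M)
          = (\<integral>\<^sup>+\<omega>. ennreal ?c * ennreal ((tree_sum (V \<omega>) (Suc n) m k)\<^sup>2) \<partial>M)"
        by (intro nn_integral_cong) (simp only: ennreal_mult[symmetric] zero_le_power2 zero_le_divide_1_iff power_divide times_divide_eq_left mult_1)
      also have "\<dots> = ennreal ?c * (\<integral>\<^sup>+\<omega>. ennreal ((tree_sum (V \<omega>) (Suc n) m k)\<^sup>2) \<partial>M)"
        by (rule nn_integral_cmult) measurable
      also have "\<dots> \<le> ennreal ?c * ennreal (K * (real (Suc n) * (T / 2 ^ m))\<^sup>2)"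
        by (intro mult_left_mono tree_sum_second_moment[OF V bound K]) auto
      also have "\<dots> = ennreal (?c * (K * (real (Suc n) * (T / 2 ^ m))\<^sup>2))"
        using K by (intro ennreal_mult[symmetric]) auto
      also have "?c * (K * (real (Suc n) * (T / 2 ^ m))\<^sup>2) = K * (T / 2 ^ m)\<^sup>2"
      proof -
        have "1 / r * (K * (r * x)) = K * x" if "r \<noteq> 0" for r x :: real using that by simp
        then show ?thesis unfolding power_mult_distrib[of "real (Suc n)"] by simp
      qed
      finally show ?thesis .
    qed
    have "(\<integral>\<^sup>+\<omega>. Y m k \<omega> \<partial>M) \<le> liminf (\<lambda>n. \<integral>\<^sup>+\<omega>. ennreal ((tree_sum (V \<omega>) (Suc n) m k / real (Suc n))\<^sup>2) \<partial>M)"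
      unfolding Y_def by (rule nn_integral_liminf) measurable
    also have "\<dots> \<le> liminf (\<lambda>n. ennreal (K * (T / 2 ^ m)\<^sup>2))"
      by (intro Liminf_mono always_eventually allI b)
    also have "\<dots> = ennreal (K * (T / 2 ^ m)\<^sup>2)" by (rule Liminf_const) simp
    finally show ?thesis .
  qed
  define Q where "Q m \<omega> = (\<Sum>k<2 ^ m. Y m k \<omega>)" for m :: nat and \<omega>
  have [measurable]: "Q m \<in> borel_measurable M" for m unfolding Q_def by measurable
  have Q: "(\<integral>\<^sup>+\<omega>. Q m \<omega> \<partial>M) \<le> ennreal (K * T\<^sup>2 * (1 / 2) ^ m)" for m
  proof -
    have "(\<integral>\<^sup>+\<omega>. Q m \<omega> \<partial>M) = (\<Sum>k<2 ^ m. \<integral>\<^sup>+\<omega>. Y m k \<omega> \<partial>M)"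
      unfolding Q_def by (rule nn_integral_sum) measurable
    also have "\<dots> \<le> (\<Sum>k<(2::nat) ^ m. ennreal (K * (T / 2 ^ m)\<^sup>2))" by (intro sum_mono Y)
    also have "\<dots> = ennreal (\<Sum>k<(2::nat) ^ m. K * (T / 2 ^ m)\<^sup>2)" using K by (intro sum_ennreal) auto
    also have "(\<Sum>k<(2::nat) ^ m. K * (T / 2 ^ m)\<^sup>2) = K * T\<^sup>2 * (1 / 2) ^ m"
      by (simp add: power_divide power2_eq_square)
    finally show ?thesis .
  qed
  have "(\<integral>\<^sup>+\<omega>. (\<Sum>m. Q m \<omega>) \<partial>M) = (\<Sum>m. \<integral>\<^sup>+\<omega>. Q m \<omega> \<partial>M)"
    by (rule nn_integral_suminf) measurable
  also have "\<dots> \<le> (\<Sum>m. ennreal (K * T\<^sup>2 * (1 / 2) ^ m))" by (intro suminf_le Q summableI)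
  also have "\<dots> < top"
  proof -
    have "summable (\<lambda>m. K * T\<^sup>2 * (1 / 2 :: real) ^ m)" by (intro summable_mult summable_geometric) simp
    then have "(\<Sum>m. ennreal (K * T\<^sup>2 * (1 / 2) ^ m)) \<noteq> top"
      using K by (intro ennreal_suminf_neq_top) auto
    then show ?thesis by (simp add: less_top)
  qed
  finally have "(\<integral>\<^sup>+\<omega>. (\<Sum>m. Q m \<omega>) \<partial>M) \<noteq> \<infinity>" by simp
  then have "AE \<omega> in M. (\<Sum>m. Q m \<omega>) \<noteq> \<infinity>"
    by (intro nn_integral_PInf_AE) measurable
  then show ?thesis
  proof eventually_elim
    case (elim \<omega>)
    show ?case
    proof (intro allI impI)
      fix \<eta> :: real assume \<eta>: "0 < \<eta>"
      have fin: "Q m \<omega> < top" for m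
        using ennreal_suminf_lessD[of "\<lambda>m. Q m \<omega>" top m] elim by (simp add: less_top)
      have "(\<Sum>m. ennreal (enn2real (Q m \<omega>))) \<noteq> top" using elim fin by simp
      then have "summable (\<lambda>m. enn2real (Q m \<omega>))" by (intro summable_suminf_not_top) auto
      then have "(\<lambda>m. enn2real (Q m \<omega>)) \<longlonglongrightarrow> 0" by (rule summable_LIMSEQ_zero)
      from order_tendstoD(2)[OF this, of "\<eta>\<^sup>2"] have "eventually (\<lambda>m. enn2real (Q m \<omega>) < \<eta>\<^sup>2) sequentially"
        using \<eta> by simp
      then obtain m0 where m0: "\<And>m. m0 \<le> m \<Longrightarrow> enn2real (Q m \<omega>) < \<eta>\<^sup>2" by (auto simp: eventually_sequentially)
      show "\<exists>m0. \<forall>m\<ge>m0. \<forall>k<2 ^ m. \<exists>\<^sub>\<infinity>n. tree_sum (V \<omega>) n m k \<le> \<eta> * real n"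
      proof (intro exI[of _ m0] allI impI)
        fix m k :: nat assume m: "m0 \<le> m" and k: "k < 2 ^ m"
        \<comment> \<open>The sum over the level dominates each interval, so one \<open>m0\<close>
          serves every k.\<close>
        have "Y m k \<omega> \<le> Q m \<omega>" unfolding Q_def using k by (intro member_le_sum) auto
        also have "Q m \<omega> < ennreal (\<eta>\<^sup>2)"
          using m0[OF m] fin[of m] \<eta> by (metis enn2real_positive_iff ennreal_enn2real ennreal_less_iff enn2real_nonneg)
        finally have Y: "Y m k \<omega> < ennreal (\<eta>\<^sup>2)" .
        show "\<exists>\<^sub>\<infinity>n. tree_sum (V \<omega>) n m k \<le> \<eta> * real n"
        proof (rule ccontr)
          assume "\<not> ?thesis"
          \<comment> \<open>If all but finitely many depths were bad, the liminf would be at least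
            \<eta>^2.\<close>
          then have "eventually (\<lambda>n. \<eta> * real n < tree_sum (V \<omega>) n m k) sequentially"
            by (simp add: not_frequently cofinite_eq_sequentially not_le)
          then have "eventually (\<lambda>n. \<eta> * real (Suc n) < tree_sum (V \<omega>) (Suc n) m k) sequentially"
            by (rule eventually_sequentially_Suc[THEN iffD2])
          then have "eventually (\<lambda>n. ennreal (\<eta>\<^sup>2) \<le> ennreal ((tree_sum (V \<omega>) (Suc n) m k / real (Suc n))\<^sup>2)) sequentially"
          proof eventually_elim
            case (elim n)
            then have "\<eta> \<le> tree_sum (V \<omega>) (Suc n) m k / real (Suc n)" by (simp add: field_simps)
            then show ?case using \<eta> by (intro ennreal_leI power_mono) auto
          qed
          then have "ennreal (\<eta>\<^sup>2) \<le> Y m k \<omega>" unfolding Y_def by (rule Liminf_bounded)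
          with Y show False by simp
        qed
      qed
    qed
  qed
qed

section \<open>Second moments of iterated integrals\<close>

lemma Collect_mem_sets: "g \<in> measurable N N' \<Longrightarrow> S \<in> sets N' \<Longrightarrow> {x \<in> space N. g x \<in> S} \<in> sets N"
  by (drule (1) measurable_sets) (simp add: vimage_def Int_def conj_commute)

text \<open>The definition of Brownian motion gives independence along one partition at a time. The
  finitely many past times are arranged in such a partition, and past values are recovered as sums
  of increments.\<close>

lemma brownian_increment_indep_past:
  assumes bm: "standard_brownian_motion M B"
    and F: "finite F" "F \<subseteq> {0..t}" and t: "0 \<le> t" "t < u"
    and S: "\<And>s. S s \<in> sets borel" and D: "D \<in> sets borel"
  shows "measure M ({\<omega>\<in>space M. \<forall>s\<in>F. B s \<omega> \<in> S s} \<inter> {\<omega>\<in>space M. B u \<omega> - B t \<omega> \<in> D})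
    = measure M {\<omega>\<in>space M. \<forall>s\<in>F. B s \<omega> \<in> S s} * measure M {\<omega>\<in>space M. B u \<omega> - B t \<omega> \<in> D}"
proof -
  interpret prob_space M using bm by (simp add: standard_brownian_motion_def)
  have meas[measurable]: "B s \<in> borel_measurable M" if "0 \<le> s" for s
    using bm that by (simp add: standard_brownian_motion_def)
  \<comment> \<open>With 0 included, values are sums of increments from 0; with t included, the last
    increment is exactly the one from t to u.\<close>
  define X where "X = insert 0 (insert t F)"
  define xs where "xs = sorted_list_of_set X"
  define n where "n = length xs"
  define p where "p k = (if k < n then xs ! k else u)" for k
  define inc where "inc k \<omega> = B (p (Suc k)) \<omega> - B (p k) \<omega>" for k \<omega>
  have X: "finite X" "X \<subseteq> {0..t}" "0 \<in> X" "t \<in> X" using F t by (auto simp: X_def)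
  have set_xs: "set xs = X" "sorted xs" "distinct xs" using X by (auto simp: xs_def)
  have n: "0 < n" using set_xs X by (auto simp: n_def length_pos_if_in_set)
  have xs_bounds: "0 \<le> xs ! k" "xs ! k \<le> t" if "k < n" for k
  proof -
    have "xs ! k \<in> X" using that set_xs by (auto simp: n_def)
    then show "0 \<le> xs ! k" "xs ! k \<le> t" using X(2) by auto
  qed
  have first: "xs ! 0 = 0"
  proof -
    obtain k where "k < n" "xs ! k = 0" using X(3) set_xs by (auto simp: in_set_conv_nth n_def)
    then have "xs ! 0 \<le> 0" using sorted_nth_mono[OF set_xs(2), of 0 k] by (simp add: n_def)
    then show ?thesis using xs_bounds(1)[of 0] n by simp
  qed
  have last: "xs ! (n - 1) = t"
  proof -
    obtain k where "k < n" "xs ! k = t" using X(4) set_xs by (auto simp: in_set_conv_nth n_def)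
    then have "t \<le> xs ! (n - 1)" using sorted_nth_mono[OF set_xs(2), of k "n - 1"] by (auto simp: n_def)
    then show ?thesis using xs_bounds(2)[of "n - 1"] n by simp
  qed
  have p0: "0 \<le> p k" for k using xs_bounds t by (simp add: p_def)
  have "mono_on {..n} p"
  proof (rule mono_onI)
    fix r s assume rs: "r \<in> {..n}" "s \<in> {..n}" "r \<le> s"
    then show "p r \<le> p s"
      using sorted_nth_mono[OF set_xs(2), of r s] xs_bounds(2)[of r] t by (auto simp: p_def n_def)
  qed
  then have ind: "indep_vars (\<lambda>_. borel) inc {..<n}"
    using bm p0 unfolding standard_brownian_motion_def inc_def by blast
  \<comment> \<open>\<open>True\<close> collects the increments up to t, \<open>False\<close> the
    single one from t to u.\<close>
  define K where "K b = (if b then {..<n - 1} else {n - 1})" for b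
  have iv: "indep_vars (\<lambda>b. PiM (K b) (\<lambda>_. borel)) (\<lambda>b \<omega>. \<lambda>k\<in>K b. inc k \<omega>) (UNIV :: bool set)"
    by (rule indep_vars_restrict[OF ind]) (use n in \<open>auto simp: K_def disjoint_family_on_def split: if_splits\<close>)
  define A where "A b = (if b then {q \<in> space (PiM (K b) (\<lambda>_. borel)). \<forall>m<n. xs ! m \<in> F \<longrightarrow> (\<Sum>k<m. q k) \<in> S (xs ! m)}
     else {q \<in> space (PiM (K b) (\<lambda>_. borel)). q (n - 1) \<in> D})" for b
  have KT: "k \<in> K True" if "k < m" "m < n" for k m using that by (auto simp: K_def)
  have A: "A b \<in> sets (PiM (K b) (\<lambda>_. borel :: real measure))" for b
  proof (cases b)
    case True
    have [measurable]: "(\<lambda>q. \<Sum>k<m. q k) \<in> borel_measurable (PiM (K True) (\<lambda>_. borel :: real measure))" if "m < n" for m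
      using that KT by (intro borel_measurable_sum measurable_component_singleton) auto
    have [measurable]: "S s \<in> sets borel" for s by (rule S)
    show ?thesis unfolding A_def using True by simp measurable
  next
    case False
    have c: "(\<lambda>q. q (n - 1)) \<in> borel_measurable (PiM (K False) (\<lambda>_. borel :: real measure))"
      by (intro measurable_component_singleton) (simp add: K_def)
    show ?thesis unfolding A_def using False Collect_mem_sets[OF c D] by simp
  qed
  have tele: "(\<Sum>k<m. inc k \<omega>) = B (xs ! m) \<omega> - B 0 \<omega>" if "m < n" for m \<omega>
  proof -
    have "(\<Sum>k<m. inc k \<omega>) = B (p m) \<omega> - B (p 0) \<omega>"
      unfolding inc_def by (rule sum_lessThan_telescope)
    then show ?thesis using that n first by (simp add: p_def)
  qed
  define E1 where "E1 = {\<omega>\<in>space M. \<forall>s\<in>F. B s \<omega> \<in> S s}"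
  \<comment> \<open>The process vanishes at 0 only almost surely, so the event in terms of
    increments equals \<open>E1\<close> up to a null set.\<close>
  define E1' where "E1' = {\<omega>\<in>space M. \<forall>m<n. xs ! m \<in> F \<longrightarrow> B (xs ! m) \<omega> - B 0 \<omega> \<in> S (xs ! m)}"
  define E2 where "E2 = {\<omega>\<in>space M. B u \<omega> - B t \<omega> \<in> D}"
  have pre1: "(\<lambda>\<omega>. \<lambda>k\<in>K True. inc k \<omega>) -` A True \<inter> space M = E1'"
  proof -
    have "(\<Sum>k<m. (\<lambda>k\<in>K True. inc k \<omega>) k) = B (xs ! m) \<omega> - B 0 \<omega>" if "m < n" for m \<omega>
      unfolding tele[OF that, symmetric] using KT[OF _ that] by (intro sum.cong) auto
    then show ?thesis by (auto simp: A_def E1'_def space_PiM)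
  qed
  have pre2: "(\<lambda>\<omega>. \<lambda>k\<in>K False. inc k \<omega>) -` A False \<inter> space M = E2"
    using n last by (auto simp: A_def E2_def K_def space_PiM inc_def p_def)
  define P where "P b = (\<lambda>\<omega>. \<lambda>k\<in>K b. inc k \<omega>) -` A b \<inter> space M" for b
  have "prob (\<Inter>b\<in>UNIV. P b) = (\<Prod>b\<in>UNIV. prob (P b))"
    unfolding P_def by (rule indep_varsD_finite[OF iv]) (use A in auto)
  then have "prob (P True \<inter> P False) = prob (P True) * prob (P False)"
    by (simp add: UNIV_bool Int_commute mult.commute)
  then have prod: "prob (E1' \<inter> E2) = prob E1' * prob E2"
    by (simp only: P_def pre1 pre2)
  have m0: "B 0 \<in> borel_measurable M" by simp
  have [measurable]: "S s \<in> sets borel" for s by (rule S)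
  have E1: "E1 \<in> events" unfolding E1_def using F
    by (intro sets.sets_Collect_finite_All Collect_mem_sets[OF meas S]) auto
  have E1': "E1' \<in> events"
  proof -
    have "{\<omega>\<in>space M. xs ! m \<in> F \<longrightarrow> B (xs ! m) \<omega> - B 0 \<omega> \<in> S (xs ! m)} \<in> events" if "m < n" for m
    proof (cases "xs ! m \<in> F")
      case True
      then show ?thesis using xs_bounds[OF that] m0 by (auto intro!: Collect_mem_sets[OF _ S])
    qed auto
    note st = this
    have "{\<omega>\<in>space M. \<forall>m\<in>{..<n}. xs ! m \<in> F \<longrightarrow> B (xs ! m) \<omega> - B 0 \<omega> \<in> S (xs ! m)} \<in> events"
    proof (rule sets.sets_Collect_finite_All)
      fix m assume "m \<in> {..<n}"
      then have "m < n" by simp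
      then show "{\<omega>\<in>space M. xs ! m \<in> F \<longrightarrow> B (xs ! m) \<omega> - B 0 \<omega> \<in> S (xs ! m)} \<in> events" by (rule st)
    qed simp
    then show ?thesis by (simp only: E1'_def Ball_def lessThan_iff)
  qed
  have E2: "E2 \<in> events"
    unfolding E2_def using t by (intro Collect_mem_sets[OF _ D] borel_measurable_diff meas) auto
  have AE0: "AE \<omega> in M. B 0 \<omega> = 0" using bm by (simp add: standard_brownian_motion_def)
  have iff: "\<omega> \<in> E1 \<longleftrightarrow> \<omega> \<in> E1'" if "\<omega> \<in> space M" "B 0 \<omega> = 0" for \<omega>
  proof -
    have "F \<subseteq> set xs" using set_xs by (auto simp: X_def)
    then have "(\<forall>s\<in>F. B s \<omega> \<in> S s) \<longleftrightarrow> (\<forall>s\<in>set xs. s \<in> F \<longrightarrow> B s \<omega> \<in> S s)" by blast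
    then show ?thesis using that by (simp add: E1_def E1'_def all_set_conv_all_nth n_def)
  qed
  have "prob E1 = prob E1'" using AE0 iff by (intro measure_eq_AE E1 E1') auto
  moreover have "prob (E1 \<inter> E2) = prob (E1' \<inter> E2)" using AE0 iff by (intro measure_eq_AE sets.Int E1 E1' E2) auto
  ultimately show ?thesis using prod by (simp add: E1_def E2_def)
qed

lemma sets_natural_filtration:
  "sets (natural_filtration M W t) =
     sigma_sets (space M) {W j s -` S \<inter> space M | j s S. 0 \<le> s \<and> s \<le> t \<and> S \<in> sets borel}"
  unfolding natural_filtration_def by (rule sets_measure_of) auto

lemma space_natural_filtration [simp]: "space (natural_filtration M W t) = space M"
  unfolding natural_filtration_def by (rule space_measure_of) auto

lemma measurable_natural_filtration:
  assumes "0 \<le> s" "s \<le> t"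
  shows "W j s \<in> borel_measurable (natural_filtration M W t)"
proof (rule measurableI)
  fix S :: "real set" assume "S \<in> sets borel"
  then show "W j s -` S \<inter> space (natural_filtration M W t) \<in> sets (natural_filtration M W t)"
    unfolding sets_natural_filtration using assms by (auto intro!: sigma_sets.Basic)
qed auto

lemma natural_filtration_mono:
  assumes "s \<le> t" "X \<in> borel_measurable (natural_filtration M W s)"
  shows "X \<in> borel_measurable (natural_filtration M W t)"
proof -
  have "sets (natural_filtration M W s) \<subseteq> sets (natural_filtration M W t)"
    unfolding sets_natural_filtration using assms(1) by (intro sigma_sets_mono') fastforce
  then show ?thesis using assms(2) by (auto simp: measurable_def)
qed

locale brownian_family =
  fixes M :: "'a measure" and W :: "'d::finite \<Rightarrow> real \<Rightarrow> 'a \<Rightarrow> real"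
  assumes ibm: "independent_brownian_motions M W"
begin

lemma bm: "standard_brownian_motion M (W j)"
  using ibm by (simp add: independent_brownian_motions_def)

interpretation prob_space M
  using bm by (simp add: standard_brownian_motion_def)

lemma W_measurable: "0 \<le> t \<Longrightarrow> W j t \<in> borel_measurable M"
  using bm by (simp add: standard_brownian_motion_def)

lemma filtration_events: "sets (natural_filtration M W t) \<subseteq> events"
  unfolding sets_natural_filtration by (rule sets.sigma_sets_subset) (auto intro: measurable_sets[OF W_measurable])

lemma filtration_measurable: "X \<in> borel_measurable (natural_filtration M W t) \<Longrightarrow> X \<in> borel_measurable M"
  using filtration_events by (auto simp: measurable_def)

text \<open>A pi-system that generates the filtration: finitely many times for each
  component.\<close>

definition cylinders :: "real \<Rightarrow> 'a set set" where
  "cylinders t = {{\<omega>\<in>space M. \<forall>i. \<forall>s\<in>F i. W i s \<omega> \<in> S i s} | F S.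
      (\<forall>i. finite (F i) \<and> F i \<subseteq> {0..t}) \<and> (\<forall>i s. S i s \<in> sets borel)}"

lemma cylinders_Int_stable: "Int_stable (cylinders t)"
proof (rule Int_stableI)
  fix X Y assume "X \<in> cylinders t" "Y \<in> cylinders t"
  then obtain F S F' S' where
    X: "X = {\<omega>\<in>space M. \<forall>i. \<forall>s\<in>F i. W i s \<omega> \<in> S i s}" "\<forall>i. finite (F i) \<and> F i \<subseteq> {0..t}" "\<forall>i s. S i s \<in> sets borel" and
    Y: "Y = {\<omega>\<in>space M. \<forall>i. \<forall>s\<in>F' i. W i s \<omega> \<in> S' i s}" "\<forall>i. finite (F' i) \<and> F' i \<subseteq> {0..t}" "\<forall>i s. S' i s \<in> sets borel"
    unfolding cylinders_def by blast
  \<comment> \<open>A time that occurs in only one of the two cylinders is unconstrained in the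
    other.\<close>
  define T where "T i s = (if s \<in> F i then S i s else UNIV) \<inter> (if s \<in> F' i then S' i s else UNIV)" for i s
  have "X \<inter> Y = {\<omega>\<in>space M. \<forall>i. \<forall>s\<in>F i \<union> F' i. W i s \<omega> \<in> T i s}"
    unfolding X(1) Y(1) T_def by (auto split: if_splits)
  moreover have "\<forall>i. finite (F i \<union> F' i) \<and> F i \<union> F' i \<subseteq> {0..t}" using X Y by auto
  moreover have "\<forall>i s. T i s \<in> sets borel" using X Y by (auto simp: T_def)
  ultimately show "X \<inter> Y \<in> cylinders t"
    unfolding cylinders_def mem_Collect_eq by (intro exI[of _ "\<lambda>i. F i \<union> F' i"] exI[of _ T]) blast
qed

lemma filtration_le_cylinders: "sets (natural_filtration M W t) \<subseteq> sigma_sets (space M) (cylinders t)"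
  unfolding sets_natural_filtration
proof (intro sigma_sets_mono subsetI)
  fix X assume "X \<in> {W j s -` S \<inter> space M | j s S. 0 \<le> s \<and> s \<le> t \<and> S \<in> sets borel}"
  then obtain j s S where X: "X = W j s -` S \<inter> space M" "0 \<le> s" "s \<le> t" "S \<in> sets borel" by blast
  have "X = {\<omega>\<in>space M. \<forall>i. \<forall>r\<in>(if i = j then {s} else {}). W i r \<omega> \<in> S}"
    using X(1) by auto
  moreover have "\<forall>i. finite (if i = j then {s} else {}) \<and> (if i = j then {s} else {}) \<subseteq> {0..t}"
    using X by auto
  ultimately have "X \<in> cylinders t"
    unfolding cylinders_def mem_Collect_eq using X(4)
    by (intro exI[of _ "\<lambda>i. if i = j then {s} else {}"] exI[of _ "\<lambda>_ _. S"]) blast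
  then show "X \<in> sigma_sets (space M) (cylinders t)" by (rule sigma_sets.Basic)
qed

text \<open>Independence of the components factorises the probability with and without the increment
  event. The two products differ only in the factor of component j, where independence in time
  applies.\<close>

lemma cylinder_increment_indep:
  assumes t: "0 \<le> t" "t < u" and D: "D \<in> sets borel" and X: "X \<in> cylinders t"
  shows "prob (X \<inter> {\<omega>\<in>space M. W j u \<omega> - W j t \<omega> \<in> D}) = prob X * prob {\<omega>\<in>space M. W j u \<omega> - W j t \<omega> \<in> D}"
proof -
  obtain F S where X: "X = {\<omega>\<in>space M. \<forall>i. \<forall>s\<in>F i. W i s \<omega> \<in> S i s}"
    and F: "\<And>i. finite (F i)" "\<And>i. F i \<subseteq> {0..t}" and S: "\<And>i s. S i s \<in> sets borel"
    using X unfolding cylinders_def by blast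
  let ?P = "PiM {0..} (\<lambda>_. borel) :: (real \<Rightarrow> real) measure"
  let ?Z = "\<lambda>i \<omega>. \<lambda>t\<in>{0..}. W i t \<omega>"
  have iv: "indep_vars (\<lambda>_. ?P) ?Z UNIV"
    using ibm by (simp add: independent_brownian_motions_def)
  define A where "A i = {q \<in> space ?P. \<forall>s\<in>F i. q s \<in> S i s}" for i
  define A' where "A' i = (if i = j then A j \<inter> {q \<in> space ?P. q u - q t \<in> D} else A i)" for i
  have c[measurable]: "(\<lambda>q. q s) \<in> borel_measurable ?P" if "0 \<le> s" for s
    using that by (intro measurable_component_singleton) auto
  have A: "A i \<in> sets ?P" for i
  proof -
    have "{q \<in> space ?P. q s \<in> S i s} \<in> sets ?P" if "s \<in> F i" for s
      using F(2)[of i] that by (intro Collect_mem_sets[OF c S]) auto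
    then show ?thesis unfolding A_def by (rule sets.sets_Collect_finite_All) (simp_all add: F)
  qed
  have "(\<lambda>q. q u - q t) \<in> borel_measurable ?P" using t by (intro borel_measurable_diff c) auto
  then have A': "A' i \<in> sets ?P" for i
    unfolding A'_def using A D by (auto intro!: sets.Int Collect_mem_sets[of _ _ borel])
  define E where "E i = {\<omega>\<in>space M. \<forall>s\<in>F i. W i s \<omega> \<in> S i s}" for i
  define G where "G = {\<omega>\<in>space M. W j u \<omega> - W j t \<omega> \<in> D}"
  have F0: "s \<in> F i \<Longrightarrow> 0 \<le> s" for i s using F(2)[of i] by auto
  have pre: "?Z i -` A i \<inter> space M = E i" for i
    using F0[of _ i] by (auto simp: A_def E_def space_PiM)
  have pre': "?Z i -` A' i \<inter> space M = (if i = j then E j \<inter> G else E i)" for i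
    using F0[of _ i] t by (auto simp: A'_def A_def E_def G_def space_PiM)
  have "prob (\<Inter>i\<in>UNIV. ?Z i -` A i \<inter> space M) = (\<Prod>i\<in>UNIV. prob (?Z i -` A i \<inter> space M))"
    by (rule indep_varsD_finite[OF iv]) (use A in auto)
  then have 1: "prob (\<Inter>i\<in>UNIV. E i) = (\<Prod>i\<in>UNIV. prob (E i))" by (simp only: pre)
  have "prob (\<Inter>i\<in>UNIV. ?Z i -` A' i \<inter> space M) = (\<Prod>i\<in>UNIV. prob (?Z i -` A' i \<inter> space M))"
    by (rule indep_varsD_finite[OF iv]) (use A' in auto)
  then have 2: "prob (\<Inter>i\<in>UNIV. (if i = j then E j \<inter> G else E i)) = (\<Prod>i\<in>UNIV. prob (if i = j then E j \<inter> G else E i))"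
    by (simp only: pre')
  have "(\<Inter>i\<in>UNIV. (if i = j then E j \<inter> G else E i)) = (\<Inter>i\<in>UNIV. E i) \<inter> G" by (auto split: if_splits)
  moreover have "(\<Prod>i\<in>UNIV. prob (if i = j then E j \<inter> G else E i)) = prob (E j \<inter> G) * (\<Prod>i\<in>UNIV - {j}. prob (E i))"
    by (subst prod.remove[of _ j]) (auto intro!: prod.cong)
  moreover have "(\<Prod>i\<in>UNIV. prob (E i)) = prob (E j) * (\<Prod>i\<in>UNIV - {j}. prob (E i))"
    by (subst prod.remove[of _ j]) auto
  moreover have "prob (E j \<inter> G) = prob (E j) * prob G"
    unfolding E_def G_def by (rule brownian_increment_indep_past[OF bm F t S D])
  moreover have "(\<Inter>i\<in>UNIV. E i) = X" by (auto simp: X E_def)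
  ultimately show ?thesis using 1 2 by (simp add: G_def)
qed

text \<open>Independence passes from the two intersection-stable generators to the
  sigma-algebras.\<close>

lemma increment_indep_filtration:
  assumes t: "0 \<le> t" "t < u" and X: "X \<in> borel_measurable (natural_filtration M W t)"
  shows "indep_var borel X borel (\<lambda>\<omega>. W j u \<omega> - W j t \<omega>)"
  unfolding indep_var_eq
proof (intro conjI)
  let ?\<Delta> = "\<lambda>\<omega>. W j u \<omega> - W j t \<omega>"
  show "random_variable borel X" by (rule filtration_measurable[OF X])
  have \<Delta>: "random_variable borel ?\<Delta>" using t W_measurable by (intro borel_measurable_diff) auto
  then show "random_variable borel ?\<Delta>" .
  let ?G = "{?\<Delta> -` A \<inter> space M |A. A \<in> sets borel}"
  have c: "cylinders t \<subseteq> events"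
  proof
    fix Y assume "Y \<in> cylinders t"
    then obtain F S where Y: "Y = {\<omega>\<in>space M. \<forall>i. \<forall>s\<in>F i. W i s \<omega> \<in> S i s}"
      and F: "\<And>i. finite (F i)" "\<And>i. F i \<subseteq> {0..t}" and S: "\<And>i s. S i s \<in> sets borel"
      unfolding cylinders_def by blast
    have "{\<omega>\<in>space M. W i s \<omega> \<in> S i s} \<in> events" if "s \<in> F i" for i s
      using F(2)[of i] that by (intro Collect_mem_sets[OF W_measurable S]) auto
    then have "{\<omega>\<in>space M. \<forall>s\<in>F i. W i s \<omega> \<in> S i s} \<in> events" for i
      by (rule sets.sets_Collect_finite_All) (simp_all add: F)
    then have "{\<omega>\<in>space M. \<forall>i\<in>UNIV. \<forall>s\<in>F i. W i s \<omega> \<in> S i s} \<in> events"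
      by (rule sets.sets_Collect_finite_All) simp
    then show "Y \<in> events" by (simp add: Y)
  qed
  have "indep_set (cylinders t) ?G"
  proof (rule indep_setI[OF c])
    show "?G \<subseteq> events" using measurable_sets[OF \<Delta>] by auto
    fix a b assume a: "a \<in> cylinders t" and "b \<in> ?G"
    then obtain D where D: "D \<in> sets borel" "b = {\<omega>\<in>space M. ?\<Delta> \<omega> \<in> D}" by auto
    show "prob (a \<inter> b) = prob a * prob b"
      unfolding D(2) by (rule cylinder_increment_indep[OF t D(1) a])
  qed
  moreover have "Int_stable ?G"
  proof (rule Int_stableI)
    fix a b assume "a \<in> ?G" "b \<in> ?G"
    then obtain A B where "A \<in> sets borel" "B \<in> sets borel" "a = ?\<Delta> -` A \<inter> space M" "b = ?\<Delta> -` B \<inter> space M" by auto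
    then have "a \<inter> b = ?\<Delta> -` (A \<inter> B) \<inter> space M" "A \<inter> B \<in> sets borel" by auto
    then show "a \<inter> b \<in> ?G" by blast
  qed
  ultimately have "indep_set (sigma_sets (space M) (cylinders t)) (sigma_sets (space M) ?G)"
    by (intro indep_set_sigma_sets cylinders_Int_stable)
  moreover have "sigma_sets (space M) {X -` A \<inter> space M |A. A \<in> sets borel} \<subseteq> sigma_sets (space M) (cylinders t)"
    using measurable_sets[OF X] filtration_le_cylinders[of t] by (intro sigma_sets_mono) auto
  ultimately show "indep_set (sigma_sets (space M) {X -` A \<inter> space M |A. A \<in> sets borel}) (sigma_sets (space M) ?G)"
    unfolding indep_sets2_eq by blast
qed

section \<open>Moments of Brownian increments\<close>

lemma increment_distributed:
  "0 \<le> t \<Longrightarrow> t < u \<Longrightarrow> distributed M lborel (\<lambda>\<omega>. W j u \<omega> - W j t \<omega>) (normal_density 0 (sqrt (u - t)))"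
  using bm unfolding standard_brownian_motion_def by blast

lemma increment_even_moment:
  assumes "0 \<le> t" "t < u"
  shows "integrable M (\<lambda>\<omega>. (W j u \<omega> - W j t \<omega>) ^ (2 * k))"
    "expectation (\<lambda>\<omega>. (W j u \<omega> - W j t \<omega>) ^ (2 * k)) = fact (2 * k) / ((2 / (u - t)) ^ k * fact k)"
proof -
  have d: "distributed M lborel (\<lambda>\<omega>. W j u \<omega> - W j t \<omega>) (normal_density 0 (sqrt (u - t)))"
    by (rule increment_distributed[OF assms])
  have m: "has_bochner_integral lborel (\<lambda>x. normal_density 0 (sqrt (u - t)) x * x ^ (2 * k)) (fact (2 * k) / ((2 / (u - t)) ^ k * fact k))"
    using normal_moment_even[of "sqrt (u - t)" 0 k] assms by simp
  show "integrable M (\<lambda>\<omega>. (W j u \<omega> - W j t \<omega>) ^ (2 * k))"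
    using distributed_integrable[OF d, of "\<lambda>x. x ^ (2 * k)"] has_bochner_integral_iff[THEN iffD1, OF m] by simp
  show "expectation (\<lambda>\<omega>. (W j u \<omega> - W j t \<omega>) ^ (2 * k)) = fact (2 * k) / ((2 / (u - t)) ^ k * fact k)"
    using distributed_integral[OF d, of "\<lambda>x. x ^ (2 * k)"] has_bochner_integral_iff[THEN iffD1, OF m] by simp
qed

lemma increment_mean:
  assumes "0 \<le> t" "t < u"
  shows "integrable M (\<lambda>\<omega>. W j u \<omega> - W j t \<omega>)" "expectation (\<lambda>\<omega>. W j u \<omega> - W j t \<omega>) = 0"
proof -
  have d: "distributed M lborel (\<lambda>\<omega>. W j u \<omega> - W j t \<omega>) (normal_density 0 (sqrt (u - t)))"
    by (rule increment_distributed[OF assms])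
  have m: "has_bochner_integral lborel (\<lambda>x. normal_density 0 (sqrt (u - t)) x * x) 0"
    using normal_moment_odd[of "sqrt (u - t)" 0 0] assms by simp
  show "integrable M (\<lambda>\<omega>. W j u \<omega> - W j t \<omega>)"
    using distributed_integrable[OF d, of "\<lambda>x. x"] has_bochner_integral_iff[THEN iffD1, OF m] by simp
  show "expectation (\<lambda>\<omega>. W j u \<omega> - W j t \<omega>) = 0"
    using distributed_integral[OF d, of "\<lambda>x. x"] has_bochner_integral_iff[THEN iffD1, OF m] by simp
qed

lemma increment_fourth_moment:
  assumes "0 \<le> t" "t \<le> u"
  shows "integrable M (\<lambda>\<omega>. (W j u \<omega> - W j t \<omega>) ^ 4)"
    "expectation (\<lambda>\<omega>. (W j u \<omega> - W j t \<omega>) ^ 4) = 3 * (u - t)\<^sup>2"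
  using increment_even_moment[of t u j 2] assms
  by (cases "t = u"; simp add: fact_numeral power2_eq_square field_simps)+

lemma increment_second_moment:
  assumes "0 \<le> t" "t \<le> u"
  shows "integrable M (\<lambda>\<omega>. (W j u \<omega> - W j t \<omega>)\<^sup>2)"
    "expectation (\<lambda>\<omega>. (W j u \<omega> - W j t \<omega>)\<^sup>2) = u - t"
  using increment_even_moment[of t u j 1] assms
  by (cases "t = u"; simp)+

lemma increment_times_past:
  assumes t: "0 \<le> t" "t \<le> u" and X: "X \<in> borel_measurable (natural_filtration M W t)" "integrable M X"
  shows "integrable M (\<lambda>\<omega>. X \<omega> * (W j u \<omega> - W j t \<omega>))"
    "expectation (\<lambda>\<omega>. X \<omega> * (W j u \<omega> - W j t \<omega>)) = 0"
proof -
  have "integrable M (\<lambda>\<omega>. X \<omega> * (W j u \<omega> - W j t \<omega>)) \<and> expectation (\<lambda>\<omega>. X \<omega> * (W j u \<omega> - W j t \<omega>)) = 0"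
  \<comment> \<open>The normal law of an increment is given for t < u; for t = u the increment is
    0.\<close>
  proof (cases "t = u")
    case False
    then have tu: "t < u" using t by simp
    note iv = increment_indep_filtration[OF t(1) tu X(1), of j]
    show ?thesis
      using indep_var_integrable[OF iv X(2) increment_mean(1)[OF t(1) tu]]
        indep_var_lebesgue_integral[OF iv X(2) increment_mean(1)[OF t(1) tu]] increment_mean(2)[OF t(1) tu] by simp
  qed simp
  then show "integrable M (\<lambda>\<omega>. X \<omega> * (W j u \<omega> - W j t \<omega>))"
    "expectation (\<lambda>\<omega>. X \<omega> * (W j u \<omega> - W j t \<omega>)) = 0" by auto
qed

lemma increment_times_past_square:
  assumes t: "0 \<le> t" "t \<le> u" and X: "X \<in> borel_measurable (natural_filtration M W t)" "integrable M (\<lambda>\<omega>. (X \<omega>)\<^sup>2)"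
  shows "integrable M (\<lambda>\<omega>. (X \<omega> * (W j u \<omega> - W j t \<omega>))\<^sup>2)"
    "expectation (\<lambda>\<omega>. (X \<omega> * (W j u \<omega> - W j t \<omega>))\<^sup>2) = expectation (\<lambda>\<omega>. (X \<omega>)\<^sup>2) * (u - t)"
proof -
  have "integrable M (\<lambda>\<omega>. (X \<omega> * (W j u \<omega> - W j t \<omega>))\<^sup>2) \<and>
    expectation (\<lambda>\<omega>. (X \<omega> * (W j u \<omega> - W j t \<omega>))\<^sup>2) = expectation (\<lambda>\<omega>. (X \<omega>)\<^sup>2) * (u - t)"
  proof (cases "t = u")
    case False
    then have tu: "t < u" using t by simp
    have "indep_var borel ((\<lambda>x. x\<^sup>2) \<circ> X) borel ((\<lambda>x. x\<^sup>2) \<circ> (\<lambda>\<omega>. W j u \<omega> - W j t \<omega>))"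
      by (rule indep_var_compose[OF increment_indep_filtration[OF t(1) tu X(1)]]) auto
    then have iv: "indep_var borel (\<lambda>\<omega>. (X \<omega>)\<^sup>2) borel (\<lambda>\<omega>. (W j u \<omega> - W j t \<omega>)\<^sup>2)" by (simp add: comp_def)
    show ?thesis
      unfolding power_mult_distrib
      using indep_var_integrable[OF iv X(2) increment_second_moment(1)[OF t]]
        indep_var_lebesgue_integral[OF iv X(2) increment_second_moment(1)[OF t]] increment_second_moment(2)[OF t] by simp
  qed simp
  then show "integrable M (\<lambda>\<omega>. (X \<omega> * (W j u \<omega> - W j t \<omega>))\<^sup>2)"
    "expectation (\<lambda>\<omega>. (X \<omega> * (W j u \<omega> - W j t \<omega>))\<^sup>2) = expectation (\<lambda>\<omega>. (X \<omega>)\<^sup>2) * (u - t)" by auto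
qed

section \<open>The Ito isometry for simple integrands\<close>

lemma integrable_mult_of_squares:
  fixes X Y :: "'a \<Rightarrow> real"
  assumes "X \<in> borel_measurable M" "Y \<in> borel_measurable M" "integrable M (\<lambda>\<omega>. (X \<omega>)\<^sup>2)" "integrable M (\<lambda>\<omega>. (Y \<omega>)\<^sup>2)"
  shows "integrable M (\<lambda>\<omega>. X \<omega> * Y \<omega>)"
proof (rule Bochner_Integration.integrable_bound)
  show "integrable M (\<lambda>\<omega>. (X \<omega>)\<^sup>2 + (Y \<omega>)\<^sup>2)" using assms by simp
  show "AE \<omega> in M. norm (X \<omega> * Y \<omega>) \<le> norm ((X \<omega>)\<^sup>2 + (Y \<omega>)\<^sup>2)"
  proof (intro AE_I2)
    fix \<omega>
    have "2 * \<bar>X \<omega> * Y \<omega>\<bar> \<le> (X \<omega>)\<^sup>2 + (Y \<omega>)\<^sup>2"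
      using sum_squares_bound[of "\<bar>X \<omega>\<bar>" "\<bar>Y \<omega>\<bar>"] by (simp add: abs_mult)
    then show "norm (X \<omega> * Y \<omega>) \<le> norm ((X \<omega>)\<^sup>2 + (Y \<omega>)\<^sup>2)" by simp
  qed
qed (use assms in measurable)

text \<open>In the square of the sum the mixed term is a variable known at time p n times a centred
  increment independent of it, so its mean is 0. Measurability at p n is part of the induction
  because the next step needs it.\<close>

lemma simple_integral_isometry:
  assumes p: "0 \<le> p 0" "mono_on {..N} p"
    and e: "\<And>k. k < N \<Longrightarrow> e k \<in> borel_measurable (natural_filtration M W (p k))"
      "\<And>k. k < N \<Longrightarrow> integrable M (\<lambda>\<omega>. (e k \<omega>)\<^sup>2)"
  shows "n \<le> N \<Longrightarrow> simple_integral n p e (W j) \<in> borel_measurable (natural_filtration M W (p n)) \<and>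
     integrable M (\<lambda>\<omega>. (simple_integral n p e (W j) \<omega>)\<^sup>2) \<and>
     expectation (\<lambda>\<omega>. (simple_integral n p e (W j) \<omega>)\<^sup>2) = (\<Sum>k<n. expectation (\<lambda>\<omega>. (e k \<omega>)\<^sup>2) * (p (Suc k) - p k))"
proof (induction n)
  case 0
  show ?case by (simp add: simple_integral_def)
next
  case (Suc n)
  let ?S = "simple_integral n p e (W j)"
  let ?d = "\<lambda>\<omega>. W j (p (Suc n)) \<omega> - W j (p n) \<omega>"
  have n: "n < N" using Suc.prems by simp
  have pn: "0 \<le> p n" "p n \<le> p (Suc n)"
    using mono_onD[OF p(2), of 0 n] mono_onD[OF p(2), of n "Suc n"] p(1) n by auto
  have S: "?S \<in> borel_measurable (natural_filtration M W (p n))" "integrable M (\<lambda>\<omega>. (?S \<omega>)\<^sup>2)"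
    "expectation (\<lambda>\<omega>. (?S \<omega>)\<^sup>2) = (\<Sum>k<n. expectation (\<lambda>\<omega>. (e k \<omega>)\<^sup>2) * (p (Suc k) - p k))"
    using Suc.IH n by auto
  note en = e(1)[OF n] e(2)[OF n]
  have eq: "simple_integral (Suc n) p e (W j) = (\<lambda>\<omega>. ?S \<omega> + e n \<omega> * ?d \<omega>)"
    by (simp add: simple_integral_def fun_eq_iff)
  have d: "?d \<in> borel_measurable (natural_filtration M W (p (Suc n)))"
    using pn by (intro borel_measurable_diff measurable_natural_filtration) auto
  have 1: "simple_integral (Suc n) p e (W j) \<in> borel_measurable (natural_filtration M W (p (Suc n)))"
    unfolding eq by (intro borel_measurable_add borel_measurable_times d
        natural_filtration_mono[OF pn(2) S(1)] natural_filtration_mono[OF pn(2) en(1)])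
  have cross: "integrable M (\<lambda>\<omega>. ?S \<omega> * e n \<omega>)"
    by (intro integrable_mult_of_squares filtration_measurable[OF S(1)] filtration_measurable[OF en(1)] S en)
  note c = increment_times_past[OF pn borel_measurable_times[OF S(1) en(1)] cross, of j]
  note q = increment_times_past_square[OF pn en, of j]
  have sq: "(\<lambda>\<omega>. (simple_integral (Suc n) p e (W j) \<omega>)\<^sup>2)
     = (\<lambda>\<omega>. (?S \<omega>)\<^sup>2 + 2 * (?S \<omega> * e n \<omega> * ?d \<omega>) + (e n \<omega> * ?d \<omega>)\<^sup>2)"
    by (simp add: eq fun_eq_iff power2_eq_square algebra_simps)
  have "integrable M (\<lambda>\<omega>. (simple_integral (Suc n) p e (W j) \<omega>)\<^sup>2)"
    unfolding sq using S(2) c(1) q(1) by simp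
  moreover have "expectation (\<lambda>\<omega>. (simple_integral (Suc n) p e (W j) \<omega>)\<^sup>2)
     = (\<Sum>k<Suc n. expectation (\<lambda>\<omega>. (e k \<omega>)\<^sup>2) * (p (Suc k) - p k))"
    unfolding sq using S(2,3) c q by simp
  ultimately show ?case using 1 by blast
qed

lemma simple_process_at:
  assumes p: "mono_on {..N} p" and k: "k < N" "p k \<le> u" "u < p (Suc k)"
  shows "simple_process N p e u \<omega> = e k \<omega>"
proof -
  have "e i \<omega> * indicator {p i..<p (Suc i)} u = (if i = k then e k \<omega> else 0)" if "i < N" for i
  proof (cases i k rule: linorder_cases)
    case less
    then have "p (Suc i) \<le> p k" using p k by (auto intro: mono_onD)
    then show ?thesis using less k by (simp add: indicator_def)
  next
    case greater
    then have "p (Suc k) \<le> p i" using p that by (auto intro: mono_onD)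
    then show ?thesis using greater k by (simp add: indicator_def)
  qed (use k in \<open>simp add: indicator_def\<close>)
  then show ?thesis using k by (simp add: simple_process_def sum.delta)
qed

lemma square_split: "(x :: real)\<^sup>2 \<le> 2 * (x - y)\<^sup>2 + 2 * y\<^sup>2"
  using zero_le_power2[of "x - 2 * y"] by (simp add: power2_eq_square algebra_simps)

lemma nn_integral_square_split:
  fixes X Y :: "'a \<Rightarrow> real"
  assumes "X \<in> borel_measurable M" "Y \<in> borel_measurable M"
  shows "(\<integral>\<^sup>+\<omega>. ennreal ((X \<omega>)\<^sup>2) \<partial>M) \<le> 2 * (\<integral>\<^sup>+\<omega>. ennreal ((X \<omega> - Y \<omega>)\<^sup>2) \<partial>M) + 2 * (\<integral>\<^sup>+\<omega>. ennreal ((Y \<omega>)\<^sup>2) \<partial>M)"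
proof -
  have "ennreal ((X \<omega>)\<^sup>2) \<le> 2 * ennreal ((X \<omega> - Y \<omega>)\<^sup>2) + 2 * ennreal ((Y \<omega>)\<^sup>2)" for \<omega>
  proof -
    have "ennreal ((X \<omega>)\<^sup>2) \<le> ennreal (2 * (X \<omega> - Y \<omega>)\<^sup>2 + 2 * (Y \<omega>)\<^sup>2)" by (rule ennreal_leI[OF square_split])
    also have "\<dots> = 2 * ennreal ((X \<omega> - Y \<omega>)\<^sup>2) + 2 * ennreal ((Y \<omega>)\<^sup>2)"
      by (simp add: ennreal_plus ennreal_mult')
    finally show ?thesis .
  qed
  then have "(\<integral>\<^sup>+\<omega>. ennreal ((X \<omega>)\<^sup>2) \<partial>M) \<le> (\<integral>\<^sup>+\<omega>. 2 * ennreal ((X \<omega> - Y \<omega>)\<^sup>2) + 2 * ennreal ((Y \<omega>)\<^sup>2) \<partial>M)"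
    by (intro nn_integral_mono)
  also have "\<dots> = 2 * (\<integral>\<^sup>+\<omega>. ennreal ((X \<omega> - Y \<omega>)\<^sup>2) \<partial>M) + 2 * (\<integral>\<^sup>+\<omega>. ennreal ((Y \<omega>)\<^sup>2) \<partial>M)"
    using assms by (simp add: nn_integral_add nn_integral_cmult)
  finally show ?thesis .
qed

text \<open>The inner mean square gap is not known to be measurable in \<open>u\<close>, so additivity of its time integral
  is not available; only monotonicity is used, after moving the measurable part to the other side.\<close>

lemma simple_integral_second_moment:
  assumes st: "0 \<le> s" "s \<le> t"
    and simple: "simple_integrand M (natural_filtration M W) s t N p e"
    and X: "\<And>u. s \<le> u \<Longrightarrow> u \<le> t \<Longrightarrow> X u \<in> borel_measurable M"
      "\<And>u. s \<le> u \<Longrightarrow> u \<le> t \<Longrightarrow> (\<integral>\<^sup>+\<omega>. ennreal ((X u \<omega>)\<^sup>2) \<partial>M) \<le> ennreal (t - s)"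
  shows "(\<integral>\<^sup>+\<omega>. ennreal ((simple_integral N p e (W j) \<omega>)\<^sup>2) \<partial>M) \<le>
    2 * (\<integral>\<^sup>+u\<in>{s..t}. (\<integral>\<^sup>+\<omega>. ennreal ((simple_process N p e u \<omega> - X u \<omega>)\<^sup>2) \<partial>M) \<partial>lborel) + 2 * ennreal ((t - s)\<^sup>2)"
proof -
  have p: "p 0 = s" "p N = t" "mono_on {..N} p"
    and e: "\<And>k. k < N \<Longrightarrow> e k \<in> borel_measurable (natural_filtration M W (p k))"
      "\<And>k. k < N \<Longrightarrow> integrable M (\<lambda>\<omega>. (e k \<omega>)\<^sup>2)"
    using simple unfolding simple_integrand_def by auto
  define c where "c k = expectation (\<lambda>\<omega>. (e k \<omega>)\<^sup>2)" for k
  have c: "0 \<le> c k" for k by (simp add: c_def)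
  have pk: "p k \<le> p (Suc k)" "s \<le> p k" "p (Suc k) \<le> t" if "k < N" for k
    using mono_onD[OF p(3), of k "Suc k"] mono_onD[OF p(3), of 0 k] mono_onD[OF p(3), of "Suc k" N] p that by auto
  define F where "F u = (\<integral>\<^sup>+\<omega>. ennreal ((simple_process N p e u \<omega> - X u \<omega>)\<^sup>2) \<partial>M)" for u
  \<comment> \<open>The mean square of the simple process as a step function of time; by the
    isometry its integral is the second moment of the simple integral.\<close>
  define H where "H u = (\<Sum>k<N. ennreal (c k) * indicator {p k..<p (Suc k)} u)" for u :: real
  have [measurable]: "H \<in> borel_measurable lborel" unfolding H_def by measurable
  have HF: "H u \<le> 2 * F u + 2 * ennreal (t - s)" for u
  proof (cases "\<exists>k<N. p k \<le> u \<and> u < p (Suc k)")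
    case True
    then obtain k where k: "k < N" "p k \<le> u" "u < p (Suc k)" by blast
    then have u: "s \<le> u" "u \<le> t" using pk[OF k(1)] by auto
    have "H u = (\<Sum>i<N. if i = k then ennreal (c k) else 0)"
      unfolding H_def
    proof (intro sum.cong refl)
      fix i assume i: "i \<in> {..<N}"
      show "ennreal (c i) * indicator {p i..<p (Suc i)} u = (if i = k then ennreal (c k) else 0)"
      proof (cases i k rule: linorder_cases)
        case less
        then have "p (Suc i) \<le> p k" using p k by (auto intro: mono_onD)
        then show ?thesis using less k by (simp add: indicator_def)
      next
        case greater
        then have "p (Suc k) \<le> p i" using p i by (auto intro: mono_onD)
        then show ?thesis using greater k by (simp add: indicator_def)
      qed (use k in \<open>simp add: indicator_def\<close>)
    qed
    also have "\<dots> = ennreal (c k)" using k by simp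
    also have "\<dots> = (\<integral>\<^sup>+\<omega>. ennreal ((e k \<omega>)\<^sup>2) \<partial>M)"
      unfolding c_def by (rule nn_integral_eq_integral[OF e(2)[OF k(1)], symmetric]) simp
    also have "\<dots> \<le> 2 * (\<integral>\<^sup>+\<omega>. ennreal ((e k \<omega> - X u \<omega>)\<^sup>2) \<partial>M) + 2 * (\<integral>\<^sup>+\<omega>. ennreal ((X u \<omega>)\<^sup>2) \<partial>M)"
      by (intro nn_integral_square_split filtration_measurable[OF e(1)[OF k(1)]] X u)
    also have "\<dots> \<le> 2 * F u + 2 * ennreal (t - s)"
      unfolding F_def simple_process_at[OF p(3) k] using X(2)[OF u] by (intro add_mono mult_left_mono) auto
    finally show ?thesis .
  next
    case False
    then have "H u = 0" by (auto simp: H_def indicator_def)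
    then show ?thesis by simp
  qed
  have Hout: "H u = 0" if "u \<notin> {s..t}" for u
    unfolding H_def
  proof (intro sum.neutral ballI)
    fix k assume "k \<in> {..<N}"
    then have "u \<notin> {p k..<p (Suc k)}" using pk[of k] that by auto
    then show "ennreal (c k) * indicator {p k..<p (Suc k)} u = 0" by simp
  qed
  have "(\<integral>\<^sup>+\<omega>. ennreal ((simple_integral N p e (W j) \<omega>)\<^sup>2) \<partial>M) = ennreal (\<Sum>k<N. c k * (p (Suc k) - p k))"
    using simple_integral_isometry[of p N e N j] p e st
    by (subst nn_integral_eq_integral) (auto simp: c_def)
  also have "\<dots> = (\<Sum>k<N. ennreal (c k) * ennreal (p (Suc k) - p k))"
    using c pk by (subst sum_ennreal[symmetric]) (auto simp: ennreal_mult intro!: sum.cong mult_nonneg_nonneg)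
  also have "\<dots> = (\<integral>\<^sup>+u. H u \<partial>lborel)"
    unfolding H_def using pk by (subst nn_integral_sum) (auto simp: nn_integral_cmult_indicator intro!: sum.cong)
  \<comment> \<open>Subtraction in \<open>ennreal\<close> stops at 0. The truncated difference is
    measurable, and it lies below 2 F by \<open>HF\<close>.\<close>
  also have "\<dots> \<le> (\<integral>\<^sup>+u. (H u - 2 * ennreal (t - s)) + 2 * ennreal (t - s) * indicator {s..t} u \<partial>lborel)"
  proof (rule nn_integral_mono)
    fix u
    show "H u \<le> (H u - 2 * ennreal (t - s)) + 2 * ennreal (t - s) * indicator {s..t} u"
    proof (cases "u \<in> {s..t}")
      case True
      have "H u \<le> 2 * ennreal (t - s) + (H u - 2 * ennreal (t - s))"
        using ennreal_minus_le_iff[of "H u" "2 * ennreal (t - s)" "H u - 2 * ennreal (t - s)"] by blast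
      with True show ?thesis by (simp add: add.commute)
    qed (simp add: Hout)
  qed
  also have "\<dots> = (\<integral>\<^sup>+u. (H u - 2 * ennreal (t - s)) \<partial>lborel) + 2 * ennreal (t - s) * ennreal (t - s)"
    using st by (subst nn_integral_add) (auto simp: nn_integral_cmult_indicator)
  \<comment> \<open>The factor 2 is taken out while the integrand is still measurable, before the
    comparison with F.\<close>
  also have "(\<integral>\<^sup>+u. (H u - 2 * ennreal (t - s)) \<partial>lborel) = 2 * (\<integral>\<^sup>+u. (H u - 2 * ennreal (t - s)) / 2 \<partial>lborel)"
  proof (subst nn_integral_cmult[symmetric])
    have "2 * (x / 2) = x" for x :: ennreal
      unfolding ennreal_times_divide mult.commute[of 2] by (rule ennreal_mult_divide_eq) auto
    then show "(\<integral>\<^sup>+u. (H u - 2 * ennreal (t - s)) \<partial>lborel) = (\<integral>\<^sup>+u. 2 * ((H u - 2 * ennreal (t - s)) / 2) \<partial>lborel)"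
      by simp
  qed measurable
  also have "(\<integral>\<^sup>+u. (H u - 2 * ennreal (t - s)) / 2 \<partial>lborel) \<le> (\<integral>\<^sup>+u\<in>{s..t}. F u \<partial>lborel)"
  proof (rule nn_integral_mono)
    fix u
    have "H u - 2 * ennreal (t - s) \<le> 2 * F u"
      using HF[of u] by (simp add: ennreal_minus_le_iff add.commute ennreal_mult_eq_top_iff)
    then show "(H u - 2 * ennreal (t - s)) / 2 \<le> F u * indicator {s..t} u"
      using Hout[of u] by (cases "u \<in> {s..t}") (auto simp: divide_le_posI_ennreal mult.commute)
  qed
  finally show ?thesis
    unfolding F_def using st by (simp add: power2_eq_square ennreal_mult mult.assoc add_mono mult_left_mono)
qed

section \<open>Second moments of the areas and of the roughness\<close>

lemma increment_nn_second_moment: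
  "0 \<le> t \<Longrightarrow> t \<le> u \<Longrightarrow> (\<integral>\<^sup>+\<omega>. ennreal ((W j u \<omega> - W j t \<omega>)\<^sup>2) \<partial>M) = ennreal (u - t)"
  by (subst nn_integral_eq_integral) (auto simp: increment_second_moment)

lemma increment_nn_fourth_moment:
  "0 \<le> t \<Longrightarrow> t \<le> u \<Longrightarrow> (\<integral>\<^sup>+\<omega>. ennreal ((W j u \<omega> - W j t \<omega>) ^ 4) \<partial>M) = ennreal (3 * (u - t)\<^sup>2)"
  by (subst nn_integral_eq_integral) (auto simp: increment_fourth_moment)

text \<open>The factor 4 results from splitting the square twice, once against the approximating
  simple integrals and once against the integrand. The order (t - s)^2 is what matters.\<close>

lemma iterated_integral_second_moment:
  assumes I: "is_iterated_integral M W r j s t I" and st: "0 \<le> s" "s \<le> t"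
  shows "(\<integral>\<^sup>+\<omega>. ennreal ((I \<omega>)\<^sup>2) \<partial>M) \<le> ennreal (4 * (t - s)\<^sup>2)"
proof -
  let ?X = "\<lambda>u \<omega>. W r u \<omega> - W r s \<omega>"
  obtain N p e where I_meas: "I \<in> borel_measurable M"
    and simple: "\<And>m. simple_integrand M (natural_filtration M W) s t (N m) (p m) (e m)"
    and a: "(\<lambda>m. \<integral>\<^sup>+u\<in>{s..t}. (\<integral>\<^sup>+\<omega>. ennreal ((simple_process (N m) (p m) (e m) u \<omega> - ?X u \<omega>)\<^sup>2) \<partial>M)
              \<partial>lborel) \<longlonglongrightarrow> 0" (is "?a \<longlonglongrightarrow> 0")
    and b: "(\<lambda>m. \<integral>\<^sup>+\<omega>. ennreal ((simple_integral (N m) (p m) (e m) (W j) \<omega> - I \<omega>)\<^sup>2) \<partial>M) \<longlonglongrightarrow> 0" (is "?b \<longlonglongrightarrow> 0")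
    using I unfolding is_iterated_integral_def has_ito_integral_def by blast
  let ?c = "ennreal ((t - s)\<^sup>2)"
  have "(\<integral>\<^sup>+\<omega>. ennreal ((I \<omega>)\<^sup>2) \<partial>M) \<le> 2 * ?b m + 2 * (2 * ?a m + 2 * ?c)" for m
  proof -
    let ?S = "simple_integral (N m) (p m) (e m) (W j)"
    have p: "0 \<le> p m 0" "mono_on {..N m} (p m)"
      "\<And>k. k < N m \<Longrightarrow> e m k \<in> borel_measurable (natural_filtration M W (p m k))"
      "\<And>k. k < N m \<Longrightarrow> integrable M (\<lambda>\<omega>. (e m k \<omega>)\<^sup>2)"
      using simple[of m] st unfolding simple_integrand_def by auto
    have S: "?S \<in> borel_measurable M"
      using simple_integral_isometry[of "p m" "N m" "e m" "N m" j] p filtration_measurable by blast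
    have "(\<integral>\<^sup>+\<omega>. ennreal ((I \<omega>)\<^sup>2) \<partial>M) \<le> 2 * (\<integral>\<^sup>+\<omega>. ennreal ((I \<omega> - ?S \<omega>)\<^sup>2) \<partial>M) + 2 * (\<integral>\<^sup>+\<omega>. ennreal ((?S \<omega>)\<^sup>2) \<partial>M)"
      by (rule nn_integral_square_split[OF I_meas S])
    also have "(\<integral>\<^sup>+\<omega>. ennreal ((I \<omega> - ?S \<omega>)\<^sup>2) \<partial>M) = ?b m" by (simp only: power2_commute)
    also have "(\<integral>\<^sup>+\<omega>. ennreal ((?S \<omega>)\<^sup>2) \<partial>M) \<le> 2 * ?a m + 2 * ?c"
    proof (rule simple_integral_second_moment[OF st simple])
      fix u assume u: "s \<le> u" "u \<le> t"
      show "?X u \<in> borel_measurable M" using u st by (intro borel_measurable_diff W_measurable) auto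
      show "(\<integral>\<^sup>+\<omega>. ennreal ((?X u \<omega>)\<^sup>2) \<partial>M) \<le> ennreal (t - s)"
        using u st by (simp add: increment_nn_second_moment ennreal_leI)
    qed
    finally show ?thesis by (simp add: mult_left_mono add_left_mono)
  qed
  moreover have "(\<lambda>m. 2 * ?b m + 2 * (2 * ?a m + 2 * ?c)) \<longlonglongrightarrow> 2 * 0 + 2 * (2 * 0 + 2 * ?c)"
    by (intro tendsto_add ennreal_tendsto_cmult a b tendsto_const) auto
  ultimately have "(\<integral>\<^sup>+\<omega>. ennreal ((I \<omega>)\<^sup>2) \<partial>M) \<le> 2 * 0 + 2 * (2 * 0 + 2 * ?c)"
    by (intro LIMSEQ_le_const) blast+
  also have "\<dots> = ennreal (4 * (t - s)\<^sup>2)"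
    by (simp add: ennreal_mult mult.assoc[symmetric])
  finally show ?thesis .
qed

text \<open>A diagonal Stratonovich term need not be measurable, hence the passage to a version.\<close>

lemma iterated_version:
  assumes A: "ito_iterated M W A \<or> stratonovich_iterated M W A" and st: "0 \<le> s" "s \<le> t"
  shows "\<exists>Z. Z \<in> borel_measurable M \<and> (AE \<omega> in M. A r j s t \<omega> = Z \<omega>) \<and>
    (\<integral>\<^sup>+\<omega>. ennreal ((Z \<omega>)\<^sup>2) \<partial>M) \<le> ennreal (4 * (t - s)\<^sup>2)"
proof (cases "is_iterated_integral M W r j s t (A r j s t)")
  case True
  then show ?thesis using iterated_integral_second_moment[OF True st]
    by (intro exI[of _ "A r j s t"]) (auto simp: is_iterated_integral_def has_ito_integral_def)
next
  case False
  with A st have "stratonovich_iterated M W A" by (auto simp: ito_iterated_def)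
  then have *: "if r = j then AE \<omega> in M. A j j s t \<omega> = (W j t \<omega> - W j s \<omega>)\<^sup>2 / 2
      else is_iterated_integral M W r j s t (A r j s t)"
    using st unfolding stratonovich_iterated_def by blast
  with False have "r = j" by (auto split: if_splits)
  with * have ae: "AE \<omega> in M. A j j s t \<omega> = (W j t \<omega> - W j s \<omega>)\<^sup>2 / 2" by simp
  let ?Z = "\<lambda>\<omega>. (W j t \<omega> - W j s \<omega>)\<^sup>2 / 2"
  have W: "W j t \<in> borel_measurable M" "W j s \<in> borel_measurable M" using st W_measurable by auto
  have "(\<integral>\<^sup>+\<omega>. ennreal ((?Z \<omega>)\<^sup>2) \<partial>M) \<le> (\<integral>\<^sup>+\<omega>. ennreal ((W j t \<omega> - W j s \<omega>) ^ 4) \<partial>M)"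
  proof (intro nn_integral_mono ennreal_leI)
    fix \<omega>
    have "(?Z \<omega>)\<^sup>2 = (W j t \<omega> - W j s \<omega>) ^ 4 / 4" by (simp add: power_divide flip: power_mult)
    also have "\<dots> \<le> (W j t \<omega> - W j s \<omega>) ^ 4" by simp
    finally show "(?Z \<omega>)\<^sup>2 \<le> (W j t \<omega> - W j s \<omega>) ^ 4" .
  qed
  also have "\<dots> = ennreal (3 * (t - s)\<^sup>2)" by (rule increment_nn_fourth_moment[OF st])
  also have "\<dots> \<le> ennreal (4 * (t - s)\<^sup>2)" by (intro ennreal_leI mult_right_mono) auto
  finally have "(\<integral>\<^sup>+\<omega>. ennreal ((?Z \<omega>)\<^sup>2) \<partial>M) \<le> ennreal (4 * (t - s)\<^sup>2)" .
  then show ?thesis using ae \<open>r = j\<close> W by (intro exI[of _ ?Z]) auto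
qed

lemma three_times_ennreal:
  assumes "0 \<le> x" "0 \<le> y" "0 \<le> z"
  shows "3 * (ennreal x + ennreal y + ennreal z) = ennreal (3 * (x + y + z))"
  using assms by (simp add: ennreal_mult)

text \<open>14 = 2 * 3 + 2 * 4, from the fourth moment 3 (t - s)^2 of an increment and the bound 4
  (t - s)^2 for an area; Cauchy-Schwarz over the indices and the number of terms produce the fourth
  power of the dimension.\<close>

lemma roughness_second_moment:
  assumes st: "0 \<le> s" "s \<le> t"
    and Z: "\<And>r j. Z r j s t \<in> borel_measurable M"
      "\<And>r j. (\<integral>\<^sup>+\<omega>. ennreal ((Z r j s t \<omega>)\<^sup>2) \<partial>M) \<le> ennreal (4 * (t - s)\<^sup>2)"
  shows "(\<integral>\<^sup>+\<omega>. ennreal ((roughness (\<lambda>j t. W j t \<omega>) (\<lambda>r j s t. Z r j s t \<omega>) s t)\<^sup>2) \<partial>M)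
    \<le> ennreal (14 * real CARD('d) ^ 4 * (t - s)\<^sup>2)"
proof -
  let ?d = "real CARD('d)"
  let ?w = "\<lambda>j \<omega>. W j t \<omega> - W j s \<omega>"
  have w[measurable]: "?w j \<in> borel_measurable M" for j using st by (intro borel_measurable_diff W_measurable) auto
  note [measurable] = Z(1)
  have cs: "(\<Sum>i\<in>(UNIV :: 'd set). x i)\<^sup>2 \<le> ?d * (\<Sum>i\<in>UNIV. (x i)\<^sup>2)" for x :: "'d \<Rightarrow> real"
    using sum_squared_le_sum_of_squares[of x UNIV] by (simp add: mult.commute)
  have pw: "(roughness (\<lambda>j t. W j t \<omega>) (\<lambda>r j s t. Z r j s t \<omega>) s t)\<^sup>2
     \<le> 2 * ?d ^ 3 * (\<Sum>j\<in>UNIV. ?w j \<omega> ^ 4) + 2 * ?d\<^sup>2 * (\<Sum>r\<in>UNIV. \<Sum>j\<in>UNIV. (Z r j s t \<omega>)\<^sup>2)" for \<omega>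
  proof -
    define P where "P = (\<Sum>j\<in>UNIV. \<bar>?w j \<omega>\<bar>)"
    define Q where "Q = (\<Sum>r\<in>UNIV. \<Sum>j\<in>UNIV. \<bar>Z r j s t \<omega>\<bar>)"
    have "P\<^sup>2 \<le> ?d * (\<Sum>j\<in>UNIV. (?w j \<omega>)\<^sup>2)" unfolding P_def using cs[of "\<lambda>j. \<bar>?w j \<omega>\<bar>"] by simp
    then have "(P\<^sup>2)\<^sup>2 \<le> (?d * (\<Sum>j\<in>UNIV. (?w j \<omega>)\<^sup>2))\<^sup>2" by (intro power_mono) auto
    also have "\<dots> = ?d\<^sup>2 * (\<Sum>j\<in>UNIV. (?w j \<omega>)\<^sup>2)\<^sup>2" by (simp add: power_mult_distrib)
    also have "\<dots> \<le> ?d\<^sup>2 * (?d * (\<Sum>j\<in>UNIV. ((?w j \<omega>)\<^sup>2)\<^sup>2))" by (intro mult_left_mono cs) auto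
    finally have P: "(P\<^sup>2)\<^sup>2 \<le> ?d ^ 3 * (\<Sum>j\<in>UNIV. ?w j \<omega> ^ 4)"
      by (simp add: power2_eq_square power3_eq_cube power4_eq_xxxx mult.assoc)
    have "Q\<^sup>2 \<le> ?d * (\<Sum>r\<in>UNIV. (\<Sum>j\<in>UNIV. \<bar>Z r j s t \<omega>\<bar>)\<^sup>2)" unfolding Q_def by (rule cs)
    also have "\<dots> \<le> ?d * (\<Sum>r\<in>UNIV. ?d * (\<Sum>j\<in>UNIV. \<bar>Z r j s t \<omega>\<bar>\<^sup>2))" by (intro mult_left_mono sum_mono cs) auto
    also have "\<dots> = ?d\<^sup>2 * (\<Sum>r\<in>UNIV. \<Sum>j\<in>UNIV. (Z r j s t \<omega>)\<^sup>2)"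
      by (simp add: power2_eq_square mult.assoc flip: sum_distrib_left)
    finally have Q: "Q\<^sup>2 \<le> ?d\<^sup>2 * (\<Sum>r\<in>UNIV. \<Sum>j\<in>UNIV. (Z r j s t \<omega>)\<^sup>2)" .
    have "(P\<^sup>2 + Q)\<^sup>2 \<le> 2 * (P\<^sup>2)\<^sup>2 + 2 * Q\<^sup>2" using square_split[of "P\<^sup>2 + Q" Q] by simp
    then show ?thesis using P Q by (simp add: roughness_def increment_sum_def area_sum_def P_def[symmetric] Q_def[symmetric])
  qed
  let ?S = "\<lambda>\<omega>. \<Sum>j\<in>UNIV. ennreal (?w j \<omega> ^ 4)" and ?Q = "\<lambda>\<omega>. \<Sum>r\<in>UNIV. \<Sum>j\<in>UNIV. ennreal ((Z r j s t \<omega>)\<^sup>2)"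
  have "(\<integral>\<^sup>+\<omega>. ennreal ((roughness (\<lambda>j t. W j t \<omega>) (\<lambda>r j s t. Z r j s t \<omega>) s t)\<^sup>2) \<partial>M)
     \<le> (\<integral>\<^sup>+\<omega>. ennreal (2 * ?d ^ 3) * ?S \<omega> + ennreal (2 * ?d\<^sup>2) * ?Q \<omega> \<partial>M)"
  proof (rule nn_integral_mono)
    fix \<omega>
    have "ennreal (2 * ?d ^ 3 * (\<Sum>j\<in>UNIV. ?w j \<omega> ^ 4) + 2 * ?d\<^sup>2 * (\<Sum>r\<in>UNIV. \<Sum>j\<in>UNIV. (Z r j s t \<omega>)\<^sup>2))
       = ennreal (2 * ?d ^ 3 * (\<Sum>j\<in>UNIV. ?w j \<omega> ^ 4)) + ennreal (2 * ?d\<^sup>2 * (\<Sum>r\<in>UNIV. \<Sum>j\<in>UNIV. (Z r j s t \<omega>)\<^sup>2))"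
      by (intro ennreal_plus mult_nonneg_nonneg sum_nonneg) auto
    also have "\<dots> = ennreal (2 * ?d ^ 3) * ?S \<omega> + ennreal (2 * ?d\<^sup>2) * ?Q \<omega>"
      by (simp add: ennreal_mult sum_nonneg)
    finally show "ennreal ((roughness (\<lambda>j t. W j t \<omega>) (\<lambda>r j s t. Z r j s t \<omega>) s t)\<^sup>2) \<le> ennreal (2 * ?d ^ 3) * ?S \<omega> + ennreal (2 * ?d\<^sup>2) * ?Q \<omega>"
      using ennreal_leI[OF pw[of \<omega>]] by simp
  qed
  also have "\<dots> = ennreal (2 * ?d ^ 3) * (\<Sum>j\<in>UNIV. \<integral>\<^sup>+\<omega>. ennreal (?w j \<omega> ^ 4) \<partial>M)
      + ennreal (2 * ?d\<^sup>2) * (\<Sum>r\<in>UNIV. \<Sum>j\<in>UNIV. \<integral>\<^sup>+\<omega>. ennreal ((Z r j s t \<omega>)\<^sup>2) \<partial>M)"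
    by (simp add: nn_integral_add nn_integral_cmult nn_integral_sum del: sum_ennreal)
  also have "\<dots> \<le> ennreal (2 * ?d ^ 3) * (\<Sum>j\<in>(UNIV :: 'd set). ennreal (3 * (t - s)\<^sup>2))
      + ennreal (2 * ?d\<^sup>2) * (\<Sum>r\<in>(UNIV :: 'd set). \<Sum>j\<in>(UNIV :: 'd set). ennreal (4 * (t - s)\<^sup>2))"
    by (intro add_mono mult_left_mono sum_mono Z) (auto simp: increment_nn_fourth_moment[OF st])
  also have "\<dots> = ennreal (2 * ?d ^ 3 * (?d * (3 * (t - s)\<^sup>2)) + 2 * ?d\<^sup>2 * (?d * (?d * (4 * (t - s)\<^sup>2))))"
  proof -
    have sum: "(\<Sum>j\<in>(UNIV :: 'd set). ennreal q) = ennreal (?d * q)" if "0 \<le> q" for q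
      by (subst sum_ennreal) (use that in auto)
    have "ennreal x * ennreal y + ennreal z * ennreal u = ennreal (x * y + z * u)"
      if "0 \<le> x" "0 \<le> y" "0 \<le> z" "0 \<le> u" for x y z u
      using that by (simp add: ennreal_mult ennreal_plus)
    from this[of "2 * ?d ^ 3" "?d * (3 * (t - s)\<^sup>2)" "2 * ?d\<^sup>2" "?d * (?d * (4 * (t - s)\<^sup>2))"] show ?thesis
      by (simp only: sum zero_le_power2 mult_nonneg_nonneg zero_le_numeral of_nat_0_le_iff zero_le_power)
  qed
  also have "2 * ?d ^ 3 * (?d * (3 * (t - s)\<^sup>2)) + 2 * ?d\<^sup>2 * (?d * (?d * (4 * (t - s)\<^sup>2))) = 14 * ?d ^ 4 * (t - s)\<^sup>2"
    by (simp add: power2_eq_square power3_eq_cube power4_eq_xxxx algebra_simps)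
  finally show ?thesis .
qed

text \<open>Moments are computed for measurable versions of the areas. Tameness involves only dyadic
  intervals, so countably many null sets separate the versions from \<open>A\<close>.\<close>

lemma tame_AE:
  assumes A: "ito_iterated M W A \<or> stratonovich_iterated M W A" and T: "0 \<le> T"
  shows "AE \<omega> in M. tame (\<lambda>j t. W j t \<omega>) (\<lambda>r j s t. A r j s t \<omega>) T"
proof -
  define good where "good r j s t Z \<longleftrightarrow> Z \<in> borel_measurable M \<and> (AE \<omega> in M. A r j s t \<omega> = Z \<omega>) \<and>
    (\<integral>\<^sup>+\<omega>. ennreal ((Z \<omega>)\<^sup>2) \<partial>M) \<le> ennreal (4 * (t - s)\<^sup>2)" for r j s t Z
  define Z where "Z r j s t = (SOME Z. good r j s t Z)" for r j s t
  have "good r j s t (Z r j s t)" if "0 \<le> s" "s \<le> t" for r j s t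
  proof -
    have "\<exists>Z. good r j s t Z" unfolding good_def by (rule iterated_version[OF A that])
    then show ?thesis unfolding Z_def by (rule someI_ex)
  qed
  then have Z: "Z r j s t \<in> borel_measurable M" "AE \<omega> in M. A r j s t \<omega> = Z r j s t \<omega>"
    "(\<integral>\<^sup>+\<omega>. ennreal ((Z r j s t \<omega>)\<^sup>2) \<partial>M) \<le> ennreal (4 * (t - s)\<^sup>2)" if "0 \<le> s" "s \<le> t" for r j s t
    using that unfolding good_def by blast+
  define V where "V \<omega> m k = dyadic_roughness (\<lambda>j t. W j t \<omega>) (\<lambda>r j s t. Z r j s t \<omega>) T m k" for \<omega> m k
  define x where "x m k = dyadic T (Suc m) (2 * k)" for m k
  define y where "y m k = dyadic T (Suc m) (2 * k + 1)" for m k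
  define z where "z m k = dyadic T (Suc m) (2 * k + 2)" for m k
  have xyz: "0 \<le> x m k" "x m k \<le> y m k" "y m k \<le> z m k" "0 \<le> y m k"
    "y m k - x m k = T / 2 ^ m / 2" "z m k - y m k = T / 2 ^ m / 2" for m k
    using T by (auto simp: x_def y_def z_def dyadic_def field_simps)
  have V_eq: "V \<omega> m k = roughness (\<lambda>j t. W j t \<omega>) (\<lambda>r j s t. Z r j s t \<omega>) (x m k) (y m k)
      + roughness (\<lambda>j t. W j t \<omega>) (\<lambda>r j s t. Z r j s t \<omega>) (y m k) (z m k) + T / 2 ^ m" for \<omega> m k
    by (simp add: V_def dyadic_roughness_def x_def y_def z_def)
  have rm[measurable]: "(\<lambda>\<omega>. roughness (\<lambda>j t. W j t \<omega>) (\<lambda>r j s t. Z r j s t \<omega>) s t) \<in> borel_measurable M" if "0 \<le> s" "s \<le> t" for s t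
    unfolding roughness_def increment_sum_def area_sum_def using that
    by (intro borel_measurable_add borel_measurable_power borel_measurable_sum borel_measurable_abs borel_measurable_diff W_measurable Z) auto
  have V_meas: "(\<lambda>\<omega>. V \<omega> m k) \<in> borel_measurable M" for m k
    unfolding V_eq using xyz by (intro borel_measurable_add rm) auto
  define K where "K = 14 * real CARD('d) ^ 4"
  have K: "0 \<le> K" by (simp add: K_def)
  have V_bound: "(\<integral>\<^sup>+\<omega>. ennreal ((V \<omega> m k)\<^sup>2) \<partial>M) \<le> ennreal ((3 * (K + 1)) * (T / 2 ^ m)\<^sup>2)" for m k
  proof -
    let ?u = "\<lambda>\<omega>. roughness (\<lambda>j t. W j t \<omega>) (\<lambda>r j s t. Z r j s t \<omega>) (x m k) (y m k)"
    let ?v = "\<lambda>\<omega>. roughness (\<lambda>j t. W j t \<omega>) (\<lambda>r j s t. Z r j s t \<omega>) (y m k) (z m k)"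
    let ?h = "T / 2 ^ m"
    have uv[measurable]: "?u \<in> borel_measurable M" "?v \<in> borel_measurable M" using xyz by (auto intro!: rm)
    have *: "(a + b + c)\<^sup>2 \<le> 3 * (a\<^sup>2 + b\<^sup>2 + c\<^sup>2)" for a b c :: real
      using zero_le_power2[of "a - b"] zero_le_power2[of "b - c"] zero_le_power2[of "a - c"]
      by (simp add: power2_eq_square algebra_simps)
    have "(\<integral>\<^sup>+\<omega>. ennreal ((V \<omega> m k)\<^sup>2) \<partial>M) \<le> (\<integral>\<^sup>+\<omega>. 3 * (ennreal ((?u \<omega>)\<^sup>2) + ennreal ((?v \<omega>)\<^sup>2) + ennreal (?h\<^sup>2)) \<partial>M)"
    proof (rule nn_integral_mono)
      fix \<omega>
      have "ennreal ((V \<omega> m k)\<^sup>2) \<le> ennreal (3 * ((?u \<omega>)\<^sup>2 + (?v \<omega>)\<^sup>2 + ?h\<^sup>2))" unfolding V_eq by (intro ennreal_leI *)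
      also have "\<dots> = 3 * (ennreal ((?u \<omega>)\<^sup>2) + ennreal ((?v \<omega>)\<^sup>2) + ennreal (?h\<^sup>2))"
        by (intro three_times_ennreal[symmetric]) auto
      finally show "ennreal ((V \<omega> m k)\<^sup>2) \<le> 3 * (ennreal ((?u \<omega>)\<^sup>2) + ennreal ((?v \<omega>)\<^sup>2) + ennreal (?h\<^sup>2))" .
    qed
    also have "\<dots> = 3 * ((\<integral>\<^sup>+\<omega>. ennreal ((?u \<omega>)\<^sup>2) \<partial>M) + (\<integral>\<^sup>+\<omega>. ennreal ((?v \<omega>)\<^sup>2) \<partial>M) + ennreal (?h\<^sup>2))"
      by (simp add: nn_integral_cmult nn_integral_add emeasure_space_1)
    also have "\<dots> \<le> 3 * (ennreal (K * (?h / 2)\<^sup>2) + ennreal (K * (?h / 2)\<^sup>2) + ennreal (?h\<^sup>2))"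
    proof (intro mult_left_mono add_mono order_refl)
      show "(\<integral>\<^sup>+\<omega>. ennreal ((?u \<omega>)\<^sup>2) \<partial>M) \<le> ennreal (K * (?h / 2)\<^sup>2)"
        unfolding K_def xyz(5)[of m k, symmetric] by (intro roughness_second_moment Z xyz)
      show "(\<integral>\<^sup>+\<omega>. ennreal ((?v \<omega>)\<^sup>2) \<partial>M) \<le> ennreal (K * (?h / 2)\<^sup>2)"
        unfolding K_def xyz(6)[of m k, symmetric] by (intro roughness_second_moment Z xyz)
    qed auto
    also have "\<dots> = ennreal (3 * (K * (?h / 2)\<^sup>2 + K * (?h / 2)\<^sup>2 + ?h\<^sup>2))"
      using K by (intro three_times_ennreal) auto
    also have "\<dots> \<le> ennreal ((3 * (K + 1)) * ?h\<^sup>2)"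
    proof (rule ennreal_leI)
      have "3 * (K * (h / 2)\<^sup>2 + K * (h / 2)\<^sup>2 + h\<^sup>2) = 3 * (K / 2 + 1) * h\<^sup>2" for h
        by (simp add: power2_eq_square field_simps)
      from this[of ?h] have "3 * (K * (?h / 2)\<^sup>2 + K * (?h / 2)\<^sup>2 + ?h\<^sup>2) = 3 * (K / 2 + 1) * ?h\<^sup>2" .
      also have "\<dots> \<le> 3 * (K + 1) * ?h\<^sup>2" using K by (intro mult_right_mono) auto
      finally show "3 * (K * (?h / 2)\<^sup>2 + K * (?h / 2)\<^sup>2 + ?h\<^sup>2) \<le> 3 * (K + 1) * ?h\<^sup>2" .
    qed
    finally show ?thesis .
  qed
  have "AE \<omega> in M. \<forall>\<eta>>0. \<exists>m0. \<forall>m\<ge>m0. \<forall>k<2 ^ m. \<exists>\<^sub>\<infinity>n. tree_sum (V \<omega>) n m k \<le> \<eta> * real n"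
    using tree_sum_tame_AE[where V=V, OF V_meas V_bound] K by simp
  moreover have "AE \<omega> in M. \<forall>r j. \<forall>m k. A r j (x m k) (y m k) \<omega> = Z r j (x m k) (y m k) \<omega>"
    unfolding AE_all_countable using Z(2) xyz by (simp add: eventually_all_finite)
  moreover have "AE \<omega> in M. \<forall>r j. \<forall>m k. A r j (y m k) (z m k) \<omega> = Z r j (y m k) (z m k) \<omega>"
    unfolding AE_all_countable using Z(2) xyz by (simp add: eventually_all_finite)
  ultimately show ?thesis
  proof eventually_elim
    case (elim \<omega>)
    have "dyadic_roughness (\<lambda>j t. W j t \<omega>) (\<lambda>r j s t. A r j s t \<omega>) T = V \<omega>"
      using elim(2,3) by (intro ext) (simp add: V_eq dyadic_roughness_def roughness_def area_sum_def x_def y_def z_def)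
    then show ?case unfolding tame_def using elim(1) by simp
  qed
qed

end

text \<open>The choice p = 5/2 gives the exponent 2/5, which exceeds 1/3; any p strictly between 2
  and 3 would give an exponent above 1/3.\<close>

lemma rough_hoelder_sums:
  fixes w :: "'d::finite \<Rightarrow> real \<Rightarrow> real"
  assumes "rough_hoelder_bounds w a"
  obtains c where "0 \<le> c"
    "\<And>s t. 0 \<le> s \<Longrightarrow> s \<le> t \<Longrightarrow> t \<le> T \<Longrightarrow> increment_sum w s t \<le> c * (t - s) powr (2 / 5)"
    "\<And>s t. 0 \<le> s \<Longrightarrow> s \<le> t \<Longrightarrow> t \<le> T \<Longrightarrow> area_sum a s t \<le> c * (t - s) powr (2 * (2 / 5))"
proof -
  obtain c0 where c0: "\<And>s t. 0 \<le> s \<Longrightarrow> s \<le> t \<Longrightarrow> t \<le> T \<Longrightarrow>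
      norm ((\<chi> j. w j t - w j s) :: real ^ 'd) \<le> c0 * (t - s) powr (1 / (5 / 2)) \<and>
      (\<forall>r j. \<bar>a r j s t\<bar> \<le> c0 * (t - s) powr (2 / (5 / 2)))"
  proof -
    have "2 < (5 / 2 :: real)" by simp
    with assms have "\<exists>c. \<forall>s t. 0 \<le> s \<and> s \<le> t \<and> t \<le> T \<longrightarrow>
        norm ((\<chi> j. w j t - w j s) :: real ^ 'd) \<le> c * (t - s) powr (1 / (5 / 2)) \<and>
        (\<forall>r j. \<bar>a r j s t\<bar> \<le> c * (t - s) powr (2 / (5 / 2)))"
      unfolding rough_hoelder_bounds_def by blast
    then show thesis using that by blast
  qed
  define b where "b = max c0 0"
  let ?d = "real CARD('d)"
  have b: "0 \<le> b" "c0 * x powr e \<le> b * x powr e" for x e by (auto simp: b_def intro: mult_right_mono)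
  show thesis
  proof (rule that[of "?d * ?d * b"])
    show "0 \<le> ?d * ?d * b" using b by simp
    fix s t assume st: "0 \<le> s" "s \<le> t" "t \<le> T"
    have "\<bar>w j t - w j s\<bar> \<le> b * (t - s) powr (2 / 5)" for j
      using component_le_norm_cart[of "\<chi> j. w j t - w j s" j] c0[OF st] b(2)[of "t - s" "2 / 5"] by simp
    then have "increment_sum w s t \<le> (\<Sum>j\<in>(UNIV :: 'd set). b * (t - s) powr (2 / 5))"
      unfolding increment_sum_def by (intro sum_mono)
    \<comment> \<open>The factor 1 is then raised to the dimension, so that the increments and the
      areas share one constant.\<close>
    also have "\<dots> = 1 * (?d * (b * (t - s) powr (2 / 5)))" by simp
    also have "\<dots> \<le> ?d * (?d * (b * (t - s) powr (2 / 5)))"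
      using b by (intro mult_right_mono) (auto simp: Suc_le_eq)
    finally show "increment_sum w s t \<le> ?d * ?d * b * (t - s) powr (2 / 5)" by (simp only: mult.assoc)
    have "\<bar>a r j s t\<bar> \<le> b * (t - s) powr (2 * (2 / 5))" for r j
      using conjunct2[OF c0[OF st], rule_format, of r j] b(2)[of "t - s" "2 * (2 / 5)"] by simp
    then have "area_sum a s t \<le> (\<Sum>r\<in>(UNIV :: 'd set). \<Sum>j\<in>(UNIV :: 'd set). b * (t - s) powr (2 * (2 / 5)))"
      unfolding area_sum_def by (intro sum_mono)
    then show "area_sum a s t \<le> ?d * ?d * b * (t - s) powr (2 * (2 / 5))" by (simp add: mult.assoc)
  qed
qed

theorem theorem4p10:
  fixes M :: "'a measure"
    and W :: "'d::finite \<Rightarrow> real \<Rightarrow> 'a \<Rightarrow> real"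
    and A :: "'d \<Rightarrow> 'd \<Rightarrow> real \<Rightarrow> real \<Rightarrow> 'a \<Rightarrow> real"
    and T :: real
  assumes "independent_brownian_motions M W"
    and "ito_iterated M W A \<or> stratonovich_iterated M W A"
    and "AE \<omega> in M. chen_relation (\<lambda>j t. W j t \<omega>) (\<lambda>r j s t. A r j s t \<omega>)"
    and "AE \<omega> in M. rough_hoelder_bounds (\<lambda>j t. W j t \<omega>) (\<lambda>r j s t. A r j s t \<omega>)"
    and "0 < T"
  shows "AE \<omega> in M. \<forall>(f :: 'n::finite \<Rightarrow> 'd \<Rightarrow> real ^ 'n \<Rightarrow> real) y0. C2_coeff f \<longrightarrow>
           (let w = (\<lambda>j t. W j t \<omega>); a = (\<lambda>r j s t. A r j s t \<omega>) in
            \<exists>\<tau> y. 0 < \<tau> \<and> \<tau> \<le> T \<and>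
              solution_before f w a y0 \<tau> y \<and>
              (\<tau> < T \<longrightarrow> filterlim (\<lambda>t. norm (y t)) at_top (at_left \<tau>)) \<and>
              (\<forall>t y'. 0 \<le> t \<and> t < \<tau> \<and> solution_on f w a y0 t y' \<longrightarrow>
                 (\<forall>s\<in>{0..t}. y' s = y s)))"
proof -
  interpret brownian_family M W by unfold_locales (fact assms(1))
  have "AE \<omega> in M. tame (\<lambda>j t. W j t \<omega>) (\<lambda>r j s t. A r j s t \<omega>) T"
    using tame_AE[OF assms(2)] assms(5) by simp
  with assms(3,4) show ?thesis
  proof eventually_elim
    case (elim \<omega>)
    obtain c where c: "0 \<le> c"
      "\<And>s t. 0 \<le> s \<Longrightarrow> s \<le> t \<Longrightarrow> t \<le> T \<Longrightarrow> increment_sum (\<lambda>j t. W j t \<omega>) s t \<le> c * (t - s) powr (2 / 5)"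
      "\<And>s t. 0 \<le> s \<Longrightarrow> s \<le> t \<Longrightarrow> t \<le> T \<Longrightarrow> area_sum (\<lambda>r j s t. A r j s t \<omega>) s t \<le> c * (t - s) powr (2 * (2 / 5))"
      using rough_hoelder_sums[OF elim(2)] by blast
    show ?case
      unfolding Let_def
    proof (intro allI impI)
      fix f :: "'n \<Rightarrow> 'd \<Rightarrow> real ^ 'n \<Rightarrow> real" and y0
      assume f: "C2_coeff f"
      interpret tame_equation f "\<lambda>j t. W j t \<omega>" "\<lambda>r j s t. A r j s t \<omega>" c "2 / 5" T y0
        by (rule tame_equation.intro[OF f elim(1) c(2,3,1) _ assms(5) elim(3)]) auto
      show "\<exists>\<tau> y. 0 < \<tau> \<and> \<tau> \<le> T \<and>
          solution_before f (\<lambda>j t. W j t \<omega>) (\<lambda>r j s t. A r j s t \<omega>) y0 \<tau> y \<and>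
          (\<tau> < T \<longrightarrow> filterlim (\<lambda>t. norm (y t)) at_top (at_left \<tau>)) \<and>
          (\<forall>t y'. 0 \<le> t \<and> t < \<tau> \<and> solution_on f (\<lambda>j t. W j t \<omega>) (\<lambda>r j s t. A r j s t \<omega>) y0 t y' \<longrightarrow>
             (\<forall>s\<in>{0..t}. y' s = y s))"
        by (rule pathwise_theorem)
    qed
  qed
qed

end
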